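(* Let $G=\sum_{l\geq 1}v_l\delta_{\xi_l}$ be a discrete random probability measure on the unit ball of a separable Hilbert space $H$, with random weights $(v_l)_{l\ge1}$, $v_l>0$, arranged in non-increasing order, and distinct random points $(\xi_l)_{l\geq 1}$ of the unit ball of $H$. If $G$ satisfies the Ghirlanda-Guerra identities, then the Gram matrix $Q=(\xi_l\cdot\xi_{l'})_{l,l'\geq 1}$ is weakly exchangeable and is independent of the weights $(v_l)_{l\ge1}$.
   Context: $(\sigma^l)_{l\geq 1}$ is an i.i.d. sequence from $G$; $\langle\cdot\rangle$ is the average with respect to $G^{\otimes\infty}$; $\mathbb{E}$ is the expectation with respect to the randomness of $G$. $R_{l,l'}=\sigma^l\cdot\sigma^{l'}$ is the scalar product (overlap). Ghirlanda-Guerra identities: for any $n\geq 2$, any bounded measurable function $f$ of the overlaps $(R_{l,l'})_{l,l'\leq n}$ and any bounded measurable function $\psi$ of one overlap, $$\mathbb{E}\langle f\psi(R_{1,n+1})\rangle=\frac1n\,\mathbb{E}\langle f\rangle\,\mathbb{E}\langle\psi(R_{1,2})\rangle+\frac1n\sum_{l=2}^n\mathbb{E}\langle f\psi(R_{1,l})\rangle .$$ The matrix $Q$ is called weakly exchangeable if for any permutation $\rho$ of finitely many indices, $(\xi_{\rho(l)}\cdot\xi_{\rho(l')})_{l,l'\ge 1}\stackrel{d}{=}(\xi_l\cdot\xi_{l'})_{l,l'\geq 1}$. *)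

theory Defs
  imports "HOL-Probability.Probability" "HOL-Combinatorics.Permutations"
begin

(* All sequences (atoms, replicas) are indexed from 0: index l here is index l + 1 in the
   usual notation, and the replicas 1, ..., n become {..<n}. *)

text \<open>The atomic measure \<open>\<Sum>l. v l \<cdot> \<delta>(\<xi> l)\<close> on the Borel sets, obtained as
  the push-forward under \<open>\<xi>\<close> of the measure on the indices with masses \<open>v l\<close>.\<close>

definition atomic_measure :: "(nat \<Rightarrow> real) \<Rightarrow> (nat \<Rightarrow> 'h::topological_space) \<Rightarrow> 'h measure" where
  "atomic_measure v \<xi> = distr (density (count_space UNIV) (\<lambda>l. ennreal (v l))) borel \<xi>"

definition replica_average :: "'h measure \<Rightarrow> ((nat \<Rightarrow> 'h) \<Rightarrow> real) \<Rightarrow> real" where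
  "replica_average g F = (\<integral>\<sigma>. F \<sigma> \<partial>(\<Pi>\<^sub>M l\<in>(UNIV :: nat set). g))"

definition mean_average ::
  "'w measure \<Rightarrow> ('w \<Rightarrow> 'h measure) \<Rightarrow> ((nat \<Rightarrow> 'h) \<Rightarrow> real) \<Rightarrow> real" where
  "mean_average M G F = (\<integral>\<omega>. replica_average (G \<omega>) F \<partial>M)"

definition gram :: "(nat \<Rightarrow> 'h::real_inner) \<Rightarrow> nat \<times> nat \<Rightarrow> real" where
  "gram x = (\<lambda>(l, l'). x l \<bullet> x l')"

definition ghirlanda_guerra ::
  "'w measure \<Rightarrow> ('w \<Rightarrow> 'h::real_inner measure) \<Rightarrow> bool" where
  "ghirlanda_guerra M G \<longleftrightarrow>
    (\<forall>n\<ge>2. \<forall>f \<psi>.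
       f \<in> borel_measurable (\<Pi>\<^sub>M p\<in>{..<n} \<times> {..<n}. (borel :: real measure)) \<longrightarrow>
       bounded (f ` space (\<Pi>\<^sub>M p\<in>{..<n} \<times> {..<n}. (borel :: real measure))) \<longrightarrow>
       \<psi> \<in> borel_measurable (borel :: real measure) \<longrightarrow> bounded (range \<psi>) \<longrightarrow>
       (let F = (\<lambda>\<sigma>. f (restrict (gram \<sigma>) ({..<n} \<times> {..<n})) :: real) in
        mean_average M G (\<lambda>\<sigma>. F \<sigma> * \<psi> (\<sigma> 0 \<bullet> \<sigma> n)) =
          1 / real n * mean_average M G F * mean_average M G (\<lambda>\<sigma>. \<psi> (\<sigma> 0 \<bullet> \<sigma> 1))
          + 1 / real n * (\<Sum>l = 1..<n. mean_average M G (\<lambda>\<sigma>. F \<sigma> * \<psi> (\<sigma> 0 \<bullet> \<sigma> l)))))"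

abbreviation array_borel :: "(nat \<times> nat \<Rightarrow> real) measure" where
  "array_borel \<equiv> \<Pi>\<^sub>M p\<in>UNIV. borel"

abbreviation seq_borel :: "(nat \<Rightarrow> real) measure" where
  "seq_borel \<equiv> \<Pi>\<^sub>M l\<in>UNIV. borel"

definition weakly_exchangeable :: "'w measure \<Rightarrow> ('w \<Rightarrow> nat \<times> nat \<Rightarrow> real) \<Rightarrow> bool" where
  "weakly_exchangeable M Q \<longleftrightarrow>
    Q \<in> measurable M array_borel \<and>
    (\<forall>\<rho>. permutation \<rho> \<longrightarrow>
      distr M array_borel (\<lambda>\<omega> (l, l'). Q \<omega> (\<rho> l, \<rho> l')) = distr M array_borel Q)"

text \<open>This is \<open>prob_space.indep_var\<close> (in the form of \<open>indep_var_eq\<close>) for random variables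
  whose values need not have the same type.\<close>

definition indep_rv ::
  "'w measure \<Rightarrow> 'a measure \<Rightarrow> ('w \<Rightarrow> 'a) \<Rightarrow> 'b measure \<Rightarrow> ('w \<Rightarrow> 'b) \<Rightarrow> bool" where
  "indep_rv M S X T Y \<longleftrightarrow>
    X \<in> measurable M S \<and> Y \<in> measurable M T \<and>
    prob_space.indep_set M
      (sigma_sets (space M) {X -` A \<inter> space M | A. A \<in> sets S})
      (sigma_sets (space M) {Y -` A \<inter> space M | A. A \<in> sets T})"

end

theory Submission
  imports Defs
begin

text \<open>
  The replicas are written \<open>\<sigma> i = \<xi> (\<iota> i)\<close>, where, given the weights \<open>v\<close> and the atoms \<open>\<xi>\<close>, the indices
  \<open>\<iota> i\<close> are independent with law \<open>v\<close>; all arguments take place under the joint law \<open>P\<close> of the weights,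
  the atoms and the indices.

  All atoms lie on one sphere. For two replicas the identities and the exchangeability of the replicas
  say that the self-overlap of \<open>\<sigma> 0\<close> is independent of its overlap with \<open>\<sigma> 1\<close>. Let \<open>q\<close> be the largest
  point of the support of the law of that overlap. Every atom is drawn twice with positive probability,
  hence its self-overlap is at most \<open>q\<close>. If the self-overlap of \<open>\<sigma> 0\<close> is at most \<open>q - \<epsilon>\<close>, the overlap with
  \<open>\<sigma> 1\<close> is at most \<open>q - \<epsilon> / 2\<close> by the inequality of the arithmetic and geometric means, and independence
  forces such a self-overlap to have probability \<open>0\<close> (\<open>AE_self_overlap\<close>). Since the atoms are distinct,
  two replicas coincide exactly when their overlap is \<open>q\<close>.

  Coincidences do not see the geometry. Applied to the indicator of \<open>q\<close>, the identities express the
  probability that a new replica coincides with an old one, on an event of the array of the first \<open>n\<close>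
  replicas, through coincidences between the first \<open>n\<close> replicas. By induction on the number of replicas,
  given that the first \<open>k\<close> replicas are distinct, their array is independent of any event of coincidence
  between finitely many replicas (\<open>integral_deviation_equalities\<close>). The weights of the first \<open>k\<close>
  replicas and the power sums \<open>\<Sum>l. v l ^ a\<close> are conditional probabilities of coincidences with new
  replicas, so that the independence extends to monomials in these variables, and by Weierstrass'
  theorem to all their bounded measurable functions. As the power sums determine \<open>v\<close>, the array of \<open>k\<close>
  distinct replicas is independent of \<open>v\<close> together with the weights of these replicas
  (\<open>integral_deviation_weights\<close>).

  No two weights are equal (\<open>AE_inj_weights\<close>). The coincidences with two given distinct replicas have
  the transition probabilities of a Polya urn. In terms of moments, the share of the first atom in the
  total weight of a pair satisfies the recursion of a symmetric beta law, also when localized by the total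
  weight. It follows that the \<open>N\<close>-th moment of \<open>4 w (1 - w)\<close>, where \<open>w\<close> is this share, tends to \<open>0\<close>, which
  excludes \<open>w = 1 / 2\<close>.

  Conclusion. As the weights are distinct, the weights of the first \<open>k\<close> replicas reveal which atoms
  have been drawn. Hence, for every injective \<open>\<rho>\<close>, the array of the atoms \<open>\<rho> 0, \<dots>, \<rho> (k - 1)\<close> is independent
  of \<open>v\<close>, with a law that does not depend on \<open>\<rho>\<close> (\<open>reindexed_independent\<close>). This is weak exchangeability
  and independence at once.
\<close>

section \<open>The moment problem for signed images of a measure\<close>

lemma integrable_mult_bounded:
  fixes Z Y :: "'a \<Rightarrow> real"
  assumes "integrable M Z" "Y \<in> borel_measurable M" "\<And>x. x \<in> space M \<Longrightarrow> \<bar>Y x\<bar> \<le> C"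
  shows "integrable M (\<lambda>x. Z x * Y x)"
proof (rule Bochner_Integration.integrable_bound)
  show "integrable M (\<lambda>x. C * Z x)" using assms(1) by simp
  show "(\<lambda>x. Z x * Y x) \<in> borel_measurable M" using assms by measurable
  show "AE x in M. norm (Z x * Y x) \<le> norm (C * Z x)"
  proof (rule AE_I2)
    fix x assume "x \<in> space M"
    then have "\<bar>Y x\<bar> \<le> \<bar>C\<bar>" using assms(3)[of x] by linarith
    then show "norm (Z x * Y x) \<le> norm (C * Z x)"
      unfolding real_norm_def abs_mult by (subst mult.commute) (rule mult_right_mono, auto)
  qed
qed

text \<open>A signed density \<open>Z\<close> is handled through its positive and negative parts: the function
  \<open>\<lambda>x. ennreal (Z x)\<close> is the positive part of \<open>Z\<close>, since \<open>ennreal\<close> sends negative numbers to \<open>0\<close>.\<close>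

lemma emeasure_image_positive_part:
  fixes Z :: "'a \<Rightarrow> real"
  assumes Z: "integrable M Z" and X: "X \<in> measurable M N" and A: "A \<in> sets N"
  shows "emeasure (distr (density M (\<lambda>x. ennreal (Z x))) N X) A
    = ennreal (\<integral>x. max 0 (Z x) * indicator A (X x) \<partial>M)"
proof -
  note [measurable] = X A borel_measurable_integrable[OF Z]
  have int: "integrable M (\<lambda>x. max 0 (Z x) * indicator A (X x))"
    using Z by (intro integrable_mult_bounded[where C=1]) (auto simp: indicator_def)
  have "emeasure (distr (density M (\<lambda>x. ennreal (Z x))) N X) A
     = (\<integral>\<^sup>+x. ennreal (Z x) * indicator (X -` A \<inter> space M) x \<partial>M)"
    by (simp add: emeasure_distr emeasure_density)
  also have "\<dots> = (\<integral>\<^sup>+x. ennreal (max 0 (Z x) * indicator A (X x)) \<partial>M)"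
    by (intro nn_integral_cong) (auto simp: indicator_def max_def ennreal_neg)
  also have "\<dots> = ennreal (\<integral>x. max 0 (Z x) * indicator A (X x) \<partial>M)"
    by (rule nn_integral_eq_integral[OF int]) (auto simp: indicator_def)
  finally show ?thesis .
qed

lemma emeasure_image_signed_eq_iff:
  fixes Z :: "'a \<Rightarrow> real"
  assumes Z: "integrable M Z" and X: "X \<in> measurable M N" and A: "A \<in> sets N"
  shows "emeasure (distr (density M (\<lambda>x. ennreal (Z x))) N X) A
      = emeasure (distr (density M (\<lambda>x. ennreal (- Z x))) N X) A
    \<longleftrightarrow> (\<integral>x. Z x * indicator A (X x) \<partial>M) = 0"
proof -
  note [measurable] = X A borel_measurable_integrable[OF Z]
  have i1: "integrable M (\<lambda>x. max 0 (Z x) * indicator A (X x))"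
    using Z by (intro integrable_mult_bounded[where C=1]) (auto simp: indicator_def)
  have i2: "integrable M (\<lambda>x. max 0 (- Z x) * indicator A (X x))"
    using Z by (intro integrable_mult_bounded[where C=1]) (auto simp: indicator_def)
  have "(\<integral>x. Z x * indicator A (X x) \<partial>M) =
    (\<integral>x. max 0 (Z x) * indicator A (X x) - max 0 (- Z x) * indicator A (X x) \<partial>M)"
    by (intro Bochner_Integration.integral_cong) (auto simp: indicator_def max_def)
  also have "\<dots> = (\<integral>x. max 0 (Z x) * indicator A (X x) \<partial>M) - (\<integral>x. max 0 (- Z x) * indicator A (X x) \<partial>M)"
    using i1 i2 by simp
  finally show ?thesis
    using Z by (simp add: emeasure_image_positive_part X A Bochner_Integration.integral_nonneg)
qed

lemma finite_measure_image_positive_part: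
  fixes Z :: "'a \<Rightarrow> real"
  assumes Z: "integrable M Z" and X: "X \<in> measurable M N"
  shows "finite_measure (distr (density M (\<lambda>x. ennreal (Z x))) N X)"
  by (rule finite_measureI)
     (simp only: space_distr emeasure_image_positive_part[OF Z X sets.top] ennreal_neq_top infinity_ennreal_def not_False_eq_True)

text \<open>The one-dimensional moment problem on \<open>[0, 1]\<close>.\<close>

lemma moments_determine_signed_image_real:
  fixes Z X :: "'a \<Rightarrow> real"
  assumes Z: "integrable M Z" and X: "X \<in> borel_measurable M"
    and X01: "\<And>x. x \<in> space M \<Longrightarrow> X x \<in> {0..1}"
    and moments: "\<And>n. (\<integral>x. Z x * X x ^ n \<partial>M) = 0"
    and A: "A \<in> sets borel"
  shows "(\<integral>x. Z x * indicator A (X x) \<partial>M) = 0"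
proof -
  note [measurable] = X borel_measurable_integrable[OF Z]
  have pow_int: "integrable M (\<lambda>x. Z x * X x ^ n)" for n
    using X01 by (intro integrable_mult_bounded[where C=1] Z) (auto simp: power_abs abs_le_iff intro!: power_le_one)
  have cont: "(\<integral>x. Z x * h (X x) \<partial>M) = 0"
    if h: "continuous_on UNIV h" for h :: "real \<Rightarrow> real"
  proof -
    have [measurable]: "h \<in> borel_measurable borel" using h by (rule borel_measurable_continuous_onI)
    obtain C where C: "\<And>t. t \<in> {0..1} \<Longrightarrow> \<bar>h t\<bar> \<le> C"
    proof -
      have "compact (h ` {0..1})"
        by (intro compact_continuous_image continuous_on_subset[OF h]) auto
      then have "bounded (h ` {0..1})" by (rule compact_imp_bounded)
      then obtain C where "\<forall>t\<in>{0..1}. norm (h t) \<le> C" by (auto simp: bounded_iff)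
      then show ?thesis by (intro that[of C]) auto
    qed
    have int_h: "integrable M (\<lambda>x. Z x * h (X x))"
      using X01 C by (intro integrable_mult_bounded[where C=C] Z) auto
    have "\<bar>\<integral>x. Z x * h (X x) \<partial>M\<bar> \<le> e * (\<integral>x. \<bar>Z x\<bar> \<partial>M)" if "e > 0" for e :: real
    proof -
      obtain g where g: "real_polynomial_function g" and gh: "\<And>t. t \<in> {0..1} \<Longrightarrow> \<bar>h t - g t\<bar> < e"
        using Stone_Weierstrass_real_polynomial_function[of "{0..1::real}" h e] h \<open>e > 0\<close>
        by (metis compact_Icc continuous_on_subset subset_UNIV)
      obtain a n where ga: "g = (\<lambda>t. \<Sum>i\<le>n. a i * t ^ i)"
        using g by (auto simp: real_polynomial_function_iff_sum)
      have zg: "(\<lambda>x. Z x * g (X x)) = (\<lambda>x. \<Sum>i\<le>n. a i * (Z x * X x ^ i))"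
        by (simp add: ga sum_distrib_left mult_ac)
      have int_g: "integrable M (\<lambda>x. Z x * g (X x))"
        unfolding zg using pow_int by simp
      have "(\<integral>x. Z x * g (X x) \<partial>M) = 0"
        unfolding zg using pow_int moments by simp
      then have "\<bar>\<integral>x. Z x * h (X x) \<partial>M\<bar> = \<bar>\<integral>x. Z x * h (X x) - Z x * g (X x) \<partial>M\<bar>"
        using int_h int_g by simp
      also have "\<dots> \<le> (\<integral>x. \<bar>Z x * h (X x) - Z x * g (X x)\<bar> \<partial>M)"
        by (rule integral_abs_bound)
      also have "\<dots> \<le> (\<integral>x. e * \<bar>Z x\<bar> \<partial>M)"
      proof (rule integral_mono)
        fix x assume "x \<in> space M"
        then have "\<bar>h (X x) - g (X x)\<bar> \<le> e" using gh X01 by (simp add: less_imp_le)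
        then show "\<bar>Z x * h (X x) - Z x * g (X x)\<bar> \<le> e * \<bar>Z x\<bar>"
          unfolding right_diff_distrib[symmetric] abs_mult
          by (subst mult.commute[of e]) (rule mult_left_mono, auto)
      qed (use int_h int_g Z in auto)
      finally show ?thesis by simp
    qed
    note bound = this
    define c where "c = (\<integral>x. \<bar>Z x\<bar> \<partial>M)"
    have "c \<ge> 0" by (simp add: c_def)
    have "\<bar>\<integral>x. Z x * h (X x) \<partial>M\<bar> \<le> 0 + d" if "d > 0" for d
    proof -
      have "0 < d / (c + 1)" using \<open>d > 0\<close> \<open>c \<ge> 0\<close> by simp
      from bound[OF this] have "\<bar>\<integral>x. Z x * h (X x) \<partial>M\<bar> \<le> d / (c + 1) * c"
        by (simp only: c_def)
      also have "\<dots> \<le> d / (c + 1) * (c + 1)" using \<open>d > 0\<close> \<open>c \<ge> 0\<close> by (intro mult_left_mono) auto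
      also have "\<dots> = d" using \<open>c \<ge> 0\<close> by simp
      finally show ?thesis by simp
    qed
    then have "\<bar>\<integral>x. Z x * h (X x) \<partial>M\<bar> \<le> 0" by (rule field_le_epsilon)
    then show ?thesis by simp
  qed
  \<comment> \<open>Indicators of half-lines are limits of bounded continuous functions.\<close>
  have half_line: "(\<integral>x. Z x * indicator {t<..} (X x) \<partial>M) = 0" for t :: real
  proof -
    define h where "h n s = max 0 (min 1 (real n * (s - t)))" for n s
    have "(\<lambda>n. \<integral>x. Z x * h n (X x) \<partial>M) \<longlonglongrightarrow> (\<integral>x. Z x * indicator {t<..} (X x) \<partial>M)"
    proof (rule integral_dominated_convergence[where w="\<lambda>x. \<bar>Z x\<bar>"])
      show "AE x in M. (\<lambda>n. Z x * h n (X x)) \<longlonglongrightarrow> Z x * indicator {t<..} (X x)"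
      proof (intro AE_I2 tendsto_mult tendsto_const)
        fix x
        show "(\<lambda>n. h n (X x)) \<longlonglongrightarrow> indicator {t<..} (X x)"
        proof (cases "X x > t")
          case True
          obtain m :: nat where m: "1 / (X x - t) < real m" using reals_Archimedean2 by blast
          have "eventually (\<lambda>n. h n (X x) = indicator {t<..} (X x)) sequentially"
          proof (rule eventually_sequentiallyI[of m])
            fix n assume "m \<le> n"
            then have "1 / (X x - t) \<le> real n" using m by linarith
            then have "1 \<le> real n * (X x - t)" using True by (simp add: field_simps)
            then show "h n (X x) = indicator {t<..} (X x)" using True by (simp add: h_def)
          qed
          then show ?thesis by (rule tendsto_eventually)
        next
          case False
          then have "real n * (X x - t) \<le> 0" for n by (intro mult_nonneg_nonpos) auto
          then have "h n (X x) = 0" for n by (simp add: h_def max_absorb1 min_le_iff_disj)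
          then show ?thesis using False by simp
        qed
      qed
      show "AE x in M. norm (Z x * h n (X x)) \<le> \<bar>Z x\<bar>" for n
      proof (rule AE_I2)
        fix x
        have "\<bar>h n (X x)\<bar> \<le> 1" by (auto simp: h_def)
        then show "norm (Z x * h n (X x)) \<le> \<bar>Z x\<bar>" by (simp add: abs_mult mult_left_le)
      qed
    qed (use Z in \<open>auto simp: h_def\<close>)
    moreover have "(\<integral>x. Z x * h n (X x) \<partial>M) = 0" for n
      unfolding h_def by (rule cont) (intro continuous_intros)
    ultimately show ?thesis by (simp add: LIMSEQ_const_iff)
  qed
  have "distr (density M (\<lambda>x. ennreal (Z x))) borel X = distr (density M (\<lambda>x. ennreal (- Z x))) borel X"
  proof (rule measure_eqI_lessThan)
    interpret finite_measure "distr (density M (\<lambda>x. ennreal (Z x))) borel X"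
      by (rule finite_measure_image_positive_part[OF Z X])
    show "emeasure (distr (density M (\<lambda>x. ennreal (Z x))) borel X) {t<..} < \<infinity>" for t
      by (simp add: less_top[symmetric])
    show "emeasure (distr (density M (\<lambda>x. ennreal (Z x))) borel X) {t<..}
      = emeasure (distr (density M (\<lambda>x. ennreal (- Z x))) borel X) {t<..}" for t
      using half_line[of t] by (subst emeasure_image_signed_eq_iff[OF Z X]) auto
  qed simp_all
  then show ?thesis
    using emeasure_image_signed_eq_iff[OF Z X A] by simp
qed

text \<open>The moment problem on \<open>[0, 1]\<^sup>\<nat>\<close>; a monomial is given by the list of the indices of its
  factors.\<close>

lemma moments_determine_signed_image:
  fixes Z :: "'a \<Rightarrow> real" and X :: "nat \<Rightarrow> 'a \<Rightarrow> real"
  assumes Z: "integrable M Z" and X: "\<And>i. X i \<in> borel_measurable M"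
    and X01: "\<And>i x. x \<in> space M \<Longrightarrow> X i x \<in> {0..1}"
    and moments: "\<And>is. (\<integral>x. Z x * prod_list (map (\<lambda>i. X i x) is) \<partial>M) = 0"
    and U: "U \<in> sets (\<Pi>\<^sub>M i\<in>(UNIV :: nat set). (borel :: real measure))"
  shows "(\<integral>x. Z x * indicator U (\<lambda>i. X i x) \<partial>M) = 0"
proof -
  note [measurable] = X borel_measurable_integrable[OF Z]
  have prod01: "prod_list (map (\<lambda>i. X i x) is) \<in> {0..1}" if "x \<in> space M" for x "is"
    using X01[OF that] by (induction "is") (auto intro: mult_le_one)
  have [measurable]: "(\<lambda>x. prod_list (map (\<lambda>i. X i x) is)) \<in> borel_measurable M" for "is"
    by (induction "is") auto
  have X': "(\<lambda>x i. X i x) \<in> measurable M (\<Pi>\<^sub>M i\<in>(UNIV :: nat set). borel)"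
    by (rule measurable_PiM_single') (auto simp: X)
  \<comment> \<open>The coordinates are treated one at a time: the coordinates already treated appear through
    indicators and become part of the density, the others through a monomial.\<close>
  have box: "(\<integral>x. Z x * ((\<Prod>j\<in>J. indicator (A j) (X j x)) * prod_list (map (\<lambda>i. X i x) is)) \<partial>M) = 0"
    if "finite J" "\<And>j. j \<in> J \<Longrightarrow> A j \<in> sets borel" for J "is" and A :: "nat \<Rightarrow> real set"
    using that
  proof (induction J arbitrary: "is" rule: finite_induct)
    case empty
    then show ?case using moments by simp
  next
    case (insert j J)
    let ?p = "\<lambda>is x. (\<Prod>j\<in>J. indicator (A j) (X j x)) * prod_list (map (\<lambda>i. X i x) is)"
    have [measurable]: "A i \<in> sets borel" if "i \<in> J" for i using insert.prems that by auto
    have pm: "?p is \<in> borel_measurable M" for "is"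
      by measurable
    have "\<bar>?p is x\<bar> \<le> 1" if "x \<in> space M" for x
    proof -
      have "(\<Prod>j\<in>J. indicator (A j) (X j x)) \<le> (1::real)"
        by (rule prod_le_1) (auto simp: indicator_def)
      moreover have "0 \<le> (\<Prod>j\<in>J. (indicator (A j) (X j x) :: real))" by (intro prod_nonneg) auto
      ultimately show ?thesis using prod01[OF that, of "is"]
        by (simp add: abs_mult mult_le_one)
    qed
    then have int: "integrable M (\<lambda>x. Z x * ?p is x)"
      by (intro integrable_mult_bounded[OF Z pm])
    have "(\<integral>x. (Z x * ?p is x) * indicator (A j) (X j x) \<partial>M) = 0"
    proof (rule moments_determine_signed_image_real[OF int X X01])
      fix n
      have "(\<integral>x. Z x * ?p (replicate n j @ is) x \<partial>M) = 0"
        using insert.IH insert.prems by blast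
      then show "(\<integral>x. (Z x * ?p is x) * X j x ^ n \<partial>M) = 0"
        by (simp add: mult_ac)
    qed (use insert.prems in auto)
    then show ?case using insert.hyps by (simp add: mult_ac)
  qed
  have "distr (density M (\<lambda>x. ennreal (Z x))) (\<Pi>\<^sub>M i\<in>UNIV. borel) (\<lambda>x i. X i x)
    = distr (density M (\<lambda>x. ennreal (- Z x))) (\<Pi>\<^sub>M i\<in>UNIV. borel) (\<lambda>x i. X i x)"
  proof (rule measure_eqI_PiM_infinite)
    fix J :: "nat set" and A :: "nat \<Rightarrow> real set"
    assume J: "finite J" "\<And>i. i \<in> J \<Longrightarrow> A i \<in> sets borel"
    have ind: "indicator (prod_emb UNIV (\<lambda>_. borel) J (Pi\<^sub>E J A)) (\<lambda>i. X i x)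
        = (\<Prod>j\<in>J. indicator (A j) (X j x) :: real)" for x
      using J(1) by (auto simp: indicator_def prod_emb_def PiE_iff prod_zero_iff)
    have "(\<integral>x. Z x * indicator (prod_emb UNIV (\<lambda>_. borel) J (Pi\<^sub>E J A)) (\<lambda>i. X i x) \<partial>M) = 0"
      using box[of J A "[]"] J by (simp add: ind)
    then show "emeasure (distr (density M (\<lambda>x. ennreal (Z x))) (\<Pi>\<^sub>M i\<in>UNIV. borel) (\<lambda>x i. X i x))
        (prod_emb UNIV (\<lambda>_. borel) J (Pi\<^sub>E J A))
      = emeasure (distr (density M (\<lambda>x. ennreal (- Z x))) (\<Pi>\<^sub>M i\<in>UNIV. borel) (\<lambda>x i. X i x))
        (prod_emb UNIV (\<lambda>_. borel) J (Pi\<^sub>E J A))"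
      using J by (subst emeasure_image_signed_eq_iff[OF Z X']) (auto intro!: sets_PiM_I)
  qed (auto intro!: finite_measure_image_positive_part[OF Z X'])
  then show ?thesis
    using emeasure_image_signed_eq_iff[OF Z X' U] by simp
qed

section \<open>Independent replicas of a random discrete measure\<close>

lemma distr_PiM_map:
  fixes K :: "'a measure" and f :: "'a \<Rightarrow> 'b"
  assumes K: "prob_space K" and f: "f \<in> measurable K N"
  shows "distr (\<Pi>\<^sub>M i\<in>(UNIV :: 'i set). K) (\<Pi>\<^sub>M i\<in>UNIV. N) (\<lambda>x i. f (x i)) = (\<Pi>\<^sub>M i\<in>UNIV. distr K N f)"
proof -
  note [measurable] = f
  interpret K: product_prob_space "\<lambda>_ :: 'i. K" UNIV
    using K by (intro product_prob_spaceI)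
  interpret D: product_prob_space "\<lambda>_ :: 'i. distr K N f" UNIV
    using K f by (intro product_prob_spaceI prob_space.prob_space_distr)
  have map: "(\<lambda>x i. f (x i)) \<in> measurable (\<Pi>\<^sub>M i\<in>(UNIV :: 'i set). K) (\<Pi>\<^sub>M i\<in>UNIV. N)"
    using measurable_space[OF f] by (intro measurable_PiM_single') (auto simp: space_PiM PiE_iff)
  show ?thesis
  proof (rule D.PiM_eq)
    show "sets (distr (\<Pi>\<^sub>M i\<in>(UNIV :: 'i set). K) (\<Pi>\<^sub>M i\<in>UNIV. N) (\<lambda>x i. f (x i)))
        = sets (\<Pi>\<^sub>M i\<in>UNIV. distr K N f)"
      by (simp cong: sets_PiM_cong)
    fix J :: "'i set" and F
    assume J: "finite J" and F: "\<And>j. j \<in> J \<Longrightarrow> F j \<in> sets (distr K N f)"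
    have emb: "prod_emb UNIV (\<lambda>_. distr K N f) J (Pi\<^sub>E J F) = prod_emb UNIV (\<lambda>_. N) J (Pi\<^sub>E J F)"
      by (simp add: prod_emb_def)
    have pre: "(\<lambda>x i. f (x i)) -` prod_emb UNIV (\<lambda>_. N) J (Pi\<^sub>E J F) \<inter> space (\<Pi>\<^sub>M i\<in>UNIV. K)
        = prod_emb UNIV (\<lambda>_. K) J (\<Pi>\<^sub>E j\<in>J. f -` F j \<inter> space K)"
      using measurable_space[OF f] by (auto simp: prod_emb_def space_PiM PiE_iff)
    have "emeasure (distr (\<Pi>\<^sub>M i\<in>(UNIV :: 'i set). K) (\<Pi>\<^sub>M i\<in>UNIV. N) (\<lambda>x i. f (x i)))
        (prod_emb UNIV (\<lambda>_. N) J (Pi\<^sub>E J F))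
      = emeasure (\<Pi>\<^sub>M i\<in>UNIV. K) (prod_emb UNIV (\<lambda>_. K) J (\<Pi>\<^sub>E j\<in>J. f -` F j \<inter> space K))"
      using J F by (subst emeasure_distr[OF map]) (auto simp: pre intro!: sets_PiM_I)
    also have "\<dots> = (\<Prod>j\<in>J. emeasure K (f -` F j \<inter> space K))"
      using J F by (intro K.emeasure_PiM_emb) auto
    also have "\<dots> = (\<Prod>j\<in>J. emeasure (distr K N f) (F j))"
      using F by (intro prod.cong) (auto simp: emeasure_distr)
    finally show "emeasure (distr (\<Pi>\<^sub>M i\<in>(UNIV :: 'i set). K) (\<Pi>\<^sub>M i\<in>UNIV. N) (\<lambda>x i. f (x i)))
        (prod_emb UNIV (\<lambda>_. distr K N f) J (Pi\<^sub>E J F)) = (\<Prod>j\<in>J. emeasure (distr K N f) (F j))"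
      by (simp only: emb)
  qed
qed

text \<open>The law of the index of one replica, given the weights.\<close>

definition index_law :: "(nat \<Rightarrow> 'w \<Rightarrow> real) \<Rightarrow> 'w \<Rightarrow> nat measure" where
  "index_law v \<omega> = density (count_space UNIV) (\<lambda>l. ennreal (v l \<omega>))"

abbreviation index_seq :: "(nat \<Rightarrow> nat) measure" where
  "index_seq \<equiv> \<Pi>\<^sub>M i\<in>UNIV. count_space UNIV"

text \<open>The conditional law of the indices of all the replicas, given the weights.\<close>

abbreviation sample_kernel :: "(nat \<Rightarrow> 'w \<Rightarrow> real) \<Rightarrow> 'w \<Rightarrow> (nat \<Rightarrow> nat) measure" where
  "sample_kernel v \<omega> \<equiv> \<Pi>\<^sub>M i\<in>UNIV. index_law v \<omega>"

text \<open>The joint law of the outcome in \<open>M\<close>, which carries the weights and the atoms, and of the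
  indices of the replicas.\<close>

definition sample_law :: "'w measure \<Rightarrow> (nat \<Rightarrow> 'w \<Rightarrow> real) \<Rightarrow> ('w \<times> (nat \<Rightarrow> nat)) measure" where
  "sample_law M v = M \<bind> (\<lambda>\<omega>. sample_kernel v \<omega> \<bind> (\<lambda>\<iota>. return (M \<Otimes>\<^sub>M index_seq) (\<omega>, \<iota>)))"

lemma sets_index_law [measurable_cong, simp]: "sets (index_law v \<omega>) = sets (count_space UNIV)"
  by (simp add: index_law_def)

lemma space_index_law [simp]: "space (index_law v \<omega>) = UNIV"
  by (simp add: index_law_def)

lemma sets_sample_kernel [measurable_cong]: "sets (sample_kernel v \<omega>) = sets index_seq"
  by (rule sets_PiM_cong) auto

text \<open>Random probability weights; a negative value of \<open>v l\<close> counts as \<open>0\<close> in \<open>index_law\<close>.\<close>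

locale random_weights = prob_space M for M :: "'w measure" +
  fixes v :: "nat \<Rightarrow> 'w \<Rightarrow> real"
  assumes v_measurable [measurable]: "\<And>l. v l \<in> borel_measurable M"
    and prob_space_index_law: "\<And>\<omega>. \<omega> \<in> space M \<Longrightarrow> prob_space (index_law v \<omega>)"
begin

abbreviation \<Omega> :: "('w \<times> (nat \<Rightarrow> nat)) measure" where
  "\<Omega> \<equiv> M \<Otimes>\<^sub>M index_seq"

abbreviation P :: "('w \<times> (nat \<Rightarrow> nat)) measure" where
  "P \<equiv> sample_law M v"

lemma prob_space_sample_kernel: "\<omega> \<in> space M \<Longrightarrow> prob_space (sample_kernel v \<omega>)"
  by (intro prob_space_PiM prob_space_index_law)

lemma measurable_sample_kernel [measurable]: "sample_kernel v \<in> M \<rightarrow>\<^sub>M prob_algebra index_seq"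
proof (rule measurable_prob_algebra_generated[OF sets_PiM Int_stable_prod_algebra prod_algebra_sets_into_space])
  fix \<omega> assume "\<omega> \<in> space M"
  then show "prob_space (sample_kernel v \<omega>)" by (rule prob_space_sample_kernel)
next
  fix A :: "(nat \<Rightarrow> nat) set" assume "A \<in> prod_algebra UNIV (\<lambda>_. count_space UNIV)"
  then obtain J E where A: "A = prod_emb UNIV (\<lambda>_. count_space UNIV) J (\<Pi>\<^sub>E j\<in>J. E j)" and J: "finite J"
    by (elim prod_algebraE) auto
  have "emeasure (sample_kernel v \<omega>) A = (\<Prod>j\<in>J. \<Sum>l. ennreal (v l \<omega>) * indicator (E j) l)"
    if "\<omega> \<in> space M" for \<omega>
  proof -
    interpret product_prob_space "\<lambda>_::nat. index_law v \<omega>" UNIV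
      using prob_space_index_law[OF that] by (intro product_prob_spaceI)
    have "A = prod_emb UNIV (\<lambda>_. index_law v \<omega>) J (\<Pi>\<^sub>E j\<in>J. E j)"
      by (simp add: A prod_emb_def)
    then have "emeasure (sample_kernel v \<omega>) A = (\<Prod>j\<in>J. emeasure (index_law v \<omega>) (E j))"
      using J emeasure_PiM_emb[of J E] by simp
    then show ?thesis by (simp add: index_law_def emeasure_density nn_integral_count_space_nat)
  qed
  then show "(\<lambda>\<omega>. emeasure (sample_kernel v \<omega>) A) \<in> borel_measurable M"
    by (subst measurable_cong) (assumption, measurable)
qed (rule sets_sample_kernel)

lemma measurable_sample_kernel_pair:
  "(\<lambda>\<omega>. sample_kernel v \<omega> \<bind> (\<lambda>\<iota>. return \<Omega> (\<omega>, \<iota>))) \<in> M \<rightarrow>\<^sub>M prob_algebra \<Omega>"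
  by measurable

lemma M_in_prob_algebra: "M \<in> space (prob_algebra M)"
  by (simp add: space_prob_algebra prob_space_axioms)

lemma sets_P [measurable_cong]: "sets P = sets \<Omega>"
  unfolding sample_law_def by (rule sets_bind'[OF M_in_prob_algebra measurable_sample_kernel_pair])

lemma space_P: "space P = space M \<times> UNIV"
  using sets_eq_imp_space_eq[OF sets_P] by (simp add: space_pair_measure space_PiM)

lemma prob_space_P: "prob_space P"
  unfolding sample_law_def by (rule prob_space_bind'[OF M_in_prob_algebra measurable_sample_kernel_pair])

sublocale P: prob_space P
  by (rule prob_space_P)

lemma nn_integral_P:
  assumes [measurable]: "f \<in> borel_measurable \<Omega>"
  shows "(\<integral>\<^sup>+x. f x \<partial>P) = (\<integral>\<^sup>+\<omega>. \<integral>\<^sup>+\<iota>. f (\<omega>, \<iota>) \<partial>sample_kernel v \<omega> \<partial>M)"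
proof -
  have "(\<integral>\<^sup>+x. f x \<partial>P) = (\<integral>\<^sup>+\<omega>. \<integral>\<^sup>+x. f x \<partial>(sample_kernel v \<omega> \<bind> (\<lambda>\<iota>. return \<Omega> (\<omega>, \<iota>))) \<partial>M)"
    unfolding sample_law_def
    by (rule nn_integral_bind[OF assms measurable_prob_algebraD[OF measurable_sample_kernel_pair]])
  also have "\<dots> = (\<integral>\<^sup>+\<omega>. \<integral>\<^sup>+\<iota>. f (\<omega>, \<iota>) \<partial>sample_kernel v \<omega> \<partial>M)"
  proof (rule nn_integral_cong)
    fix \<omega> assume \<omega>: "\<omega> \<in> space M"
    have [measurable]: "Pair \<omega> \<in> sample_kernel v \<omega> \<rightarrow>\<^sub>M \<Omega>"
      using \<omega> by measurable
    have "(\<integral>\<^sup>+x. f x \<partial>(sample_kernel v \<omega> \<bind> (\<lambda>\<iota>. return \<Omega> (\<omega>, \<iota>))))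
      = (\<integral>\<^sup>+\<iota>. \<integral>\<^sup>+x. f x \<partial>return \<Omega> (\<omega>, \<iota>) \<partial>sample_kernel v \<omega>)"
      by (rule nn_integral_bind[OF assms]) measurable
    also have "\<dots> = (\<integral>\<^sup>+\<iota>. f (\<omega>, \<iota>) \<partial>sample_kernel v \<omega>)"
      using \<omega> by (intro nn_integral_cong nn_integral_return) (auto simp: space_pair_measure space_PiM)
    finally show "(\<integral>\<^sup>+x. f x \<partial>(sample_kernel v \<omega> \<bind> (\<lambda>\<iota>. return \<Omega> (\<omega>, \<iota>))))
      = (\<integral>\<^sup>+\<iota>. f (\<omega>, \<iota>) \<partial>sample_kernel v \<omega>)" .
  qed
  finally show ?thesis .
qed

lemma measurable_sample_integral:
  fixes f :: "'w \<times> (nat \<Rightarrow> nat) \<Rightarrow> real"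
  assumes [measurable]: "f \<in> borel_measurable \<Omega>"
  shows "(\<lambda>\<omega>. \<integral>\<iota>. f (\<omega>, \<iota>) \<partial>sample_kernel v \<omega>) \<in> borel_measurable M"
proof -
  have "(\<lambda>\<omega>. distr (sample_kernel v \<omega>) \<Omega> (Pair \<omega>)) \<in> M \<rightarrow>\<^sub>M subprob_algebra \<Omega>"
    by (rule measurable_distr2[where M=index_seq]) (measurable, rule measurable_prob_algebraD, measurable)
  then have "(\<lambda>\<omega>. \<integral>x. f x \<partial>distr (sample_kernel v \<omega>) \<Omega> (Pair \<omega>)) \<in> borel_measurable M"
    by (rule measurable_compose) measurable
  moreover have "(\<integral>x. f x \<partial>distr (sample_kernel v \<omega>) \<Omega> (Pair \<omega>)) = (\<integral>\<iota>. f (\<omega>, \<iota>) \<partial>sample_kernel v \<omega>)"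
    if [measurable]: "\<omega> \<in> space M" for \<omega>
    by (rule integral_distr) measurable
  ultimately show ?thesis
    by (simp cong: measurable_cong)
qed

lemma integral_P:
  fixes f :: "'w \<times> (nat \<Rightarrow> nat) \<Rightarrow> real"
  assumes f [measurable]: "f \<in> borel_measurable \<Omega>"
    and bound: "\<And>x. x \<in> space P \<Longrightarrow> \<bar>f x\<bar> \<le> C"
  shows "(\<integral>x. f x \<partial>P) = (\<integral>\<omega>. \<integral>\<iota>. f (\<omega>, \<iota>) \<partial>sample_kernel v \<omega> \<partial>M)"
proof -
  let ?g = "\<lambda>x. f x + C"
  have bound': "\<bar>f (\<omega>, \<iota>)\<bar> \<le> C" if "\<omega> \<in> space M" for \<omega> \<iota>
    using bound[of "(\<omega>, \<iota>)"] that by (simp add: space_P)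
  have f_P [measurable]: "f \<in> borel_measurable P" by measurable
  have f_K [measurable]: "(\<lambda>\<iota>. f (\<omega>, \<iota>)) \<in> borel_measurable (sample_kernel v \<omega>)" if [measurable]: "\<omega> \<in> space M" for \<omega>
    by measurable
  have inner: "(\<integral>\<^sup>+\<iota>. ennreal (f (\<omega>, \<iota>) + C) \<partial>sample_kernel v \<omega>) = ennreal ((\<integral>\<iota>. f (\<omega>, \<iota>) \<partial>sample_kernel v \<omega>) + C)"
    and inner_bound: "\<bar>\<integral>\<iota>. f (\<omega>, \<iota>) \<partial>sample_kernel v \<omega>\<bar> \<le> C" if \<omega>: "\<omega> \<in> space M" for \<omega>
  proof -
    interpret K: prob_space "sample_kernel v \<omega>" using \<omega> by (rule prob_space_sample_kernel)
    have int: "integrable (sample_kernel v \<omega>) (\<lambda>\<iota>. f (\<omega>, \<iota>))"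
      using bound'[OF \<omega>] f_K[OF \<omega>] by (intro K.integrable_const_bound[where B=C]) auto
    have nonneg: "0 \<le> f (\<omega>, \<iota>) + C" for \<iota> using bound'[OF \<omega>, of \<iota>] by linarith
    have "(\<integral>\<^sup>+\<iota>. ennreal (f (\<omega>, \<iota>) + C) \<partial>sample_kernel v \<omega>) = ennreal (\<integral>\<iota>. f (\<omega>, \<iota>) + C \<partial>sample_kernel v \<omega>)"
      using int nonneg by (intro nn_integral_eq_integral) auto
    also have "(\<integral>\<iota>. f (\<omega>, \<iota>) + C \<partial>sample_kernel v \<omega>) = (\<integral>\<iota>. f (\<omega>, \<iota>) \<partial>sample_kernel v \<omega>) + C"
      using int K.prob_space by simp
    finally show "(\<integral>\<^sup>+\<iota>. ennreal (f (\<omega>, \<iota>) + C) \<partial>sample_kernel v \<omega>) = ennreal ((\<integral>\<iota>. f (\<omega>, \<iota>) \<partial>sample_kernel v \<omega>) + C)" .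
    have "\<bar>\<integral>\<iota>. f (\<omega>, \<iota>) \<partial>sample_kernel v \<omega>\<bar> \<le> (\<integral>\<iota>. \<bar>f (\<omega>, \<iota>)\<bar> \<partial>sample_kernel v \<omega>)"
      by (rule integral_abs_bound)
    also have "\<dots> \<le> (\<integral>\<iota>. C \<partial>sample_kernel v \<omega>)"
      using int bound'[OF \<omega>] by (intro integral_mono) auto
    finally show "\<bar>\<integral>\<iota>. f (\<omega>, \<iota>) \<partial>sample_kernel v \<omega>\<bar> \<le> C" using K.prob_space by simp
  qed
  \<comment> \<open>Adding \<open>C\<close> makes \<open>f\<close> nonnegative and reduces the claim to nonnegative integrals.\<close>
  note [measurable] = measurable_sample_integral[OF f]
  have int_P: "integrable P f"
    using bound by (intro P.integrable_const_bound[where B=C]) auto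
  have int_M: "integrable M (\<lambda>\<omega>. \<integral>\<iota>. f (\<omega>, \<iota>) \<partial>sample_kernel v \<omega>)"
    using inner_bound by (intro integrable_const_bound[where B=C]) auto
  have nonneg_P: "0 \<le> f x + C" if "x \<in> space P" for x using bound[OF that] by linarith
  have nonneg_M: "0 \<le> (\<integral>\<iota>. f (\<omega>, \<iota>) \<partial>sample_kernel v \<omega>) + C" if "\<omega> \<in> space M" for \<omega>
    using inner_bound[OF that] by linarith
  have "ennreal ((\<integral>x. f x \<partial>P) + C) = ennreal (\<integral>x. f x + C \<partial>P)"
    using int_P P.prob_space by simp
  also have "\<dots> = (\<integral>\<^sup>+x. ennreal (f x + C) \<partial>P)"
    using int_P nonneg_P by (intro nn_integral_eq_integral[symmetric]) auto
  also have "\<dots> = (\<integral>\<^sup>+\<omega>. ennreal ((\<integral>\<iota>. f (\<omega>, \<iota>) \<partial>sample_kernel v \<omega>) + C) \<partial>M)"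
    by (subst nn_integral_P) (auto intro!: nn_integral_cong simp: inner)
  also have "\<dots> = ennreal (\<integral>\<omega>. (\<integral>\<iota>. f (\<omega>, \<iota>) \<partial>sample_kernel v \<omega>) + C \<partial>M)"
    using int_M nonneg_M by (intro nn_integral_eq_integral) auto
  also have "\<dots> = ennreal ((\<integral>\<omega>. \<integral>\<iota>. f (\<omega>, \<iota>) \<partial>sample_kernel v \<omega> \<partial>M) + C)"
    using int_M prob_space by simp
  finally have eq: "ennreal ((\<integral>x. f x \<partial>P) + C) = ennreal ((\<integral>\<omega>. \<integral>\<iota>. f (\<omega>, \<iota>) \<partial>sample_kernel v \<omega> \<partial>M) + C)" .
  have "0 \<le> (\<integral>x. f x + C \<partial>P)" using nonneg_P by (intro Bochner_Integration.integral_nonneg) auto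
  then have "0 \<le> (\<integral>x. f x \<partial>P) + C" using int_P P.prob_space by simp
  moreover have "0 \<le> (\<integral>\<omega>. (\<integral>\<iota>. f (\<omega>, \<iota>) \<partial>sample_kernel v \<omega>) + C \<partial>M)"
    using nonneg_M by (intro Bochner_Integration.integral_nonneg) auto
  then have "0 \<le> (\<integral>\<omega>. \<integral>\<iota>. f (\<omega>, \<iota>) \<partial>sample_kernel v \<omega> \<partial>M) + C" using int_M prob_space by simp
  ultimately show ?thesis using eq by simp
qed

text \<open>Permuting the replicas does not change the law of the sample.\<close>

lemma integral_P_permute:
  fixes f :: "'w \<times> (nat \<Rightarrow> nat) \<Rightarrow> real"
  assumes f [measurable]: "f \<in> borel_measurable \<Omega>"
    and bound: "\<And>x. x \<in> space P \<Longrightarrow> \<bar>f x\<bar> \<le> C" and \<pi>: "inj \<pi>"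
  shows "(\<integral>x. f (fst x, \<lambda>i. snd x (\<pi> i)) \<partial>P) = (\<integral>x. f x \<partial>P)"
proof -
  have [measurable]: "(\<lambda>\<iota> i. \<iota> (\<pi> i)) \<in> index_seq \<rightarrow>\<^sub>M index_seq"
    by (rule measurable_PiM_single') (auto simp: space_PiM)
  have "(\<integral>x. f (fst x, \<lambda>i. snd x (\<pi> i)) \<partial>P) = (\<integral>\<omega>. \<integral>\<iota>. f (\<omega>, \<lambda>i. \<iota> (\<pi> i)) \<partial>sample_kernel v \<omega> \<partial>M)"
    using bound by (subst integral_P[where C=C]) (auto simp: space_P, measurable)
  also have "\<dots> = (\<integral>\<omega>. \<integral>\<iota>. f (\<omega>, \<iota>) \<partial>sample_kernel v \<omega> \<partial>M)"
  proof (rule Bochner_Integration.integral_cong)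
    fix \<omega> assume \<omega>[measurable]: "\<omega> \<in> space M"
    have "sample_kernel v \<omega> = distr (sample_kernel v \<omega>) (sample_kernel v \<omega>) (\<lambda>\<iota> i. \<iota> (\<pi> i))"
      using distr_PiM_reindex[of UNIV "\<lambda>_. index_law v \<omega>" \<pi> UNIV] \<pi> prob_space_index_law[OF \<omega>]
      by (simp add: restrict_def)
    then have "(\<integral>\<iota>. f (\<omega>, \<iota>) \<partial>sample_kernel v \<omega>)
      = (\<integral>\<iota>. f (\<omega>, \<iota>) \<partial>distr (sample_kernel v \<omega>) (sample_kernel v \<omega>) (\<lambda>\<iota> i. \<iota> (\<pi> i)))"
      by simp
    also have "\<dots> = (\<integral>\<iota>. f (\<omega>, \<lambda>i. \<iota> (\<pi> i)) \<partial>sample_kernel v \<omega>)"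
      by (rule integral_distr) measurable
    finally show "(\<integral>\<iota>. f (\<omega>, \<lambda>i. \<iota> (\<pi> i)) \<partial>sample_kernel v \<omega>) = (\<integral>\<iota>. f (\<omega>, \<iota>) \<partial>sample_kernel v \<omega>)" ..
  qed simp
  also have "\<dots> = (\<integral>x. f x \<partial>P)"
    by (rule integral_P[OF f bound, symmetric])
  finally show ?thesis .
qed

end

lemma PiM_atomic_measure:
  assumes v: "prob_space (index_law v \<omega>)"
  shows "(\<Pi>\<^sub>M l\<in>(UNIV :: nat set). atomic_measure (\<lambda>l. v l \<omega>) x)
    = distr (sample_kernel v \<omega>) (\<Pi>\<^sub>M l\<in>UNIV. borel) (\<lambda>\<iota> i. x (\<iota> i))"
proof -
  have "atomic_measure (\<lambda>l. v l \<omega>) x = distr (index_law v \<omega>) borel x"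
    by (simp add: atomic_measure_def index_law_def)
  then show ?thesis using distr_PiM_map[OF v, of x borel, where 'i=nat] by simp
qed

lemma prob_space_index_law_iff:
  "prob_space (atomic_measure (\<lambda>l. v l \<omega>) x) \<longleftrightarrow> prob_space (index_law v \<omega>)"
proof -
  have [measurable]: "x \<in> measurable (index_law v \<omega>) borel" by simp
  have "atomic_measure (\<lambda>l. v l \<omega>) x = distr (index_law v \<omega>) borel x"
    by (simp add: atomic_measure_def index_law_def)
  then show ?thesis using prob_space_distrD[of x "index_law v \<omega>" borel]
    prob_space.prob_space_distr[of "index_law v \<omega>" x borel] by auto
qed

section \<open>Integrating out replicas\<close>

text \<open>The properties of the weights are required everywhere instead of almost surely, which can be
  achieved by a modification on a null set.\<close>

locale positive_weights = random_weights +
  assumes v_pos: "\<And>\<omega> l. \<omega> \<in> space M \<Longrightarrow> 0 < v l \<omega>"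
    and v_decseq: "\<And>\<omega>. \<omega> \<in> space M \<Longrightarrow> decseq (\<lambda>l. v l \<omega>)"
begin

lemma v_sums_1: 
  assumes "\<omega> \<in> space M"
  shows "(\<lambda>l. v l \<omega>) sums 1"
proof -
  interpret D: prob_space "index_law v \<omega>" using assms by (rule prob_space_index_law)
  have "1 = emeasure (index_law v \<omega>) UNIV" using D.emeasure_space_1 by simp
  also have "\<dots> = (\<Sum>l. ennreal (v l \<omega>))"
    by (simp add: index_law_def emeasure_density nn_integral_count_space_nat)
  finally have s: "(\<Sum>l. ennreal (v l \<omega>)) = ennreal 1" by simp
  have nn: "0 \<le> v l \<omega>" for l using v_pos[OF assms, of l] by simp
  have "summable (\<lambda>l. v l \<omega>)" by (rule summable_suminf_not_top[OF nn]) (simp add: s)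
  moreover from this have "ennreal (\<Sum>l. v l \<omega>) = ennreal 1" using s nn suminf_ennreal2 by metis
  then have "(\<Sum>l. v l \<omega>) = 1" using nn \<open>summable _\<close> by (simp add: suminf_nonneg)
  ultimately show ?thesis by (simp add: sums_iff)
qed

lemma v_le_1: "\<omega> \<in> space M \<Longrightarrow> v l \<omega> \<le> 1"
  using sums_unique[OF v_sums_1] sum_le_suminf[OF sums_summable[OF v_sums_1], of \<omega> "{l}"] v_pos
  by (simp add: less_imp_le)

lemma v_in_01: "\<omega> \<in> space M \<Longrightarrow> v l \<omega> \<in> {0..1}"
  using v_pos[of \<omega> l] v_le_1[of \<omega> l] by simp

lemma summable_v_mult:
  fixes g :: "nat \<Rightarrow> real"
  assumes \<omega>: "\<omega> \<in> space M" and g: "\<And>l. \<bar>g l\<bar> \<le> C"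
  shows "summable (\<lambda>l. v l \<omega> * g l)"
proof -
  have "summable (\<lambda>l. v l \<omega> * C)" using v_sums_1[OF \<omega>] by (intro summable_mult2) (auto simp: sums_iff)
  then show ?thesis
    by (rule summable_comparison_test'[where N=0]) (use g v_pos[OF \<omega>] in \<open>simp add: abs_mult abs_of_pos mult_left_mono less_imp_le\<close>)
qed

lemma integral_index_law:
  fixes g :: "nat \<Rightarrow> real"
  assumes \<omega>: "\<omega> \<in> space M" and g: "\<And>l. \<bar>g l\<bar> \<le> C"
  shows "(\<integral>l. g l \<partial>index_law v \<omega>) = (\<Sum>l. v l \<omega> * g l)"
proof -
  have "summable (\<lambda>l. v l \<omega> * \<bar>g l\<bar>)" using \<omega> g by (intro summable_v_mult[where C=C]) auto
  then have "summable (\<lambda>l. norm (v l \<omega> * g l))" using v_pos[OF \<omega>] by (simp add: abs_mult abs_of_pos)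
  then have int: "integrable (count_space UNIV) (\<lambda>l. v l \<omega> * g l)"
    by (simp add: integrable_count_space_nat_iff)
  have "(\<integral>l. g l \<partial>index_law v \<omega>) = (\<integral>l. v l \<omega> * g l \<partial>count_space UNIV)"
    unfolding index_law_def using v_pos[OF \<omega>] by (subst integral_density) (auto intro: less_imp_le)
  then show ?thesis using integral_count_space_nat[OF int] by simp
qed

lemma abs_suminf_v_mult:
  fixes g :: "nat \<Rightarrow> real"
  assumes \<omega>: "\<omega> \<in> space M" and g: "\<And>l. \<bar>g l\<bar> \<le> C"
  shows "\<bar>\<Sum>l. v l \<omega> * g l\<bar> \<le> C"
proof -
  have s1: "summable (\<lambda>l. v l \<omega> * \<bar>g l\<bar>)" using \<omega> g by (intro summable_v_mult[where C=C]) auto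
  have "\<bar>\<Sum>l. v l \<omega> * g l\<bar> \<le> (\<Sum>l. \<bar>v l \<omega> * g l\<bar>)"
    using s1 v_pos[OF \<omega>] by (intro summable_rabs) (simp add: abs_mult abs_of_pos)
  also have "\<dots> = (\<Sum>l. v l \<omega> * \<bar>g l\<bar>)" using v_pos[OF \<omega>] by (simp add: abs_mult abs_of_pos)
  also have "\<dots> \<le> (\<Sum>l. v l \<omega> * C)"
    using s1 v_pos[OF \<omega>] g v_sums_1[OF \<omega>]
    by (intro suminf_le summable_mult2) (auto simp: sums_iff less_imp_le intro!: mult_left_mono)
  also have "\<dots> = C" using v_sums_1[OF \<omega>] by (simp add: suminf_mult2[symmetric] sums_iff)
  finally show ?thesis .
qed

lemma bound_nonneg:
  fixes f :: "'a \<times> (nat \<Rightarrow> nat) \<Rightarrow> real"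
  assumes "\<And>x. x \<in> space P \<Longrightarrow> \<bar>f x\<bar> \<le> C"
  shows "0 \<le> C"
  using P.not_empty assms by (meson abs_ge_zero equals0I order_trans)

lemma measurable_index [measurable]: "(\<lambda>x. snd x n) \<in> measurable \<Omega> (count_space UNIV)"
  by measurable

text \<open>Integrating out one replica: given the weights and the other replicas, the index drawn by
  the replica \<open>n\<close> has law \<open>v\<close>.\<close>

lemma integral_P_replica:
  fixes H :: "nat \<Rightarrow> 'a \<times> (nat \<Rightarrow> nat) \<Rightarrow> real"
  assumes H [measurable]: "\<And>l. H l \<in> borel_measurable \<Omega>"
    and bound: "\<And>l x. x \<in> space P \<Longrightarrow> \<bar>H l x\<bar> \<le> C"
    and indep: "\<And>l \<omega> \<iota> j. H l (\<omega>, \<iota>(n := j)) = H l (\<omega>, \<iota>)"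
  shows "(\<integral>x. H (snd x n) x \<partial>P) = (\<integral>x. (\<Sum>l. v l (fst x) * H l x) \<partial>P)"
proof -
  have H1 [measurable]: "(\<lambda>x. H (snd x n) x) \<in> borel_measurable \<Omega>"
    by (rule measurable_compose_countable[where f=H]) measurable
  have b: "\<bar>H l (\<omega>, \<iota>)\<bar> \<le> C" if "\<omega> \<in> space M" for l \<omega> \<iota>
    using bound[of "(\<omega>, \<iota>)"] that by (simp add: space_P)
  have "(\<integral>x. H (snd x n) x \<partial>P) = (\<integral>\<omega>. \<integral>\<iota>. H (\<iota> n) (\<omega>, \<iota>) \<partial>sample_kernel v \<omega> \<partial>M)"
    using bound by (subst integral_P[OF H1, of C]) auto
  also have "\<dots> = (\<integral>\<omega>. \<integral>\<iota>. (\<Sum>l. v l \<omega> * H l (\<omega>, \<iota>)) \<partial>sample_kernel v \<omega> \<partial>M)"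
  proof (rule Bochner_Integration.integral_cong[OF refl])
    fix \<omega> assume \<omega> [measurable]: "\<omega> \<in> space M"
    let ?D = "index_law v \<omega>"
    let ?R = "\<Pi>\<^sub>M i\<in>UNIV - {n}. ?D"
    interpret D: prob_space ?D using \<omega> by (rule prob_space_index_law)
    interpret R: prob_space ?R by (intro prob_space_PiM D.prob_space_axioms)
    interpret DR: pair_prob_space ?D ?R ..
    let ?upd = "\<lambda>(j, \<iota>). \<iota>(n := j)"
    have upd [measurable]: "?upd \<in> measurable (?D \<Otimes>\<^sub>M ?R) (sample_kernel v \<omega>)"
    proof -
      have "(\<lambda>x. (snd x)(n := fst x)) \<in> measurable (?D \<Otimes>\<^sub>M ?R) (\<Pi>\<^sub>M i\<in>UNIV. ?D)"
        by (rule measurable_fun_upd[where J="UNIV - {n}"]) auto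
      then show ?thesis by (simp add: case_prod_beta')
    qed
    have K: "sample_kernel v \<omega> = distr (?D \<Otimes>\<^sub>M ?R) (sample_kernel v \<omega>) ?upd"
      using distr_pair_PiM_eq_PiM[of "UNIV - {n}" "\<lambda>_. ?D" n] D.prob_space_axioms
      by (simp add: insert_Diff_if insert_absorb)
    have split: "(\<integral>\<iota>. F \<iota> \<partial>sample_kernel v \<omega>) = (\<integral>\<iota>. \<integral>j. F (\<iota>(n := j)) \<partial>?D \<partial>?R)"
      if F [measurable]: "F \<in> borel_measurable index_seq" and Fb: "\<And>\<iota>. \<bar>F \<iota>\<bar> \<le> C" for F :: "(nat \<Rightarrow> nat) \<Rightarrow> real"
    proof -
      have FK: "F \<in> borel_measurable (sample_kernel v \<omega>)" by measurable
      have "(\<integral>\<iota>. F \<iota> \<partial>sample_kernel v \<omega>) = (\<integral>x. F (?upd x) \<partial>(?D \<Otimes>\<^sub>M ?R))"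
        by (subst K, rule integral_distr[OF upd FK])
      also have "\<dots> = (\<integral>x. (case x of (j, \<iota>) \<Rightarrow> F (\<iota>(n := j))) \<partial>(?D \<Otimes>\<^sub>M ?R))"
        by (simp add: case_prod_beta')
      also have "\<dots> = (\<integral>\<iota>. \<integral>j. F (\<iota>(n := j)) \<partial>?D \<partial>?R)"
      proof (rule DR.integral_snd[symmetric])
        have "(\<lambda>x. F (?upd x)) \<in> borel_measurable (?D \<Otimes>\<^sub>M ?R)"
          by (rule measurable_compose[OF upd FK])
        then have "integrable (?D \<Otimes>\<^sub>M ?R) (\<lambda>x. F (?upd x))"
          using Fb by (intro DR.integrable_const_bound[where B=C]) auto
        then show "integrable (?D \<Otimes>\<^sub>M ?R) (\<lambda>(j, \<iota>). F (\<iota>(n := j)))"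
          by (simp add: case_prod_beta')
      qed
      finally show ?thesis .
    qed
    have "(\<integral>\<iota>. H (\<iota> n) (\<omega>, \<iota>) \<partial>sample_kernel v \<omega>) = (\<integral>\<iota>. \<integral>j. H j (\<omega>, \<iota>) \<partial>?D \<partial>?R)"
      using b[OF \<omega>] by (subst split) (auto simp: indep intro: measurable_compose[OF _ H1, of "Pair \<omega>", simplified])
    also have "\<dots> = (\<integral>\<iota>. (\<Sum>l. v l \<omega> * H l (\<omega>, \<iota>)) \<partial>?R)"
      using \<omega> b by (intro Bochner_Integration.integral_cong integral_index_law[where C=C]) auto
    also have "\<dots> = (\<integral>\<iota>. (\<Sum>l. v l \<omega> * H l (\<omega>, \<iota>)) \<partial>sample_kernel v \<omega>)"
    proof -
      have "(\<lambda>\<iota>. \<Sum>l. v l \<omega> * H l (\<omega>, \<iota>)) \<in> borel_measurable index_seq" by measurable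
      then show ?thesis
        using \<omega> b D.prob_space by (subst split) (auto simp: indep intro!: abs_suminf_v_mult)
    qed
    finally show "(\<integral>\<iota>. H (\<iota> n) (\<omega>, \<iota>) \<partial>sample_kernel v \<omega>) = (\<integral>\<iota>. (\<Sum>l. v l \<omega> * H l (\<omega>, \<iota>)) \<partial>sample_kernel v \<omega>)" .
  qed
  also have "\<dots> = (\<integral>x. (\<Sum>l. v l (fst x) * H l x) \<partial>P)"
    using b by (subst integral_P[where C=C]) (auto simp: space_P intro!: abs_suminf_v_mult)
  finally show ?thesis .
qed

text \<open>The conditional probability that \<open>a\<close> replicas coincide.\<close>

definition power_sum :: "nat \<Rightarrow> 'a \<Rightarrow> real" where
  "power_sum a \<omega> = (\<Sum>l. v l \<omega> ^ a)"

lemma measurable_power_sum [measurable]: "power_sum a \<in> borel_measurable M"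
  unfolding power_sum_def by measurable

lemma power_sum_in_01: "\<omega> \<in> space M \<Longrightarrow> power_sum (Suc a) \<omega> \<in> {0..1}"
proof -
  assume \<omega>: "\<omega> \<in> space M"
  have *: "\<bar>v l \<omega> ^ a\<bar> \<le> 1" for l using v_in_01[OF \<omega>, of l] by (simp add: power_abs power_le_one)
  have "0 \<le> (\<Sum>l. v l \<omega> * v l \<omega> ^ a)"
    using v_in_01[OF \<omega>] by (intro suminf_nonneg summable_v_mult[OF \<omega> *]) auto
  then show ?thesis
    using abs_suminf_v_mult[OF \<omega>, of "\<lambda>l. v l \<omega> ^ a" 1] * by (simp add: power_sum_def)
qed

text \<open>The weight of the atom on which the replica \<open>i\<close> falls.\<close>

abbreviation weight_of :: "nat \<Rightarrow> 'a \<times> (nat \<Rightarrow> nat) \<Rightarrow> real" where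
  "weight_of i x \<equiv> v (snd x i) (fst x)"

lemma measurable_weight_of [measurable]: "weight_of i \<in> borel_measurable \<Omega>"
  by (rule measurable_compose_countable[where f="\<lambda>l x. v l (fst x)"]) measurable

lemma weight_of_in_01: "x \<in> space P \<Longrightarrow> weight_of i x \<in> {0..1}"
  using v_in_01 by (auto simp: space_P)

lemma pred_eq_index [measurable]: "Measurable.pred \<Omega> (\<lambda>x. snd x i = snd x j)"
  by (rule measurable_compose_countable[where f="\<lambda>l x. l = snd x j" and g="\<lambda>x. snd x i"]) measurable

lemma pred_eq_index_const [measurable]: "Measurable.pred \<Omega> (\<lambda>x. l = snd x j)"
  by measurable

text \<open>A fresh replica falls on the atom of the replica \<open>j\<close> with conditional probability its weight.\<close>

lemma integral_P_eq_index:
  assumes Y [measurable]: "Y \<in> borel_measurable \<Omega>"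
    and bound: "\<And>x. x \<in> space P \<Longrightarrow> \<bar>Y x\<bar> \<le> C"
    and indep: "\<And>\<omega> \<iota> j. Y (\<omega>, \<iota>(n := j)) = Y (\<omega>, \<iota>)" and "j \<noteq> n"
  shows "(\<integral>x. Y x * of_bool (snd x n = snd x j) \<partial>P) = (\<integral>x. Y x * weight_of j x \<partial>P)"
proof -
  have "(\<integral>x. Y x * of_bool (snd x n = snd x j) \<partial>P)
      = (\<integral>x. (\<Sum>l. v l (fst x) * (Y x * of_bool (l = snd x j))) \<partial>P)"
    using bound indep \<open>j \<noteq> n\<close> 
    by (subst integral_P_replica[where H="\<lambda>l x. Y x * of_bool (l = snd x j)" and C=C, symmetric]) (auto intro: bound_nonneg[OF bound])
  moreover have "(\<Sum>l. v l (fst x) * (Y x * of_bool (l = snd x j))) = Y x * weight_of j x" for x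
    using suminf_finite[of "{snd x j}" "\<lambda>l. v l (fst x) * (Y x * of_bool (l = snd x j))"] by simp
  ultimately show ?thesis by simp
qed

lemma integral_P_at_index:
  assumes Y [measurable]: "Y \<in> borel_measurable \<Omega>"
    and bound: "\<And>x. x \<in> space P \<Longrightarrow> \<bar>Y x\<bar> \<le> C"
    and indep: "\<And>\<omega> \<iota> j. Y (\<omega>, \<iota>(n := j)) = Y (\<omega>, \<iota>)"
  shows "(\<integral>x. Y x * of_bool (snd x n = l) \<partial>P) = (\<integral>x. Y x * v l (fst x) \<partial>P)"
proof -
  have "(\<integral>x. Y x * of_bool (snd x n = l) \<partial>P)
      = (\<integral>x. (\<Sum>l'. v l' (fst x) * (Y x * of_bool (l' = l))) \<partial>P)"
    using bound indep
    by (subst integral_P_replica[where H="\<lambda>l' x. Y x * of_bool (l' = l)" and C=C, symmetric]) (auto intro: bound_nonneg[OF bound])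
  moreover have "(\<Sum>l'. v l' (fst x) * (Y x * of_bool (l' = l))) = Y x * v l (fst x)" for x
    using suminf_finite[of "{l}" "\<lambda>l'. v l' (fst x) * (Y x * of_bool (l' = l))"] by simp
  ultimately show ?thesis by simp
qed

text \<open>A factor that is a power sum can be traded for a power of the weight of a fresh replica.\<close>

lemma integral_P_power_sum:
  assumes Y [measurable]: "Y \<in> borel_measurable \<Omega>"
    and bound: "\<And>x. x \<in> space P \<Longrightarrow> \<bar>Y x\<bar> \<le> C"
    and indep: "\<And>\<omega> \<iota> j. Y (\<omega>, \<iota>(n := j)) = Y (\<omega>, \<iota>)"
  shows "(\<integral>x. Y x * weight_of n x ^ a \<partial>P) = (\<integral>x. Y x * power_sum (Suc a) (fst x) \<partial>P)"
proof -
  have *: "\<bar>v l \<omega> ^ a\<bar> \<le> 1" if "\<omega> \<in> space M" for l \<omega> 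
    using v_in_01[OF that, of l] by (simp add: power_abs power_le_one)
  have "(\<integral>x. Y x * weight_of n x ^ a \<partial>P)
      = (\<integral>x. (\<Sum>l. v l (fst x) * (Y x * v l (fst x) ^ a)) \<partial>P)"
  proof (rule integral_P_replica[where H="\<lambda>l x. Y x * v l (fst x) ^ a" and C=C])
    fix l x assume x: "x \<in> space P"
    have "\<bar>Y x\<bar> * \<bar>v l (fst x) ^ a\<bar> \<le> C * 1"
      using x bound[OF x] *[of "fst x" l] by (intro mult_mono) (auto simp: space_P)
    then show "\<bar>Y x * v l (fst x) ^ a\<bar> \<le> C" by (simp add: abs_mult)
  qed (use indep in auto)
  also have "\<dots> = (\<integral>x. Y x * power_sum (Suc a) (fst x) \<partial>P)"
  proof (rule Bochner_Integration.integral_cong[OF refl])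
    fix x assume "x \<in> space P"
    then have "fst x \<in> space M" by (auto simp: space_P)
    note summable_v_mult[OF this *[OF this]]
    from suminf_mult[OF this, of "Y x"]
    show "(\<Sum>l. v l (fst x) * (Y x * v l (fst x) ^ a)) = Y x * power_sum (Suc a) (fst x)"
      by (simp add: power_sum_def mult_ac)
  qed
  finally show ?thesis .
qed

lemma distr_P_fst: "distr P M fst = M"
proof (rule measure_eqI)
  fix A assume "A \<in> sets (distr P M fst)"
  then have A [measurable]: "A \<in> sets M" by simp
  have "emeasure (distr P M fst) A = (\<integral>\<^sup>+x. indicator A (fst x) \<partial>P)"
    by (subst nn_integral_indicator[symmetric], simp, subst nn_integral_distr, measurable)
  also have "\<dots> = (\<integral>\<^sup>+\<omega>. \<integral>\<^sup>+\<iota>. indicator A \<omega> \<partial>sample_kernel v \<omega> \<partial>M)"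
    by (subst nn_integral_P) auto
  also have "\<dots> = (\<integral>\<^sup>+\<omega>. indicator A \<omega> \<partial>M)"
    using prob_space.emeasure_space_1[OF prob_space_sample_kernel] by (intro nn_integral_cong) simp
  finally show "emeasure (distr P M fst) A = emeasure M A" by simp
qed simp

lemma measurable_fst_P: "fst \<in> measurable P M"
  by measurable

lemma AE_P_fst: "AE \<omega> in M. R \<omega> \<Longrightarrow> AE x in P. R (fst x)"
  by (rule AE_distrD[OF measurable_fst_P]) (simp only: distr_P_fst)

lemma integral_P_fst:
  fixes g :: "'a \<Rightarrow> real"
  assumes "g \<in> borel_measurable M"
  shows "(\<integral>x. g (fst x) \<partial>P) = (\<integral>\<omega>. g \<omega> \<partial>M)"
  using integral_distr[OF measurable_fst_P assms] by (simp add: distr_P_fst)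

text \<open>The replicas \<open>0, \<dots>, k - 1\<close> fall on the atoms \<open>\<rho> 0, \<dots>, \<rho> (k - 1)\<close> with conditional probability
  the product of the weights of these atoms.\<close>

lemma integral_P_indices:
  fixes g :: "'a \<Rightarrow> real"
  assumes g [measurable]: "g \<in> borel_measurable M" and bound: "\<And>\<omega>. \<omega> \<in> space M \<Longrightarrow> \<bar>g \<omega>\<bar> \<le> C"
  shows "(\<integral>x. g (fst x) * of_bool (\<forall>i<k. snd x i = \<rho> i) \<partial>P) = (\<integral>\<omega>. g \<omega> * (\<Prod>i<k. v (\<rho> i) \<omega>) \<partial>M)"
  using g bound
proof (induction k arbitrary: g)
  case 0
  then show ?case by (simp add: integral_P_fst)
next
  case (Suc k)
  note [measurable] = Suc.prems(1)
  have "0 \<le> C"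
    using Suc.prems(2) by (intro bound_nonneg[of "\<lambda>x. g (fst x)"]) (auto simp: space_P)
  have "(\<integral>x. g (fst x) * of_bool (\<forall>i<Suc k. snd x i = \<rho> i) \<partial>P)
      = (\<integral>x. (g (fst x) * of_bool (\<forall>i<k. snd x i = \<rho> i)) * of_bool (snd x k = \<rho> k) \<partial>P)"
    by (intro Bochner_Integration.integral_cong) (auto simp: less_Suc_eq)
  also have "\<dots> = (\<integral>x. (g (fst x) * of_bool (\<forall>i<k. snd x i = \<rho> i)) * v (\<rho> k) (fst x) \<partial>P)"
    using Suc.prems(2) \<open>0 \<le> C\<close> by (intro integral_P_at_index[where C=C]) (auto simp: space_P)
  also have "\<dots> = (\<integral>x. (g (fst x) * v (\<rho> k) (fst x)) * of_bool (\<forall>i<k. snd x i = \<rho> i) \<partial>P)"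
    by (simp add: mult_ac)
  also have "\<dots> = (\<integral>\<omega>. (g \<omega> * v (\<rho> k) \<omega>) * (\<Prod>i<k. v (\<rho> i) \<omega>) \<partial>M)"
  proof (rule Suc.IH)
    fix \<omega> assume \<omega>: "\<omega> \<in> space M"
    have "\<bar>g \<omega>\<bar> * \<bar>v (\<rho> k) \<omega>\<bar> \<le> C * 1"
      using \<omega> Suc.prems(2)[OF \<omega>] v_in_01[OF \<omega>, of "\<rho> k"] by (intro mult_mono) auto
    then show "\<bar>g \<omega> * v (\<rho> k) \<omega>\<bar> \<le> C" by (simp add: abs_mult)
  qed measurable
  finally show ?case by (simp add: mult_ac)
qed

text \<open>What holds almost surely once certain atoms have been drawn holds almost surely, every atom
  having positive weight.\<close>

lemma AE_P_indicesD:
  assumes R [measurable]: "Measurable.pred M R"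
    and ae: "AE x in P. (\<forall>i<k. snd x i = \<rho> i) \<longrightarrow> R (fst x)"
  shows "AE \<omega> in M. R \<omega>"
proof -
  let ?g = "\<lambda>\<omega>. of_bool (\<not> R \<omega>) :: real"
  have "AE x in P. ?g (fst x) * of_bool (\<forall>i<k. snd x i = \<rho> i) = 0"
    using ae by eventually_elim auto
  then have "(\<integral>x. ?g (fst x) * of_bool (\<forall>i<k. snd x i = \<rho> i) \<partial>P) = 0"
    by (rule integral_eq_zero_AE)
  then have "(\<integral>\<omega>. ?g \<omega> * (\<Prod>i<k. v (\<rho> i) \<omega>) \<partial>M) = 0"
    by (subst (asm) integral_P_indices[where C=1]) auto
  moreover have "integrable M (\<lambda>\<omega>. ?g \<omega> * (\<Prod>i<k. v (\<rho> i) \<omega>))"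
  proof (rule integrable_const_bound[where B=1])
    show "AE \<omega> in M. norm (?g \<omega> * (\<Prod>i<k. v (\<rho> i) \<omega>)) \<le> 1"
    proof (rule AE_I2)
      fix \<omega> assume \<omega>: "\<omega> \<in> space M"
      have "\<bar>\<Prod>i<k. v (\<rho> i) \<omega>\<bar> \<le> 1"
        using v_in_01[OF \<omega>] by (simp add: abs_prod) (intro prod_le_1, auto)
      then show "norm (?g \<omega> * (\<Prod>i<k. v (\<rho> i) \<omega>)) \<le> 1" by (simp add: abs_mult)
    qed
  qed measurable
  ultimately have "AE \<omega> in M. ?g \<omega> * (\<Prod>i<k. v (\<rho> i) \<omega>) = 0"
    by (subst (asm) integral_nonneg_eq_0_iff_AE) (auto intro!: AE_I2 mult_nonneg_nonneg prod_nonneg simp: v_pos less_imp_le)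
  then show ?thesis
  proof (rule AE_mp, intro AE_I2 impI)
    fix \<omega> assume \<omega>: "\<omega> \<in> space M" and "?g \<omega> * (\<Prod>i<k. v (\<rho> i) \<omega>) = 0"
    moreover have "(\<Prod>i<k. v (\<rho> i) \<omega>) \<noteq> 0" using v_pos[OF \<omega>] by (simp add: less_imp_neq[symmetric])
    ultimately show "R \<omega>" by simp
  qed
qed

end

section \<open>The Ghirlanda--Guerra identities in terms of coincidences of replicas\<close>

abbreviation finite_array :: "nat \<Rightarrow> (nat \<times> nat \<Rightarrow> real) measure" where
  "finite_array n \<equiv> \<Pi>\<^sub>M p\<in>{..<n} \<times> {..<n}. borel"

text \<open>The array, indexed by replicas, that is obtained by drawing indices for an array \<open>Q\<close> indexed
  by atoms; for the Gram matrix of the atoms it is the array of the overlaps.\<close>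

definition sampled_array :: "('w \<Rightarrow> nat \<times> nat \<Rightarrow> real) \<Rightarrow> 'w \<times> (nat \<Rightarrow> nat) \<Rightarrow> nat \<times> nat \<Rightarrow> real" where
  "sampled_array Q x = (\<lambda>(i, j). Q (fst x) (snd x i, snd x j))"

text \<open>The part of an array that belongs to the first \<open>n\<close> indices.\<close>

abbreviation corner :: "nat \<Rightarrow> (nat \<times> nat \<Rightarrow> real) \<Rightarrow> nat \<times> nat \<Rightarrow> real" where
  "corner n R \<equiv> restrict R ({..<n} \<times> {..<n})"

lemma abs_mult_le_mult:
  fixes a b :: real
  assumes "\<bar>a\<bar> \<le> c" "\<bar>b\<bar> \<le> d"
  shows "\<bar>a * b\<bar> \<le> c * d"
  unfolding abs_mult using assms order_trans[OF abs_ge_zero assms(1)] by (intro mult_mono abs_ge_zero)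

lemma (in positive_weights) measurable_sampled_array_component:
  assumes A: "\<And>p. (\<lambda>\<omega>. A \<omega> p) \<in> borel_measurable M"
  shows "(\<lambda>x. sampled_array A x p) \<in> borel_measurable \<Omega>"
proof -
  have 1: "(\<lambda>x. A (fst x) (l, l')) \<in> borel_measurable \<Omega>" for l l'
    by (rule measurable_compose[OF measurable_fst A])
  have 2: "(\<lambda>x. A (fst x) (l, snd x (snd p))) \<in> borel_measurable \<Omega>" for l
    by (rule measurable_compose_countable[where f="\<lambda>l' x. A (fst x) (l, l')", OF 1 measurable_index])
  have "(\<lambda>x. A (fst x) (snd x (fst p), snd x (snd p))) \<in> borel_measurable \<Omega>"
    by (rule measurable_compose_countable[where f="\<lambda>l x. A (fst x) (l, snd x (snd p))", OF 2 measurable_index])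
  then show ?thesis by (simp add: sampled_array_def case_prod_beta')
qed

text \<open>A random array, indexed by the atoms, whose sampled array satisfies the Ghirlanda--Guerra
  identities for the function \<open>\<psi> = indicator {q}\<close>, where the value \<open>q\<close> marks the diagonal. With such a
  value, \<open>\<psi>\<close> of an overlap is the indicator of a coincidence.\<close>

locale gg_array = positive_weights M v for M :: "'w measure" and v +
  fixes Q :: "'w \<Rightarrow> nat \<times> nat \<Rightarrow> real" and q :: real
  assumes Q_measurable: "\<And>p. (\<lambda>\<omega>. Q \<omega> p) \<in> borel_measurable M"
    and Q_eq_q_iff: "\<And>\<omega> l l'. \<omega> \<in> space M \<Longrightarrow> Q \<omega> (l, l') = q \<longleftrightarrow> l = l'"
    and GG: "\<And>n f. 2 \<le> n \<Longrightarrow> f \<in> borel_measurable (finite_array n) \<Longrightarrow>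
      bounded (f ` space (finite_array n)) \<Longrightarrow>
      (\<integral>x. f (corner n (sampled_array Q x)) * of_bool (snd x 0 = snd x n) \<partial>P) =
        1 / real n * (\<integral>x. f (corner n (sampled_array Q x)) \<partial>P) * (\<integral>x. of_bool (snd x 0 = snd x 1) \<partial>P)
        + 1 / real n * (\<Sum>l = 1..<n. \<integral>x. f (corner n (sampled_array Q x)) * of_bool (snd x 0 = snd x l) \<partial>P)"
begin

abbreviation S :: "'w \<times> (nat \<Rightarrow> nat) \<Rightarrow> nat \<times> nat \<Rightarrow> real" where
  "S \<equiv> sampled_array Q"

lemma measurable_sampled_array [measurable]: "(\<lambda>x. S x p) \<in> borel_measurable \<Omega>"
  by (rule measurable_sampled_array_component[OF Q_measurable])

lemma measurable_corner [measurable]: "(\<lambda>x. corner n (S x)) \<in> \<Omega> \<rightarrow>\<^sub>M finite_array n"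
  by (rule measurable_restrict) measurable

text \<open>The probability that two replicas coincide.\<close>

definition collision :: real where
  "collision = (\<integral>x. of_bool (snd x 0 = snd x 1) \<partial>P)"

text \<open>The bounded measurable functions of the array of the first \<open>n\<close> replicas.\<close>

definition replica_function :: "nat \<Rightarrow> ('w \<times> (nat \<Rightarrow> nat) \<Rightarrow> real) \<Rightarrow> bool" where
  "replica_function n h \<longleftrightarrow> (\<exists>f\<in>borel_measurable (finite_array n). bounded (f ` space (finite_array n)) \<and>
    (\<forall>x\<in>space P. h x = f (corner n (S x))))"

lemma replica_functionI:
  assumes "f \<in> borel_measurable (finite_array n)" "\<And>R. R \<in> space (finite_array n) \<Longrightarrow> \<bar>f R\<bar> \<le> C"
    "\<And>x. x \<in> space P \<Longrightarrow> h x = f (corner n (S x))"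
  shows "replica_function n h"
  using assms unfolding replica_function_def bounded_iff by (intro bexI[of _ f]) auto

lemma corner_in_space: "corner n R \<in> space (finite_array n)"
  by (simp add: space_PiM)

lemma replica_functionE:
  assumes "replica_function n h"
  obtains f C where "f \<in> borel_measurable (finite_array n)" "\<And>R. R \<in> space (finite_array n) \<Longrightarrow> \<bar>f R\<bar> \<le> C"
    "\<And>x. x \<in> space P \<Longrightarrow> h x = f (corner n (S x))"
  using assms unfolding replica_function_def bounded_iff by (auto simp: image_iff)

lemma replica_function_measurable:
  assumes "replica_function n h"
  shows "h \<in> borel_measurable P"
proof -
  obtain f C where f: "f \<in> borel_measurable (finite_array n)" "\<And>x. x \<in> space P \<Longrightarrow> h x = f (corner n (S x))"
    using assms by (rule replica_functionE) blast
  note [measurable] = f(1)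
  have "(\<lambda>x. f (corner n (S x))) \<in> borel_measurable P" by measurable
  then show ?thesis using f(2) by (simp cong: measurable_cong)
qed

lemma replica_function_bounded:
  assumes "replica_function n h"
  obtains C where "\<And>x. x \<in> space P \<Longrightarrow> \<bar>h x\<bar> \<le> C"
proof -
  obtain f C where f: "\<And>R. R \<in> space (finite_array n) \<Longrightarrow> \<bar>f R\<bar> \<le> C" "\<And>x. x \<in> space P \<Longrightarrow> h x = f (corner n (S x))"
    using assms by (rule replica_functionE) blast
  then show ?thesis using corner_in_space by (intro that[of C]) auto
qed

lemma replica_function_integrable:
  assumes "replica_function n h"
  shows "integrable P h"
proof -
  obtain C where "\<And>x. x \<in> space P \<Longrightarrow> \<bar>h x\<bar> \<le> C" using assms by (rule replica_function_bounded) blast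
  then show ?thesis
    by (intro P.integrable_const_bound[where B=C] replica_function_measurable[OF assms]) auto
qed

lemma replica_function_mult:
  assumes "replica_function n h" "replica_function n h'"
  shows "replica_function n (\<lambda>x. h x * h' x)"
proof -
  obtain f C where f: "f \<in> borel_measurable (finite_array n)" "\<And>R. R \<in> space (finite_array n) \<Longrightarrow> \<bar>f R\<bar> \<le> C"
    "\<And>x. x \<in> space P \<Longrightarrow> h x = f (corner n (S x))" using assms(1) by (rule replica_functionE) blast
  obtain f' C' where f': "f' \<in> borel_measurable (finite_array n)" "\<And>R. R \<in> space (finite_array n) \<Longrightarrow> \<bar>f' R\<bar> \<le> C'"
    "\<And>x. x \<in> space P \<Longrightarrow> h' x = f' (corner n (S x))" using assms(2) by (rule replica_functionE) blast
  show ?thesis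
    using f f' by (intro replica_functionI[where f="\<lambda>R. f R * f' R" and C="C * C'"] abs_mult_le_mult) auto
qed

lemma replica_function_const: "replica_function n (\<lambda>x. c)"
  by (rule replica_functionI[where f="\<lambda>_. c" and C="\<bar>c\<bar>"]) auto

lemma replica_function_diff:
  assumes "replica_function n h" "replica_function n h'"
  shows "replica_function n (\<lambda>x. h x - h' x)"
proof -
  obtain f C where f: "f \<in> borel_measurable (finite_array n)" "\<And>R. R \<in> space (finite_array n) \<Longrightarrow> \<bar>f R\<bar> \<le> C"
    "\<And>x. x \<in> space P \<Longrightarrow> h x = f (corner n (S x))" using assms(1) by (rule replica_functionE) blast
  obtain f' C' where f': "f' \<in> borel_measurable (finite_array n)" "\<And>R. R \<in> space (finite_array n) \<Longrightarrow> \<bar>f' R\<bar> \<le> C'"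
    "\<And>x. x \<in> space P \<Longrightarrow> h' x = f' (corner n (S x))" using assms(2) by (rule replica_functionE) blast
  show ?thesis
  proof (rule replica_functionI[where f="\<lambda>R. f R - f' R" and C="C + C'"])
    fix R assume "R \<in> space (finite_array n)"
    then show "\<bar>f R - f' R\<bar> \<le> C + C'" using f(2)[of R] f'(2)[of R] by linarith
  qed (use f f' in auto)
qed

lemma sampled_array_eq_q_iff: "x \<in> space P \<Longrightarrow> S x (i, j) = q \<longleftrightarrow> snd x i = snd x j"
  using Q_eq_q_iff[of "fst x" "snd x i" "snd x j"] by (auto simp: sampled_array_def space_P)

lemma replica_function_eq_index:
  assumes "i < n" "j < n"
  shows "replica_function n (\<lambda>x. of_bool (snd x i = snd x j))"
proof (rule replica_functionI[where f="\<lambda>R. indicator {q} (R (i, j))" and C=1])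
  have "(\<lambda>R. R (i, j)) \<in> borel_measurable (finite_array n)"
    by (rule measurable_component_singleton) (use assms in auto)
  then show "(\<lambda>R. indicator {q} (R (i, j))) \<in> borel_measurable (finite_array n)"
    by measurable
qed (use assms sampled_array_eq_q_iff in \<open>auto simp: indicator_def\<close>)

lemma replica_function_not:
  "replica_function n (\<lambda>x. of_bool (R x)) \<Longrightarrow> replica_function n (\<lambda>x. of_bool (\<not> R x))"
  using replica_function_diff[OF replica_function_const[of n 1], of "\<lambda>x. of_bool (R x)"]
  by (simp add: of_bool_not_iff)

lemma replica_function_conj:
  "replica_function n (\<lambda>x. of_bool (R x)) \<Longrightarrow> replica_function n (\<lambda>x. of_bool (R' x)) \<Longrightarrow>
    replica_function n (\<lambda>x. of_bool (R x \<and> R' x))"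
  using replica_function_mult[of n "\<lambda>x. of_bool (R x)" "\<lambda>x. of_bool (R' x)"] by (simp add: of_bool_conj)

lemma replica_function_Ball:
  assumes "finite I" "\<And>i. i \<in> I \<Longrightarrow> replica_function n (\<lambda>x. of_bool (R i x))"
  shows "replica_function n (\<lambda>x. of_bool (\<forall>i\<in>I. R i x))"
  using assms
proof (induction I rule: finite_induct)
  case empty
  then show ?case using replica_function_const[of n 1] by simp
next
  case (insert i I)
  then show ?case using replica_function_conj[of n "R i" "\<lambda>x. \<forall>i\<in>I. R i x"] by simp
qed

lemma replica_function_corner:
  assumes "k \<le> n" "A \<in> sets (finite_array k)"
  shows "replica_function n (\<lambda>x. indicator A (corner k (S x)))"
proof (rule replica_functionI[where f="\<lambda>R. indicator A (corner k R)" and C=1])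
  have [measurable]: "(\<lambda>R. corner k R) \<in> finite_array n \<rightarrow>\<^sub>M finite_array k"
    using assms(1) by (intro measurable_restrict_subset) auto
  show "(\<lambda>R. indicator A (corner k R)) \<in> borel_measurable (finite_array n)"
    using assms(2) by measurable
  have "corner k (corner n R) = corner k R" for R
    using assms(1) by (auto simp: restrict_def fun_eq_iff)
  then show "indicator A (corner k (S x)) = indicator A (corner k (corner n (S x)))" for x
    by simp
qed (auto simp: indicator_def)

lemma replica_function_permute:
  assumes h: "replica_function n h" and \<pi>: "\<And>i. i < n \<Longrightarrow> \<pi> i < n"
  shows "replica_function n (\<lambda>x. h (fst x, \<lambda>i. snd x (\<pi> i)))"
proof -
  obtain f C where f: "f \<in> borel_measurable (finite_array n)" "\<And>R. R \<in> space (finite_array n) \<Longrightarrow> \<bar>f R\<bar> \<le> C"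
    "\<And>x. x \<in> space P \<Longrightarrow> h x = f (corner n (S x))" using h by (rule replica_functionE) blast
  let ?r = "\<lambda>R. \<lambda>p\<in>{..<n} \<times> {..<n}. R (\<pi> (fst p), \<pi> (snd p))"
  have r: "?r \<in> finite_array n \<rightarrow>\<^sub>M finite_array n"
    by (rule measurable_restrict, rule measurable_component_singleton) (simp add: mem_Times_iff \<pi>)
  show ?thesis
  proof (rule replica_functionI[where f="\<lambda>R. f (?r R)" and C=C])
    show "(\<lambda>R. f (?r R)) \<in> borel_measurable (finite_array n)" by (rule measurable_compose[OF r f(1)])
    show "\<bar>f (?r R)\<bar> \<le> C" for R by (rule f(2)) (simp add: space_PiM)
    fix x assume "x \<in> space P"
    then have "(fst x, \<lambda>i. snd x (\<pi> i)) \<in> space P" by (simp add: space_P mem_Times_iff)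
    from f(3)[OF this] have "h (fst x, \<lambda>i. snd x (\<pi> i)) = f (corner n (S (fst x, \<lambda>i. snd x (\<pi> i))))" .
    also have "corner n (S (fst x, \<lambda>i. snd x (\<pi> i))) = ?r (corner n (S x))"
    proof
      fix p :: "nat \<times> nat"
      show "corner n (S (fst x, \<lambda>i. snd x (\<pi> i))) p = ?r (corner n (S x)) p"
      proof (cases "p \<in> {..<n} \<times> {..<n}")
        case True
        then have "(\<pi> (fst p), \<pi> (snd p)) \<in> {..<n} \<times> {..<n}" by (simp add: mem_Times_iff \<pi>)
        with True show ?thesis by (simp add: sampled_array_def case_prod_beta)
      next
        case False
        then show ?thesis by simp
      qed
    qed
    finally show "h (fst x, \<lambda>i. snd x (\<pi> i)) = f (?r (corner n (S x)))" .
  qed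
qed

text \<open>The Ghirlanda--Guerra identity with an arbitrary distinguished replica \<open>j\<close>.\<close>

lemma GG_replica:
  assumes n: "2 \<le> n" and j: "j < n" and h: "replica_function n h"
  shows "(\<integral>x. h x * of_bool (snd x j = snd x n) \<partial>P) =
    1 / real n * collision * (\<integral>x. h x \<partial>P)
    + 1 / real n * (\<Sum>l\<in>{..<n} - {j}. \<integral>x. h x * of_bool (snd x j = snd x l) \<partial>P)"
proof -
  define \<tau> where "\<tau> = Transposition.transpose 0 j"
  have \<tau>\<tau> [simp]: "\<tau> (\<tau> i) = i" for i by (simp add: \<tau>_def)
  have \<tau>_less: "\<tau> i < n" if "i < n" for i using that j n by (auto simp: \<tau>_def Transposition.transpose_def)
  have \<tau>n: "\<tau> n = n" "\<tau> 0 = j" "\<tau> j = 0" using j n by (auto simp: \<tau>_def Transposition.transpose_def)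
  have inj: "inj \<tau>" by (metis \<tau>\<tau> injI)
  define h' where "h' = (\<lambda>x. h (fst x, \<lambda>i. snd x (\<tau> i)))"
  have "replica_function n h'" unfolding h'_def by (rule replica_function_permute[OF h \<tau>_less])
  then obtain f C where f: "f \<in> borel_measurable (finite_array n)" "\<And>R. R \<in> space (finite_array n) \<Longrightarrow> \<bar>f R\<bar> \<le> C"
    "\<And>x. x \<in> space P \<Longrightarrow> h' x = f (corner n (S x))" by (rule replica_functionE) blast
  have bdd: "bounded (f ` space (finite_array n))" using f(2) by (auto simp: bounded_iff)
  note [measurable] = f(1)
  have C0: "0 \<le> C" using f(2)[OF corner_in_space] by (meson abs_ge_zero order_trans)
  have swap: "(\<integral>x. h x * of_bool (snd x j = snd x (\<tau> l)) \<partial>P) = (\<integral>x. f (corner n (S x)) * of_bool (snd x 0 = snd x l) \<partial>P)" for l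
  proof -
    have "(\<integral>x. h x * of_bool (snd x j = snd x (\<tau> l)) \<partial>P)
      = (\<integral>x. f (corner n (S (fst x, \<lambda>i. snd x (\<tau> i)))) * of_bool (snd x (\<tau> 0) = snd x (\<tau> l)) \<partial>P)"
    proof (rule Bochner_Integration.integral_cong[OF refl])
      fix x assume "x \<in> space P"
      then have "(fst x, \<lambda>i. snd x (\<tau> i)) \<in> space P" by (simp add: space_P mem_Times_iff)
      from f(3)[OF this] show "h x * of_bool (snd x j = snd x (\<tau> l)) =
        f (corner n (S (fst x, \<lambda>i. snd x (\<tau> i)))) * of_bool (snd x (\<tau> 0) = snd x (\<tau> l))"
        by (simp add: h'_def \<tau>n)
    qed
    also have "\<dots> = (\<integral>x. f (corner n (S x)) * of_bool (snd x 0 = snd x l) \<partial>P)"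
      using integral_P_permute[of "\<lambda>x. f (corner n (S x)) * of_bool (snd x 0 = snd x l)" C \<tau>] f(2)[OF corner_in_space] inj C0
      by simp
    finally show ?thesis .
  qed
  have swap0: "(\<integral>x. h x \<partial>P) = (\<integral>x. f (corner n (S x)) \<partial>P)"
    using swap[of 0] by (simp add: \<tau>n)
  have "(\<integral>x. h x * of_bool (snd x j = snd x n) \<partial>P) = (\<integral>x. f (corner n (S x)) * of_bool (snd x 0 = snd x n) \<partial>P)"
    using swap[of n] by (simp add: \<tau>n)
  also have "\<dots> = 1 / real n * collision * (\<integral>x. h x \<partial>P)
      + 1 / real n * (\<Sum>l = 1..<n. \<integral>x. h x * of_bool (snd x j = snd x (\<tau> l)) \<partial>P)"
    by (simp add: GG[OF n f(1) bdd] swap swap0 collision_def)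
  also have "(\<Sum>l = 1..<n. \<integral>x. h x * of_bool (snd x j = snd x (\<tau> l)) \<partial>P)
      = (\<Sum>l\<in>{..<n} - {j}. \<integral>x. h x * of_bool (snd x j = snd x l) \<partial>P)"
  proof (rule sum.reindex_bij_witness[where i=\<tau> and j=\<tau>])
    fix l assume l: "l \<in> {1..<n}"
    have "\<tau> l \<noteq> j"
    proof
      assume "\<tau> l = j"
      then have "\<tau> (\<tau> l) = 0" using \<tau>n(3) by simp
      then show False using l by simp
    qed
    then show "\<tau> l \<in> {..<n} - {j}" using \<tau>_less[of l] l by auto
  next
    fix l assume l: "l \<in> {..<n} - {j}"
    have "\<tau> l \<noteq> 0"
    proof
      assume "\<tau> l = 0"
      then have "\<tau> (\<tau> l) = j" using \<tau>n(2) by simp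
      then show False using l by simp
    qed
    then show "\<tau> l \<in> {1..<n}" using \<tau>_less[of l] l by auto
  qed auto
  finally show ?thesis .
qed

text \<open>The replicas \<open>0, \<dots>, k - 1\<close> fall on distinct atoms.\<close>

definition distinct_replicas :: "nat \<Rightarrow> 'w \<times> (nat \<Rightarrow> nat) \<Rightarrow> bool" where
  "distinct_replicas k x \<longleftrightarrow> (\<forall>i\<in>{..<k}. \<forall>j\<in>{..<k}. i \<noteq> j \<longrightarrow> snd x i \<noteq> snd x j)"

lemma measurable_distinct_replicas [measurable]: "Measurable.pred \<Omega> (distinct_replicas k)"
  unfolding distinct_replicas_def by measurable

lemma replica_function_distinct: 
  assumes "k \<le> n"
  shows "replica_function n (\<lambda>x. of_bool (distinct_replicas k x))"
  unfolding distinct_replicas_def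
proof (intro replica_function_Ball finite_lessThan)
  fix i j assume "i \<in> {..<k}" "j \<in> {..<k}"
  then have "i < n" "j < n" using assms by auto
  then show "replica_function n (\<lambda>x. of_bool (i \<noteq> j \<longrightarrow> snd x i \<noteq> snd x j))"
    using replica_function_not[OF replica_function_eq_index[of i n j]] replica_function_const[of n 1]
    by (cases "i = j") auto
qed

text \<open>A coincidence event, given by a set of pairs of replicas.\<close>

definition equalities :: "(nat \<times> nat) set \<Rightarrow> 'w \<times> (nat \<Rightarrow> nat) \<Rightarrow> bool" where
  "equalities E x \<longleftrightarrow> (\<forall>p\<in>E. snd x (fst p) = snd x (snd p))"

lemma replica_function_equalities:
  assumes "E \<subseteq> {..<n} \<times> {..<n}"
  shows "replica_function n (\<lambda>x. of_bool (equalities E x))"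
  unfolding equalities_def
proof (rule replica_function_Ball)
  show "finite E" using assms by (rule finite_subset) auto
  fix p assume "p \<in> E"
  then show "replica_function n (\<lambda>x. of_bool (snd x (fst p) = snd x (snd p)))"
    using assms by (intro replica_function_eq_index) auto
qed

text \<open>The conditional probability that the array of the first \<open>k\<close> replicas is in \<open>A\<close>, given that
  these replicas are distinct.\<close>

definition ratio :: "nat \<Rightarrow> (nat \<times> nat \<Rightarrow> real) set \<Rightarrow> real" where
  "ratio k A = (\<integral>x. of_bool (distinct_replicas k x) * indicator A (corner k (S x)) \<partial>P)
    / (\<integral>x. of_bool (distinct_replicas k x) \<partial>P)"

text \<open>The event that the array of \<open>k\<close> distinct replicas is in \<open>A\<close>, centered. That an integral against
  \<open>deviation k A\<close> vanishes expresses independence given that the first \<open>k\<close> replicas are distinct.\<close>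

definition deviation :: "nat \<Rightarrow> (nat \<times> nat \<Rightarrow> real) set \<Rightarrow> 'w \<times> (nat \<Rightarrow> nat) \<Rightarrow> real" where
  "deviation k A x = of_bool (distinct_replicas k x) * (indicator A (corner k (S x)) - ratio k A)"

lemma replica_function_deviation:
  assumes "k \<le> n" "A \<in> sets (finite_array k)"
  shows "replica_function n (deviation k A)"
  unfolding deviation_def [abs_def]
  using assms by (intro replica_function_mult replica_function_diff replica_function_const
      replica_function_distinct replica_function_corner)

lemma measurable_deviation [measurable]:
  assumes [measurable]: "A \<in> sets (finite_array k)"
  shows "deviation k A \<in> borel_measurable \<Omega>"
  unfolding deviation_def [abs_def] by measurable

lemma integral_deviation:
  assumes A: "A \<in> sets (finite_array k)"
  shows "(\<integral>x. deviation k A x \<partial>P) = 0"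
proof -
  have i1: "integrable P (\<lambda>x. of_bool (distinct_replicas k x) :: real)"
    by (rule replica_function_integrable[OF replica_function_distinct[of k k]]) simp
  have i2: "integrable P (\<lambda>x. of_bool (distinct_replicas k x) * indicator A (corner k (S x)) :: real)"
    by (rule replica_function_integrable[of k])
       (intro replica_function_mult replica_function_distinct replica_function_corner A order_refl)
  have "(\<integral>x. deviation k A x \<partial>P) = (\<integral>x. of_bool (distinct_replicas k x) * indicator A (corner k (S x)) \<partial>P)
    - ratio k A * (\<integral>x. of_bool (distinct_replicas k x) \<partial>P)"
    using i1 i2 by (simp add: deviation_def right_diff_distrib mult.commute[of _ "ratio k A"])
  also have "\<dots> = 0"
  proof (cases "(\<integral>x. of_bool (distinct_replicas k x) \<partial>P) = (0 :: real)")
    case True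
    have "(\<integral>x. of_bool (distinct_replicas k x) * indicator A (corner k (S x)) \<partial>P)
        \<le> (\<integral>x. of_bool (distinct_replicas k x) \<partial>P :: real)"
      using i1 i2 by (intro integral_mono) (auto simp: indicator_def)
    moreover have "0 \<le> (\<integral>x. of_bool (distinct_replicas k x) * indicator A (corner k (S x)) \<partial>P :: real)"
      by (intro Bochner_Integration.integral_nonneg) auto
    ultimately show ?thesis using True by simp
  next
    case False
    then show ?thesis by (simp add: ratio_def)
  qed
  finally show ?thesis .
qed

text \<open>The coincidence pattern of the replicas does not see the array of distinct ones.\<close>

lemma integral_deviation_equalities:
  assumes k: "2 \<le> k" and A: "A \<in> sets (finite_array k)"
    and "k \<le> N" "E \<subseteq> {..<N} \<times> {..<N}"
  shows "(\<integral>x. deviation k A x * of_bool (equalities E x) \<partial>P) = 0"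
  using assms(3,4)
proof (induction N arbitrary: E rule: dec_induct)
  case base
  show ?case
  proof (cases "E \<subseteq> Id")
    case True
    then have "equalities E x" for x by (auto simp: equalities_def)
    then show ?thesis using integral_deviation[OF A] by simp
  next
    case False
    then obtain i j where ij: "(i, j) \<in> E" "i \<noteq> j" by auto
    then have "i < k" "j < k" using base by auto
    have "deviation k A x * of_bool (equalities E x) = 0" for x
    proof (cases "equalities E x")
      case True
      then have "snd x i = snd x j" using ij by (auto simp: equalities_def)
      then have "\<not> distinct_replicas k x" using ij \<open>i < k\<close> \<open>j < k\<close> by (auto simp: distinct_replicas_def)
      then show ?thesis by (simp add: deviation_def)
    qed simp
    then show ?thesis by (simp only: Bochner_Integration.integral_zero)
  qed
next
  \<comment> \<open>If \<open>N\<close> is related to an older replica \<open>j\<close>, the event says that \<open>N\<close> coincides with \<open>j\<close> and that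
    the equalities hold with \<open>N\<close> replaced by \<open>j\<close>. The identities for the replica \<open>j\<close> reduce this to coincidence
    events of the first \<open>N\<close> replicas.\<close>
  case (step N)
  show ?case
  proof (cases "\<exists>j<N. (N, j) \<in> E \<or> (j, N) \<in> E")
    case True
    then obtain j where j: "j < N" "(N, j) \<in> E \<or> (j, N) \<in> E" by blast
    define r where "r i = (if i = N then j else i)" for i
    define E' where "E' = map_prod r r ` E"
    have E': "E' \<subseteq> {..<N} \<times> {..<N}"
      using step.prems j by (auto simp: E'_def r_def less_Suc_eq)
    have eq: "equalities E x \<longleftrightarrow> equalities E' x \<and> snd x j = snd x N" for x
    proof -
      have jN: "equalities E x \<Longrightarrow> snd x j = snd x N" using j by (auto simp: equalities_def)
      have r: "snd x j = snd x N \<Longrightarrow> snd x (r i) = snd x i" for i by (simp add: r_def)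
      show ?thesis
      proof (cases "snd x j = snd x N")
        case True
        then show ?thesis by (simp add: equalities_def E'_def r)
      next
        case False
        then show ?thesis using jN by blast
      qed
    qed
    have h: "replica_function N (\<lambda>x. deviation k A x * of_bool (equalities E' x))"
      using step.hyps by (intro replica_function_mult replica_function_deviation A replica_function_equalities E')
    have "(\<integral>x. deviation k A x * of_bool (equalities E x) \<partial>P)
      = (\<integral>x. deviation k A x * of_bool (equalities E' x) * of_bool (snd x j = snd x N) \<partial>P)"
      by (simp add: eq of_bool_conj mult_ac)
    also have "\<dots> = 1 / real N * collision * (\<integral>x. deviation k A x * of_bool (equalities E' x) \<partial>P)
      + 1 / real N * (\<Sum>l\<in>{..<N} - {j}. \<integral>x. deviation k A x * of_bool (equalities E' x) * of_bool (snd x j = snd x l) \<partial>P)"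
      using step.hyps k j(1) by (intro GG_replica h) auto
    also have "(\<integral>x. deviation k A x * of_bool (equalities E' x) * of_bool (snd x j = snd x l) \<partial>P) = 0" if "l < N" for l
    proof -
      have "(\<integral>x. deviation k A x * of_bool (equalities (insert (j, l) E') x) \<partial>P) = 0"
        using E' j(1) that by (intro step.IH) auto
      then show ?thesis by (simp add: equalities_def of_bool_conj mult_ac)
    qed
    then have "(\<Sum>l\<in>{..<N} - {j}. \<integral>x. deviation k A x * of_bool (equalities E' x) * of_bool (snd x j = snd x l) \<partial>P) = 0"
      by (intro sum.neutral) auto
    also have "(\<integral>x. deviation k A x * of_bool (equalities E' x) \<partial>P) = 0"
      by (rule step.IH[OF E'])
    finally show ?thesis by simp
  next
    case False
    define E' where "E' = E - {(N, N)}"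
    have "E' \<subseteq> {..<N} \<times> {..<N}"
    proof
      fix p assume "p \<in> E'"
      then have p: "(fst p, snd p) \<in> E" "p \<noteq> (N, N)" by (auto simp: E'_def)
      then have less: "fst p < Suc N" "snd p < Suc N" using step.prems by auto
      have "fst p \<noteq> N"
      proof
        assume "fst p = N"
        then show False using p less False by (metis less_SucE prod.collapse)
      qed
      moreover have "snd p \<noteq> N"
      proof
        assume "snd p = N"
        then show False using p less False by (metis less_SucE prod.collapse)
      qed
      ultimately show "p \<in> {..<N} \<times> {..<N}" using less by (simp add: mem_Times_iff)
    qed
    moreover have "equalities E x \<longleftrightarrow> equalities E' x" for x by (auto simp: equalities_def E'_def)
    ultimately show ?thesis using step.IH by simp
  qed
qed

end

section \<open>Independence of the weights of the sampled atoms\<close>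

text \<open>The non-increasing weights as a function of their power sums, \<open>y a\<close> being the power sum with
  exponent \<open>a + 1\<close>: the power sum of the weights from \<open>l\<close> on lies between \<open>v l ^ (a + 1)\<close> and \<open>v l ^ a\<close>.\<close>

fun weights_of_power_sums :: "(nat \<Rightarrow> real) \<Rightarrow> nat \<Rightarrow> real" where
  "weights_of_power_sums y l =
    lim (\<lambda>a. (y a - (\<Sum>i<l. weights_of_power_sums y i ^ Suc a)) powr (1 / real (Suc a)))"

declare weights_of_power_sums.simps [simp del]

lemma measurable_weights_of_power_sums [measurable]:
  "(\<lambda>y. weights_of_power_sums y l) \<in> borel_measurable (\<Pi>\<^sub>M a\<in>(UNIV :: nat set). borel)"
proof (induction l rule: less_induct)
  case (less l)
  have [measurable]: "(\<lambda>y. weights_of_power_sums y i) \<in> borel_measurable (\<Pi>\<^sub>M a\<in>(UNIV :: nat set). borel)"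
    if "i \<in> {..<l}" for i using less that by simp
  have "(\<lambda>y. lim (\<lambda>a. (y a - (\<Sum>i<l. weights_of_power_sums y i ^ Suc a)) powr (1 / real (Suc a))))
      \<in> borel_measurable (\<Pi>\<^sub>M a\<in>(UNIV :: nat set). borel)"
    by (intro borel_measurable_lim_metric) measurable
  then show ?case by (subst weights_of_power_sums.simps)
qed

lemma weights_of_power_sums:
  fixes w :: "nat \<Rightarrow> real"
  assumes pos: "\<And>l. 0 < w l" and dec: "decseq w" and sums: "w sums 1"
  shows "weights_of_power_sums (\<lambda>a. \<Sum>l. w l ^ Suc a) l = w l"
proof (induction l rule: less_induct)
  case (less l)
  have le1: "w i \<le> 1" for i
    using sum_le_suminf[OF sums_summable[OF sums], of "{i}"] sums_unique[OF sums] pos by (simp add: less_imp_le)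
  have summ: "summable (\<lambda>i. w i ^ Suc a)" for a
    by (rule summable_comparison_test'[OF sums_summable[OF sums], where N=0])
       (use pos le1 in \<open>simp add: mult_left_le power_le_one less_imp_le\<close>)
  let ?r = "\<lambda>a. (\<Sum>i. w i ^ Suc a) - (\<Sum>i<l. w i ^ Suc a)"
  have tail: "?r a = (\<Sum>i. w (i + l) ^ Suc a)" for a
    using suminf_minus_initial_segment[OF summ[of a], of l] by simp
  have summ_l: "summable (\<lambda>i. w (i + l) ^ Suc a)" for a
    using summ[of a] by (subst summable_iff_shift)
  have lower: "w l ^ Suc a \<le> ?r a" for a
    unfolding tail using sum_le_suminf[OF summ_l[of a], of "{0}"] pos by (simp add: less_imp_le)
  have upper: "?r a \<le> w l ^ a" for a
  proof -
    have "?r a \<le> (\<Sum>i. w l ^ a * w (i + l))"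
      unfolding tail
    proof (rule suminf_le[OF _ summ_l])
      show "w (i + l) ^ Suc a \<le> w l ^ a * w (i + l)" for i
        using power_mono[of "w (i + l)" "w l" a] decseqD[OF dec, of l "i + l"] pos[of "i + l"]
        by (simp add: mult.commute)
      show "summable (\<lambda>i. w l ^ a * w (i + l))"
        using sums_summable[OF sums] by (intro summable_mult) (subst summable_iff_shift)
    qed
    also have "\<dots> = w l ^ a * (\<Sum>i. w (i + l))"
      using sums_summable[OF sums] by (intro suminf_mult) (subst summable_iff_shift)
    also have "\<dots> \<le> w l ^ a * 1"
    proof (intro mult_left_mono)
      have "(\<Sum>i. w (i + l)) = 1 - (\<Sum>i<l. w i)"
        using suminf_minus_initial_segment[OF sums_summable[OF sums], of l] sums_unique[OF sums] by simp
      also have "\<dots> \<le> 1" using pos by (simp add: sum_nonneg less_imp_le)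
      finally show "(\<Sum>i. w (i + l)) \<le> 1" .
    qed (use pos in \<open>simp add: less_imp_le\<close>)
    finally show ?thesis by simp
  qed
  have lim: "(\<lambda>a. ?r a powr (1 / real (Suc a))) \<longlonglongrightarrow> w l"
  proof (rule tendsto_sandwich)
    show "eventually (\<lambda>a. w l \<le> ?r a powr (1 / real (Suc a))) sequentially"
    proof (intro always_eventually allI)
      fix a
      have "w l = (w l powr real (Suc a)) powr (1 / real (Suc a))"
        using pos[of l] by (subst powr_powr) simp
      also have "\<dots> = (w l ^ Suc a) powr (1 / real (Suc a))"
        using pos[of l] by (subst powr_realpow) auto
      also have "\<dots> \<le> ?r a powr (1 / real (Suc a))"
        using lower[of a] pos[of l] by (intro powr_mono2) auto
      finally show "w l \<le> ?r a powr (1 / real (Suc a))" .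
    qed
    show "eventually (\<lambda>a. ?r a powr (1 / real (Suc a)) \<le> w l powr (real a / real (Suc a))) sequentially"
    proof (intro always_eventually allI)
      fix a
      have "0 \<le> ?r a" using lower[of a] zero_le_power[of "w l" "Suc a"] pos[of l] by linarith
      then have "?r a powr (1 / real (Suc a)) \<le> (w l ^ a) powr (1 / real (Suc a))"
        using upper[of a] by (intro powr_mono2) auto
      also have "\<dots> = (w l powr real a) powr (1 / real (Suc a))"
        using pos[of l] by (subst powr_realpow) auto
      also have "\<dots> = w l powr (real a / real (Suc a))"
        by (subst powr_powr) simp
      finally show "?r a powr (1 / real (Suc a)) \<le> w l powr (real a / real (Suc a))" .
    qed
    have "(\<lambda>a. w l powr (real a / real (Suc a))) \<longlonglongrightarrow> w l powr 1"
      using pos[of l] LIMSEQ_n_over_Suc_n by (intro tendsto_powr tendsto_const) auto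
    then show "(\<lambda>a. w l powr (real a / real (Suc a))) \<longlonglongrightarrow> w l" using pos[of l] by simp
  qed simp
  have "weights_of_power_sums (\<lambda>a. \<Sum>l. w l ^ Suc a) l = lim (\<lambda>a. ?r a powr (1 / real (Suc a)))"
    by (subst weights_of_power_sums.simps) (simp add: less del: power_Suc)
  then show ?case using limI[OF lim] by simp
qed

context gg_array
begin

text \<open>The factors of the monomials: the weights of replicas (\<open>Inl\<close>) and the power sums with positive
  exponent (\<open>Inr b\<close> stands for the exponent \<open>b + 1\<close>).\<close>

definition factor :: "nat + nat \<Rightarrow> 'w \<times> (nat \<Rightarrow> nat) \<Rightarrow> real" where
  "factor t x = (case t of Inl i \<Rightarrow> weight_of i x | Inr b \<Rightarrow> power_sum (Suc b) (fst x))"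

abbreviation monomial :: "(nat + nat) list \<Rightarrow> 'w \<times> (nat \<Rightarrow> nat) \<Rightarrow> real" where
  "monomial ts x \<equiv> prod_list (map (\<lambda>t. factor t x) ts)"

lemma measurable_factor [measurable]: "factor t \<in> borel_measurable \<Omega>"
  unfolding factor_def [abs_def] by (cases t) auto

lemma factor_in_01: "x \<in> space P \<Longrightarrow> factor t x \<in> {0..1}"
  using weight_of_in_01[of x] power_sum_in_01[of "fst x"]
  by (cases t) (auto simp: factor_def space_P)

lemma measurable_monomial [measurable]: "monomial ts \<in> borel_measurable \<Omega>"
  by (induction ts) auto

lemma abs_monomial_le_1: "x \<in> space P \<Longrightarrow> \<bar>monomial ts x\<bar> \<le> 1"
proof (induction ts)
  case (Cons t ts)
  have "\<bar>factor t x\<bar> \<le> 1" using factor_in_01[OF Cons.prems, of t] by simp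
  then show ?case using abs_mult_le_mult[of "factor t x" 1 "monomial ts x" 1] Cons by simp
qed simp

lemma deviation_update: "k \<le> N \<Longrightarrow> deviation k A (\<omega>, \<iota>(N := j)) = deviation k A (\<omega>, \<iota>)"
proof -
  assume kN: "k \<le> N"
  have c: "corner k (S (\<omega>, \<iota>(N := j))) = corner k (S (\<omega>, \<iota>))"
  proof
    fix p
    show "corner k (S (\<omega>, \<iota>(N := j))) p = corner k (S (\<omega>, \<iota>)) p"
      using kN by (cases "p \<in> {..<k} \<times> {..<k}") (auto simp: sampled_array_def)
  qed
  have "distinct_replicas k (\<omega>, \<iota>(N := j)) \<longleftrightarrow> distinct_replicas k (\<omega>, \<iota>)"
    using kN unfolding distinct_replicas_def by (intro ball_cong refl) auto
  then show ?thesis by (simp only: deviation_def c)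
qed

lemma equalities_update:
  assumes "E \<subseteq> {..<N} \<times> {..<N}"
  shows "equalities E (\<omega>, \<iota>(N := j)) = equalities E (\<omega>, \<iota>)"
  unfolding equalities_def
proof (intro ball_cong refl)
  fix p assume "p \<in> E"
  then have "fst p < N" "snd p < N" using assms by auto
  then show "(snd (\<omega>, \<iota>(N := j)) (fst p) = snd (\<omega>, \<iota>(N := j)) (snd p)) = (snd (\<omega>, \<iota>) (fst p) = snd (\<omega>, \<iota>) (snd p))"
    by simp
qed

lemma monomial_update:
  assumes "\<And>i. Inl i \<in> set ts \<Longrightarrow> i < N"
  shows "monomial ts (\<omega>, \<iota>(N := j)) = monomial ts (\<omega>, \<iota>)"
proof -
  have "factor t (\<omega>, \<iota>(N := j)) = factor t (\<omega>, \<iota>)" if "t \<in> set ts" for t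
    using assms that by (cases t) (auto simp: factor_def)
  then show ?thesis by (intro arg_cong[where f=prod_list] map_cong refl)
qed

lemma abs_deviation_bound:
  assumes A: "A \<in> sets (finite_array k)"
  obtains C where "\<And>x. x \<in> space P \<Longrightarrow> \<bar>deviation k A x\<bar> \<le> C"
  using replica_function_bounded[OF replica_function_deviation[OF order_refl A]] by blast

text \<open>Weights and power sums are conditional probabilities of coincidences with fresh replicas, so
  that moments reduce to coincidence events.\<close>

lemma integral_deviation_monomial:
  assumes k: "2 \<le> k" and A: "A \<in> sets (finite_array k)"
    and "k \<le> N" "E \<subseteq> {..<N} \<times> {..<N}" "\<And>i. Inl i \<in> set ts \<Longrightarrow> i < N"
  shows "(\<integral>x. deviation k A x * of_bool (equalities E x) * monomial ts x \<partial>P) = 0"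
  using assms(3-5)
\<comment> \<open>A power sum with exponent \<open>b + 1\<close> is traded for \<open>b\<close> weights of a fresh replica, and a weight for
    a coincidence; counting \<open>b + 2\<close> for the former and \<open>1\<close> for the latter makes both steps decreasing.\<close>
proof (induction "sum_list (map (case_sum (\<lambda>_. 1) (\<lambda>b. b + 2)) ts)" arbitrary: ts N E rule: less_induct)
  case less
  show ?case
  proof (cases ts)
    case Nil
    then show ?thesis using integral_deviation_equalities[OF k A less.prems(1,2)] by simp
  next
    case (Cons t ts')
    let ?Y = "\<lambda>x. deviation k A x * of_bool (equalities E x) * monomial ts' x"
    obtain C where C: "\<And>x. x \<in> space P \<Longrightarrow> \<bar>deviation k A x\<bar> \<le> C"
      using abs_deviation_bound[OF A] by blast
    have E_fin: "finite E" using less.prems(2) by (rule finite_subset) auto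
    have [measurable]: "Measurable.pred \<Omega> (equalities E)"
      unfolding equalities_def using E_fin by measurable
    have Y [measurable]: "?Y \<in> borel_measurable \<Omega>" using A by measurable
    have Y_bound: "\<bar>?Y x\<bar> \<le> C * 1 * 1" if "x \<in> space P" for x
      using C[OF that] abs_monomial_le_1[OF that] by (intro abs_mult_le_mult) auto
    have ts': "Inl i \<in> set ts' \<Longrightarrow> i < N" for i using less.prems(3) Cons by simp
    have Y_update: "?Y (\<omega>, \<iota>(N := j)) = ?Y (\<omega>, \<iota>)" for \<omega> \<iota> j
      by (simp only: deviation_update[OF less.prems(1)] equalities_update[OF less.prems(2)] monomial_update[OF ts'])
    show ?thesis
    proof (cases t)
      case (Inl i)
      then have "i < N" using less.prems(3) Cons by simp
      have "(\<integral>x. deviation k A x * of_bool (equalities E x) * monomial ts x \<partial>P) = (\<integral>x. ?Y x * weight_of i x \<partial>P)"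
        by (simp add: Cons Inl factor_def mult_ac)
      also have "\<dots> = (\<integral>x. ?Y x * of_bool (snd x N = snd x i) \<partial>P)"
        using \<open>i < N\<close> by (intro integral_P_eq_index[OF Y Y_bound Y_update, symmetric]) auto
      also have "\<dots> = (\<integral>x. deviation k A x * of_bool (equalities (insert (N, i) E) x) * monomial ts' x \<partial>P)"
        by (simp add: equalities_def of_bool_conj mult_ac)
      also have "\<dots> = 0"
      proof (rule less.hyps)
        show "k \<le> Suc N" using less.prems(1) by simp
        show "insert (N, i) E \<subseteq> {..<Suc N} \<times> {..<Suc N}"
          using less.prems(2) \<open>i < N\<close> by (auto simp: less_Suc_eq)
        show "i' < Suc N" if "Inl i' \<in> set ts'" for i' using ts'[OF that] by simp
      qed (simp add: Cons Inl)
      finally show ?thesis .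
    next
      case (Inr b)
      have "(\<integral>x. deviation k A x * of_bool (equalities E x) * monomial ts x \<partial>P)
          = (\<integral>x. ?Y x * power_sum (Suc b) (fst x) \<partial>P)"
        by (simp add: Cons Inr factor_def mult_ac)
      also have "\<dots> = (\<integral>x. ?Y x * weight_of N x ^ b \<partial>P)"
        by (rule integral_P_power_sum[OF Y Y_bound Y_update, symmetric])
      also have "\<dots> = (\<integral>x. deviation k A x * of_bool (equalities E x) * monomial (ts' @ replicate b (Inl N)) x \<partial>P)"
        by (simp add: factor_def mult_ac)
      also have "\<dots> = 0"
      proof (rule less.hyps)
        show "k \<le> Suc N" using less.prems(1) by simp
        show "E \<subseteq> {..<Suc N} \<times> {..<Suc N}" using less.prems(2) by (auto simp: less_Suc_eq)
        show "sum_list (map (case_sum (\<lambda>_. 1) (\<lambda>b. b + 2)) (ts' @ replicate b (Inl N)))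
            < sum_list (map (case_sum (\<lambda>_. 1) (\<lambda>b. b + 2)) ts)"
          by (simp add: Cons Inr sum_list_replicate)
        show "i < Suc N" if "Inl i \<in> set (ts' @ replicate b (Inl N))" for i
          using that ts'[of i] by (auto split: if_splits)
      qed
      finally show ?thesis .
    qed
  qed
qed

text \<open>The variables as one sequence: first the weights of the replicas \<open>0, \<dots>, k - 1\<close>, then the power
  sums.\<close>

definition coordinate :: "nat \<Rightarrow> nat \<Rightarrow> nat + nat" where
  "coordinate k i = (if i < k then Inl i else Inr (i - k))"

lemma integral_deviation_indicator:
  assumes k: "2 \<le> k" and A: "A \<in> sets (finite_array k)" and U: "U \<in> sets seq_borel"
  shows "(\<integral>x. deviation k A x * indicator U (\<lambda>i. factor (coordinate k i) x) \<partial>P) = 0"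
proof (rule moments_determine_signed_image[OF replica_function_integrable _ _ _ U])
  show "replica_function k (deviation k A)" by (rule replica_function_deviation[OF order_refl A])
  fix "is" :: "nat list"
  have "(\<integral>x. deviation k A x * of_bool (equalities {} x) * monomial (map (coordinate k) is) x \<partial>P) = 0"
    by (rule integral_deviation_monomial[OF k A order_refl]) (auto simp: coordinate_def split: if_splits)
  then show "(\<integral>x. deviation k A x * prod_list (map (\<lambda>i. factor (coordinate k i) x) is) \<partial>P) = 0"
    by (simp add: equalities_def comp_def)
qed (use factor_in_01 in \<open>auto\<close>)

text \<open>The array of \<open>k\<close> distinct replicas does not see the sequence of the weights together with the
  ranks of the weights of these replicas.\<close>

lemma integral_deviation_weights:
  assumes k: "2 \<le> k" and A: "A \<in> sets (finite_array k)" and C: "C \<in> sets seq_borel"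
  shows "(\<integral>x. deviation k A x * (indicator C (\<lambda>l. v l (fst x)) * of_bool (\<forall>i<k. weight_of i x = v (\<rho> i) (fst x))) \<partial>P) = 0"
proof -
  define rec where "rec y = weights_of_power_sums (\<lambda>a. y (k + a))" for y :: "nat \<Rightarrow> real"
  have shift: "(\<lambda>y a. y (k + a)) \<in> seq_borel \<rightarrow>\<^sub>M seq_borel"
    by (rule measurable_PiM_single') (auto simp: space_PiM)
  have rec_l [measurable]: "(\<lambda>y. rec y l) \<in> borel_measurable seq_borel" for l
    unfolding rec_def by (rule measurable_compose[OF shift measurable_weights_of_power_sums])
  have rec_meas [measurable]: "rec \<in> seq_borel \<rightarrow>\<^sub>M seq_borel"
    by (rule measurable_PiM_single'[where f="\<lambda>l y. rec y l", simplified]) (auto simp: space_PiM)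
  define U where "U = {y \<in> space seq_borel. rec y \<in> C \<and> (\<forall>i\<in>{..<k}. y i = rec y (\<rho> i))}"
  have "{y \<in> space seq_borel. y i = rec y (\<rho> i)} \<in> sets seq_borel" for i
    by (rule borel_measurable_eq[OF measurable_component_singleton rec_l]) simp
  then have [measurable]: "Measurable.pred seq_borel (\<lambda>y. y i = rec y (\<rho> i))" for i
    by (simp add: pred_def)
  have U: "U \<in> sets seq_borel" unfolding U_def using C by measurable
  have "indicator U (\<lambda>i. factor (coordinate k i) x)
      = indicator C (\<lambda>l. v l (fst x)) * (of_bool (\<forall>i<k. weight_of i x = v (\<rho> i) (fst x)) :: real)"
    if x: "x \<in> space P" for x
  proof -
    have \<omega>: "fst x \<in> space M" using x by (auto simp: space_P)
    have "rec (\<lambda>i. factor (coordinate k i) x) = (\<lambda>l. v l (fst x))"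
      using weights_of_power_sums[OF v_pos[OF \<omega>] v_decseq[OF \<omega>] v_sums_1[OF \<omega>]]
      by (simp add: rec_def coordinate_def factor_def power_sum_def fun_eq_iff)
    moreover have "factor (coordinate k i) x = weight_of i x" if "i < k" for i
      using that by (simp add: coordinate_def factor_def)
    ultimately show ?thesis by (auto simp: U_def space_PiM indicator_def)
  qed
  then have "(\<integral>x. deviation k A x * (indicator C (\<lambda>l. v l (fst x)) * of_bool (\<forall>i<k. weight_of i x = v (\<rho> i) (fst x))) \<partial>P)
    = (\<integral>x. deviation k A x * indicator U (\<lambda>i. factor (coordinate k i) x) \<partial>P)"
    by (intro Bochner_Integration.integral_cong) auto
  then show ?thesis using integral_deviation_indicator[OF k A U] by simp
qed

end

section \<open>The weights are almost surely distinct\<close>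

lemma signed_image_zero_bounded:
  fixes Z :: "'a \<Rightarrow> real" and g :: "'b \<Rightarrow> real"
  assumes Z: "integrable M Z" and X: "X \<in> measurable M N"
    and zero: "\<And>A. A \<in> sets N \<Longrightarrow> (\<integral>x. Z x * indicator A (X x) \<partial>M) = 0"
    and g: "g \<in> borel_measurable N" and bound: "\<And>y. y \<in> space N \<Longrightarrow> \<bar>g y\<bar> \<le> C"
  shows "(\<integral>x. Z x * g (X x) \<partial>M) = 0"
proof -
  note [measurable] = X g borel_measurable_integrable[OF Z]
  have eq: "distr (density M (\<lambda>x. ennreal (Z x))) N X = distr (density M (\<lambda>x. ennreal (- Z x))) N X"
    using zero by (intro measure_eqI) (simp_all add: emeasure_image_signed_eq_iff[OF Z X])
  have part: "(\<integral>y. g y \<partial>distr (density M (\<lambda>x. ennreal (W x))) N X) = (\<integral>x. max 0 (W x) * g (X x) \<partial>M)"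
    if [measurable]: "W \<in> borel_measurable M" for W :: "'a \<Rightarrow> real"
  proof -
    have "density M (\<lambda>x. ennreal (W x)) = density M (\<lambda>x. ennreal (max 0 (W x)))"
      by (intro density_cong AE_I2) (auto simp: max_def ennreal_neg)
    then have "(\<integral>y. g y \<partial>distr (density M (\<lambda>x. ennreal (W x))) N X)
        = (\<integral>x. g (X x) \<partial>density M (\<lambda>x. ennreal (max 0 (W x))))"
      by (subst integral_distr) auto
    also have "\<dots> = (\<integral>x. max 0 (W x) * g (X x) \<partial>M)"
      by (subst integral_density) auto
    finally show ?thesis .
  qed
  have g_X: "(\<lambda>x. g (X x)) \<in> borel_measurable M" by measurable
  have bound_X: "\<bar>g (X x)\<bar> \<le> C" if "x \<in> space M" for x
    using bound measurable_space[OF X that] by simp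
  have i: "integrable M (\<lambda>x. max 0 (Z x) * g (X x))" "integrable M (\<lambda>x. max 0 (- Z x) * g (X x))"
    using Z by (auto intro!: integrable_mult_bounded[OF _ g_X bound_X])
  have "(\<integral>x. Z x * g (X x) \<partial>M) = (\<integral>x. max 0 (Z x) * g (X x) - max 0 (- Z x) * g (X x) \<partial>M)"
    by (intro Bochner_Integration.integral_cong) (auto simp: max_def)
  also have "\<dots> = 0"
    using i part[of Z] part[of "\<lambda>x. - Z x"] eq by simp
  finally show ?thesis .
qed

context gg_array
begin

lemma collision_nonneg: "0 \<le> collision"
  unfolding collision_def by (intro Bochner_Integration.integral_nonneg) auto

lemma collision_le_1: "collision \<le> 1"
proof -
  have m: "(\<lambda>x. of_bool (snd x 0 = snd x 1) :: real) \<in> borel_measurable P" by measurable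
  have "integrable P (\<lambda>x. of_bool (snd x 0 = snd x 1) :: real)"
    by (rule P.integrable_const_bound[where B=1, OF _ m]) auto
  then have "collision \<le> (\<integral>x. 1 \<partial>P)" unfolding collision_def
    by (intro integral_mono) auto
  then show ?thesis using P.prob_space by simp
qed

text \<open>The replicas \<open>0\<close> and \<open>1\<close> are distinct, and each replica \<open>i\<close> with \<open>2 \<le> i < n\<close> coincides with the
  replica \<open>c i\<close>; the values of \<open>c\<close> will be \<open>0\<close> and \<open>1\<close>.\<close>

definition pair_event :: "(nat \<Rightarrow> nat) \<Rightarrow> nat \<Rightarrow> 'w \<times> (nat \<Rightarrow> nat) \<Rightarrow> bool" where
  "pair_event c n x \<longleftrightarrow> snd x 0 \<noteq> snd x 1 \<and> (\<forall>i\<in>{2..<n}. snd x i = snd x (c i))"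

lemma measurable_pair_event [measurable]: "Measurable.pred \<Omega> (pair_event c n)"
  unfolding pair_event_def by measurable

text \<open>The transition probabilities of the urn.\<close>

lemma pair_event_recursion:
  assumes n: "2 \<le> n" and c: "\<And>i. c i < 2" and j: "j < 2"
  shows "real n * (\<integral>x. of_bool (pair_event c n x) * of_bool (snd x j = snd x n) \<partial>P)
    = (collision + real (card {i\<in>{2..<n}. c i = j})) * (\<integral>x. of_bool (pair_event c n x) \<partial>P)"
proof -
  have c_less: "c i < n" for i using c[of i] n by linarith
  have h: "replica_function n (\<lambda>x. of_bool (pair_event c n x))"
    unfolding pair_event_def
    using n c_less by (intro replica_function_conj replica_function_not replica_function_Ball replica_function_eq_index) auto
  have single: "(\<integral>x. of_bool (pair_event c n x) * of_bool (snd x j = snd x l) \<partial>P)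
      = (if l \<in> {i\<in>{2..<n}. c i = j} then \<integral>x. of_bool (pair_event c n x) \<partial>P else (0::real))"
    if l: "l \<in> {..<n} - {j}" for l
  proof (cases "l \<in> {i\<in>{2..<n}. c i = j}")
    case True
    then have "pair_event c n x \<Longrightarrow> snd x j = snd x l" for x by (auto simp: pair_event_def)
    then have "of_bool (pair_event c n x) * of_bool (snd x j = snd x l) = (of_bool (pair_event c n x) :: real)" for x
      by (cases "pair_event c n x") auto
    then show ?thesis using True by (simp only: if_True)
  next
    case False
    have "pair_event c n x \<Longrightarrow> snd x j \<noteq> snd x l" for x
    proof (cases "l < 2")
      case True
      then have "j = 0 \<and> l = 1 \<or> j = 1 \<and> l = 0" using l j by auto
      then show "pair_event c n x \<Longrightarrow> snd x j \<noteq> snd x l" by (auto simp: pair_event_def)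
    next
      case ge: False
      then have "c l \<noteq> j" using False l by auto
      moreover have "c l = 0 \<or> c l = 1" "j = 0 \<or> j = 1" using c[of l] j by auto
      moreover assume e: "pair_event c n x"
      moreover have "snd x l = snd x (c l)" using e ge l by (auto simp: pair_event_def)
      ultimately show "snd x j \<noteq> snd x l" by (auto simp: pair_event_def)
    qed
    then have "of_bool (pair_event c n x) * of_bool (snd x j = snd x l) = (0 :: real)" for x
      by (cases "pair_event c n x") auto
    then show ?thesis using False by (simp only: if_False Bochner_Integration.integral_zero)
  qed
  have "{i\<in>{2..<n}. c i = j} \<subseteq> {..<n} - {j}" using j by auto
  then have inter: "({..<n} - {j}) \<inter> {i\<in>{2..<n}. c i = j} = {i\<in>{2..<n}. c i = j}" by blast
  have "(\<Sum>l\<in>{..<n} - {j}. \<integral>x. of_bool (pair_event c n x) * of_bool (snd x j = snd x l) \<partial>P)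
      = (\<Sum>l\<in>{..<n} - {j}. if l \<in> {i\<in>{2..<n}. c i = j} then \<integral>x. of_bool (pair_event c n x) \<partial>P else (0::real))"
    by (rule sum.cong[OF refl single])
  also have "\<dots> = (\<Sum>l\<in>({..<n} - {j}) \<inter> {i\<in>{2..<n}. c i = j}. \<integral>x. of_bool (pair_event c n x) \<partial>P)"
    by (rule sum.inter_restrict[symmetric]) simp
  also have "\<dots> = real (card {i\<in>{2..<n}. c i = j}) * (\<integral>x. of_bool (pair_event c n x) \<partial>P)"
    unfolding inter by simp
  finally show ?thesis
    using GG_replica[OF n _ h, of j] n j by (simp add: field_simps)
qed

text \<open>The mixed moments of the weights of two distinct replicas.\<close>

definition pair_moment :: "nat \<Rightarrow> nat \<Rightarrow> real" where
  "pair_moment a b = (\<integral>x. of_bool (snd x 0 \<noteq> snd x 1) * (weight_of 0 x ^ a * weight_of 1 x ^ b) \<partial>P)"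

lemma abs_weights_le_1: "x \<in> space P \<Longrightarrow> \<bar>weight_of i x ^ a * weight_of j x ^ b\<bar> \<le> 1"
  using weight_of_in_01[of x i] weight_of_in_01[of x j]
  by (simp add: abs_mult power_abs mult_le_one power_le_one)

lemma pair_event_moment:
  assumes n: "2 \<le> n" and c: "\<And>i. c i < 2"
  shows "(\<integral>x. of_bool (pair_event c n x) * (weight_of 0 x ^ a * weight_of 1 x ^ b) \<partial>P)
    = pair_moment (a + card {i\<in>{2..<n}. c i = 0}) (b + card {i\<in>{2..<n}. c i = 1})"
  using n
proof (induction n arbitrary: a b rule: dec_induct)
  case base
  then show ?case by (simp add: pair_event_def pair_moment_def)
next
  case (step n)
  have c_less: "c i < n" for i using c[of i] step.hyps by linarith
  let ?Y = "\<lambda>x. of_bool (pair_event c n x) * (weight_of 0 x ^ a * weight_of 1 x ^ b)"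
  have "(\<integral>x. of_bool (pair_event c (Suc n) x) * (weight_of 0 x ^ a * weight_of 1 x ^ b) \<partial>P)
      = (\<integral>x. ?Y x * of_bool (snd x n = snd x (c n)) \<partial>P)"
  proof (intro Bochner_Integration.integral_cong refl)
    fix x
    have "pair_event c (Suc n) x \<longleftrightarrow> pair_event c n x \<and> snd x n = snd x (c n)"
      using step.hyps by (auto simp: pair_event_def less_Suc_eq)
    then show "of_bool (pair_event c (Suc n) x) * (weight_of 0 x ^ a * weight_of 1 x ^ b) = ?Y x * of_bool (snd x n = snd x (c n))"
      by simp
  qed
  also have "\<dots> = (\<integral>x. ?Y x * weight_of (c n) x \<partial>P)"
  proof (rule integral_P_eq_index[where C=1])
    show "\<bar>?Y x\<bar> \<le> 1" if "x \<in> space P" for x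
      using abs_weights_le_1[OF that, of 0 a 1 b] by (cases "pair_event c n x") auto
    show "?Y (\<omega>, \<iota>(n := j)) = ?Y (\<omega>, \<iota>)" for \<omega> \<iota> j
    proof -
      have "pair_event c n (\<omega>, \<iota>(n := j)) = pair_event c n (\<omega>, \<iota>)"
        unfolding pair_event_def using step.hyps c_less by (intro conj_cong ball_cong refl) auto
      then show ?thesis using step.hyps by simp
    qed
    show "c n \<noteq> n" using c_less[of n] by simp
  qed measurable
  also have "\<dots> = pair_moment (a + card {i\<in>{2..<Suc n}. c i = 0}) (b + card {i\<in>{2..<Suc n}. c i = 1})"
  proof (cases "c n = 0")
    case True
    have "{i\<in>{2..<Suc n}. c i = 0} = insert n {i\<in>{2..<n}. c i = 0}"
      "{i\<in>{2..<Suc n}. c i = 1} = {i\<in>{2..<n}. c i = 1}"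
      using step.hyps True by (auto simp: less_Suc_eq)
    then show ?thesis using step.IH[of "Suc a" b] True by (simp add: mult_ac)
  next
    case False
    then have False': "c n = 1" using c[of n] by auto
    have "{i\<in>{2..<Suc n}. c i = 1} = insert n {i\<in>{2..<n}. c i = 1}"
      "{i\<in>{2..<Suc n}. c i = 0} = {i\<in>{2..<n}. c i = 0}"
      using step.hyps False' by (auto simp: less_Suc_eq)
    then show ?thesis using step.IH[of a "Suc b"] False' by (simp add: mult_ac)
  qed
  finally show ?case .
qed

lemma pair_moment_Suc:
  shows "real (a + b + 2) * pair_moment (Suc a) b = (collision + real a) * pair_moment a b"
    and "real (a + b + 2) * pair_moment a (Suc b) = (collision + real b) * pair_moment a b"
proof -
  define c where "c i = (if i < 2 + a then 0 else 1 :: nat)" for i :: nat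
  define n where "n = a + b + 2"
  have n: "2 \<le> n" by (simp add: n_def)
  have c: "c i < 2" for i by (simp add: c_def)
  have "{i\<in>{2..<n}. c i = 0} = {2..<2 + a}" "{i\<in>{2..<n}. c i = 1} = {2 + a..<n}"
    by (auto simp: c_def n_def)
  then have cards: "card {i\<in>{2..<n}. c i = 0} = a" "card {i\<in>{2..<n}. c i = 1} = b"
    by (simp_all add: n_def)
  have mom: "(\<integral>x. of_bool (pair_event c n x) * (weight_of 0 x ^ a' * weight_of 1 x ^ b') \<partial>P) = pair_moment (a' + a) (b' + b)" for a' b'
    using pair_event_moment[where c=c and n=n and a=a' and b=b', OF n c] unfolding cards .
  have step: "(\<integral>x. of_bool (pair_event c n x) * of_bool (snd x j = snd x n) \<partial>P) = (\<integral>x. of_bool (pair_event c n x) * weight_of j x \<partial>P)"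
    if j: "j < 2" for j
  proof -
    have "(\<integral>x. of_bool (pair_event c n x) * of_bool (snd x n = snd x j) \<partial>P) = (\<integral>x. of_bool (pair_event c n x) * weight_of j x \<partial>P)"
    proof (rule integral_P_eq_index[where C=1])
      have c_less: "c i < n" for i using c[of i] n by linarith
      show "of_bool (pair_event c n (\<omega>, \<iota>(n := j))) = (of_bool (pair_event c n (\<omega>, \<iota>)) :: real)" for \<omega> \<iota> j
      proof -
        have "pair_event c n (\<omega>, \<iota>(n := j)) = pair_event c n (\<omega>, \<iota>)"
          unfolding pair_event_def using n c_less by (intro conj_cong ball_cong refl) auto
        then show ?thesis by simp
      qed
      show "j \<noteq> n" using j n by simp
    qed auto
    then show ?thesis by (simp add: eq_commute[of "snd _ n"])
  qed
  have 0: "(\<integral>x. of_bool (pair_event c n x) \<partial>P) = pair_moment a b" using mom[of 0 0] by simp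
  show "real (a + b + 2) * pair_moment (Suc a) b = (collision + real a) * pair_moment a b"
    using pair_event_recursion[where c=c and n=n, OF n c, of 0] step[of 0] mom[of 1 0] cards 0 by (simp add: n_def)
  show "real (a + b + 2) * pair_moment a (Suc b) = (collision + real b) * pair_moment a b"
    using pair_event_recursion[where c=c and n=n, OF n c, of 1] step[of 1] mom[of 0 1] cards 0 by (simp add: n_def)
qed

lemma pair_moment_exchange:
  "(collision + real b) * pair_moment (Suc a) b = (collision + real a) * pair_moment a (Suc b)"
proof -
  have "real (a + b + 2) * ((collision + real b) * pair_moment (Suc a) b)
      = real (a + b + 2) * ((collision + real a) * pair_moment a (Suc b))"
    using pair_moment_Suc[of a b] by (metis mult.left_commute)
  then show ?thesis by (simp only: mult_cancel_left) auto
qed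

abbreviation pair_weight :: "'w \<times> (nat \<Rightarrow> nat) \<Rightarrow> real" where
  "pair_weight x \<equiv> weight_of 0 x + weight_of 1 x"

abbreviation pair_integrand :: "nat \<Rightarrow> nat \<Rightarrow> 'w \<times> (nat \<Rightarrow> nat) \<Rightarrow> real" where
  "pair_integrand a b x \<equiv> of_bool (snd x 0 \<noteq> snd x 1) * (weight_of 0 x ^ a * weight_of 1 x ^ b)"

lemma integrable_pair_integrand: "integrable P (pair_integrand a b)"
proof (rule P.integrable_const_bound[where B=1])
  show "AE x in P. norm (pair_integrand a b x) \<le> 1"
  proof (rule AE_I2)
    fix x assume "x \<in> space P"
    then show "norm (pair_integrand a b x) \<le> 1"
      using abs_weights_le_1[of x 0 a 1 b] by (cases "snd x 0 = snd x 1") auto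
  qed
qed measurable

lemma integrable_pair_integrand_mult: 
  assumes "h \<in> borel_measurable \<Omega>" "\<And>x. x \<in> space P \<Longrightarrow> \<bar>h x\<bar> \<le> C"
  shows "integrable P (\<lambda>x. pair_integrand a b x * h x)"
  by (rule integrable_mult_bounded[OF integrable_pair_integrand _ assms(2)]) (use assms(1) in measurable)

lemma pair_weight_bound: "x \<in> space P \<Longrightarrow> \<bar>pair_weight x ^ j\<bar> \<le> 2 ^ j"
  using weight_of_in_01[of x 0] weight_of_in_01[of x 1] by (simp add: power_abs power_mono)

text \<open>The exchange rule is compatible with the multiplication by the total weight of the pair,
  because the two rules for the exponents \<open>(a + 1, b)\<close> and \<open>(a, b + 1)\<close> add up to it.\<close>

lemma pair_exchange_power:
  "(collision + real b) * (\<integral>x. pair_integrand (Suc a) b x * pair_weight x ^ j \<partial>P)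
    = (collision + real a) * (\<integral>x. pair_integrand a (Suc b) x * pair_weight x ^ j \<partial>P)"
proof (induction j arbitrary: a b)
  case 0
  then show ?case using pair_moment_exchange[of b a] by (simp add: pair_moment_def)
next
  case (Suc j)
  define I where "I a b = (\<integral>x. pair_integrand a b x * pair_weight x ^ j \<partial>P)" for a b
  have I: "(\<integral>x. pair_integrand a b x * pair_weight x ^ Suc j \<partial>P) = I (Suc a) b + I a (Suc b)" for a b
  proof -
    have "(\<integral>x. pair_integrand a b x * pair_weight x ^ Suc j \<partial>P)
      = (\<integral>x. pair_integrand (Suc a) b x * pair_weight x ^ j + pair_integrand a (Suc b) x * pair_weight x ^ j \<partial>P)"
      by (intro Bochner_Integration.integral_cong) (auto simp: algebra_simps)
    also have "\<dots> = I (Suc a) b + I a (Suc b)"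
      unfolding I_def using pair_weight_bound
      by (intro Bochner_Integration.integral_add integrable_pair_integrand_mult[where C="2 ^ j"]) auto
    finally show ?thesis .
  qed
  have "(collision + real b) * I (Suc (Suc a)) b = (collision + real (Suc a)) * I (Suc a) (Suc b)"
    "(collision + real (Suc b)) * I (Suc a) (Suc b) = (collision + real a) * I a (Suc (Suc b))"
    unfolding I_def by (rule Suc.IH)+
  then show ?case unfolding I by (simp add: algebra_simps)
qed

lemma pair_exchange_bounded:
  assumes h [measurable]: "h \<in> borel_measurable borel" and bound: "\<And>t. \<bar>h t\<bar> \<le> C"
  shows "(collision + real b) * (\<integral>x. pair_integrand (Suc a) b x * h (pair_weight x) \<partial>P)
    = (collision + real a) * (\<integral>x. pair_integrand a (Suc b) x * h (pair_weight x) \<partial>P)"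
proof -
  let ?Z = "\<lambda>x. (collision + real b) * pair_integrand (Suc a) b x - (collision + real a) * pair_integrand a (Suc b) x"
  \<comment> \<open>The division by \<open>2\<close> keeps the variable in \<open>[0, 1]\<close> also where the two replicas coincide.\<close>
  let ?X = "\<lambda>x. pair_weight x / 2"
  have Z: "integrable P ?Z"
    by (intro Bochner_Integration.integrable_diff integrable_mult_right integrable_pair_integrand)
  have X: "?X \<in> borel_measurable P" by measurable
  have split: "(\<integral>x. ?Z x * f x \<partial>P) = (collision + real b) * (\<integral>x. pair_integrand (Suc a) b x * f x \<partial>P)
      - (collision + real a) * (\<integral>x. pair_integrand a (Suc b) x * f x \<partial>P)"
    if "f \<in> borel_measurable \<Omega>" "\<And>x. x \<in> space P \<Longrightarrow> \<bar>f x\<bar> \<le> B" for f B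
  proof -
    have i: "integrable P (\<lambda>x. pair_integrand a b x * f x)" for a b
      by (rule integrable_pair_integrand_mult[OF that])
    have "(\<integral>x. ?Z x * f x \<partial>P) = (\<integral>x. (collision + real b) * (pair_integrand (Suc a) b x * f x)
        - (collision + real a) * (pair_integrand a (Suc b) x * f x) \<partial>P)"
      by (intro Bochner_Integration.integral_cong) (auto simp: algebra_simps)
    also have "\<dots> = (collision + real b) * (\<integral>x. pair_integrand (Suc a) b x * f x \<partial>P)
      - (collision + real a) * (\<integral>x. pair_integrand a (Suc b) x * f x \<partial>P)"
      by (simp only: Bochner_Integration.integral_diff[OF integrable_mult_right[OF i] integrable_mult_right[OF i]]
          integral_mult_right_zero)
    finally show ?thesis .
  qed
  have "(\<integral>x. ?Z x * indicator A (?X x) \<partial>P) = 0" if "A \<in> sets borel" for A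
  proof (rule moments_determine_signed_image_real[OF Z X _ _ that])
    show "?X x \<in> {0..1}" if "x \<in> space P" for x
      using weight_of_in_01[OF that, of 0] weight_of_in_01[OF that, of 1] by simp
    fix j
    have "(\<integral>x. ?Z x * ?X x ^ j \<partial>P) = (\<integral>x. (1 / 2 ^ j) * (?Z x * pair_weight x ^ j) \<partial>P)"
      by (intro Bochner_Integration.integral_cong) (auto simp: power_divide)
    also have "\<dots> = (1 / 2 ^ j) * (\<integral>x. ?Z x * pair_weight x ^ j \<partial>P)"
      by (rule integral_mult_right_zero)
    also have "(\<integral>x. ?Z x * pair_weight x ^ j \<partial>P) = 0"
      using pair_exchange_power[of b a j] by (subst split[OF _ pair_weight_bound]) simp_all
    finally show "(\<integral>x. ?Z x * ?X x ^ j \<partial>P) = 0" by simp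
  qed
  then have "(\<integral>x. ?Z x * h (2 * ?X x) \<partial>P) = 0"
    using bound by (intro signed_image_zero_bounded[OF Z X, where g="\<lambda>t. h (2 * t)" and C=C]) auto
  moreover have "2 * ?X x = pair_weight x" for x by simp
  ultimately have "(\<integral>x. ?Z x * h (pair_weight x) \<partial>P) = 0" by (simp only:)
  moreover have "(\<lambda>x. h (pair_weight x)) \<in> borel_measurable \<Omega>" by measurable
  ultimately show ?thesis using split[of "\<lambda>x. h (pair_weight x)", OF _ bound] by simp
qed

text \<open>The pair of distinct atoms, seen through its share of the total weight of the pair, on the event
  that this total weight is at least \<open>\<epsilon>\<close>.\<close>

abbreviation share_integrand :: "real \<Rightarrow> nat \<Rightarrow> nat \<Rightarrow> 'w \<times> (nat \<Rightarrow> nat) \<Rightarrow> real" where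
  "share_integrand \<epsilon> a b x \<equiv> of_bool (snd x 0 \<noteq> snd x 1 \<and> \<epsilon> \<le> pair_weight x) *
    ((weight_of 0 x / pair_weight x) ^ a * (weight_of 1 x / pair_weight x) ^ b)"

definition share_moment :: "real \<Rightarrow> nat \<Rightarrow> nat \<Rightarrow> real" where
  "share_moment \<epsilon> a b = (\<integral>x. share_integrand \<epsilon> a b x \<partial>P)"

lemma weight_of_pos: "x \<in> space P \<Longrightarrow> 0 < weight_of i x"
  using v_pos by (auto simp: space_P)

lemma share_in_01:
  assumes "x \<in> space P" "i = 0 \<or> i = 1"
  shows "0 \<le> weight_of i x / pair_weight x" "weight_of i x / pair_weight x \<le> 1"
  using weight_of_pos[OF assms(1), of 0] weight_of_pos[OF assms(1), of 1] assms(2) by auto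

lemma abs_share_integrand_le_1:
  assumes "x \<in> space P"
  shows "\<bar>of_bool R * ((weight_of 0 x / pair_weight x) ^ a * (weight_of 1 x / pair_weight x) ^ b)\<bar> \<le> 1"
proof -
  have "\<bar>(weight_of 0 x / pair_weight x) ^ a\<bar> \<le> 1" "\<bar>(weight_of 1 x / pair_weight x) ^ b\<bar> \<le> 1"
    using share_in_01[OF assms, of 0] share_in_01[OF assms, of 1]
    by (subst abs_of_nonneg; intro zero_le_power power_le_one; simp)+
  then have "\<bar>(weight_of 0 x / pair_weight x) ^ a * (weight_of 1 x / pair_weight x) ^ b\<bar> \<le> 1 * 1"
    by (rule abs_mult_le_mult)
  then show ?thesis by (cases R) auto
qed

lemma integrable_share: "integrable P (\<lambda>x. share_integrand \<epsilon> a b x)"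
  using abs_share_integrand_le_1 by (intro P.integrable_const_bound[where B=1]) (auto simp del: power_divide, measurable)

lemma share_moment_split: "share_moment \<epsilon> a b = share_moment \<epsilon> (Suc a) b + share_moment \<epsilon> a (Suc b)"
proof -
  have "share_moment \<epsilon> (Suc a) b + share_moment \<epsilon> a (Suc b) =
    (\<integral>x. share_integrand \<epsilon> (Suc a) b x +
      share_integrand \<epsilon> a (Suc b) x \<partial>P)"
    unfolding share_moment_def by (rule Bochner_Integration.integral_add[symmetric]) (rule integrable_share)+
  also have "\<dots> = share_moment \<epsilon> a b"
    unfolding share_moment_def
  proof (rule Bochner_Integration.integral_cong[OF refl])
    fix x assume x: "x \<in> space P"
    define s where "s = weight_of 0 x / pair_weight x"
    define t where "t = weight_of 1 x / pair_weight x"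
    have "s + t = 1"
      using weight_of_pos[OF x, of 0] weight_of_pos[OF x, of 1]
      by (simp add: s_def t_def add_divide_distrib[symmetric])
    then have "s ^ Suc a * t ^ b + s ^ a * t ^ Suc b = s ^ a * t ^ b"
      by (metis distrib_right mult.assoc mult.left_commute mult_1 power_Suc)
    then show "share_integrand \<epsilon> (Suc a) b x +
      share_integrand \<epsilon> a (Suc b) x =
      share_integrand \<epsilon> a b x"
      unfolding s_def[symmetric] t_def[symmetric] distrib_left[symmetric] by simp
  qed
  finally show ?thesis ..
qed

lemma share_moment_exchange:
  assumes \<epsilon>: "0 < \<epsilon>"
  shows "(collision + real b) * share_moment \<epsilon> (Suc a) b = (collision + real a) * share_moment \<epsilon> a (Suc b)"
proof -
  \<comment> \<open>The moments have total degree \<open>a + b + 1\<close>; dividing by this power of the total weight turns the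
    weights into shares.\<close>
  define h where "h t = indicator {\<epsilon>..} t / t ^ Suc (a + b)" for t :: real
  have [measurable]: "h \<in> borel_measurable borel" unfolding h_def by measurable
  have bound: "\<bar>h t\<bar> \<le> 1 / \<epsilon> ^ Suc (a + b)" for t
  proof (cases "\<epsilon> \<le> t")
    case True
    then have "\<epsilon> ^ Suc (a + b) \<le> t ^ Suc (a + b)" using \<epsilon> by (intro power_mono) auto
    then show ?thesis using True \<epsilon> by (simp add: h_def frac_le del: power_Suc)
  next
    case False
    then show ?thesis using \<epsilon> by (simp add: h_def)
  qed
  have conv: "(\<integral>x. pair_integrand a' b' x * h (pair_weight x) \<partial>P) = share_moment \<epsilon> a' b'"
    if "a' + b' = Suc (a + b)" for a' b'
    unfolding share_moment_def
  proof (rule Bochner_Integration.integral_cong[OF refl])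
    fix x assume x: "x \<in> space P"
    show "pair_integrand a' b' x * h (pair_weight x) = share_integrand \<epsilon> a' b' x"
      by (cases "\<epsilon> \<le> pair_weight x") (simp_all add: h_def power_divide power_add[symmetric] that)
  qed
  have conv': "(\<integral>x. pair_integrand (Suc a) b x * h (pair_weight x) \<partial>P) = share_moment \<epsilon> (Suc a) b"
    "(\<integral>x. pair_integrand a (Suc b) x * h (pair_weight x) \<partial>P) = share_moment \<epsilon> a (Suc b)"
    by (rule conv, simp)+
  show ?thesis
    by (rule pair_exchange_bounded[of h "1 / \<epsilon> ^ Suc (a + b)" b a, unfolded conv']) (simp_all only: bound, measurable)
qed

lemma share_moment_tendsto_0:
  assumes \<epsilon>: "0 < \<epsilon>"
  shows "(\<lambda>N. 4 ^ N * share_moment \<epsilon> N N) \<longlonglongrightarrow> 0"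
proof -
  define t where "t N = 4 ^ N * share_moment \<epsilon> N N" for N
  have nonneg: "0 \<le> share_moment \<epsilon> a b" for a b
    unfolding share_moment_def using share_in_01
    by (intro Bochner_Integration.integral_nonneg mult_nonneg_nonneg zero_le_power) auto
  \<comment> \<open>The ratio \<open>t N / t (N + 1)\<close> tends to \<open>1\<close> so slowly that the product of the ratios diverges.\<close>
  have ratio: "t N * (2 * (collision + real N)) = t (Suc N) * (2 * (collision + real N) + 1)" if N: "1 \<le> N" for N
  proof -
    let ?p = "collision + real N"
    have pos: "0 < ?p" using collision_nonneg N by simp
    have e1: "share_moment \<epsilon> (Suc N) N = share_moment \<epsilon> N (Suc N)"
      using share_moment_exchange[OF \<epsilon>, of N N] pos by simp
    have e2: "?p * share_moment \<epsilon> (Suc (Suc N)) N = (?p + 1) * share_moment \<epsilon> (Suc N) (Suc N)"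
      using share_moment_exchange[OF \<epsilon>, of N "Suc N"] by (simp add: algebra_simps)
    have "?p * share_moment \<epsilon> N N = 2 * (?p * share_moment \<epsilon> (Suc N) N)"
      using share_moment_split[of \<epsilon> N N] e1 by (simp add: algebra_simps)
    also have "\<dots> = 2 * ((2 * ?p + 1) * share_moment \<epsilon> (Suc N) (Suc N))"
      using share_moment_split[of \<epsilon> "Suc N" N] e2 by (simp add: algebra_simps)
    finally have "?p * share_moment \<epsilon> N N = 2 * ((2 * ?p + 1) * share_moment \<epsilon> (Suc N) (Suc N))" .
    then have "4 ^ N * 2 * (?p * share_moment \<epsilon> N N) = 4 ^ N * 2 * (2 * ((2 * ?p + 1) * share_moment \<epsilon> (Suc N) (Suc N)))"
      by simp
    then show ?thesis by (simp add: t_def algebra_simps)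
  qed
  have t0: "0 \<le> t N" for N using nonneg by (simp add: t_def)
  \<comment> \<open>A quantitative form of the divergence: \<open>(N + 1) * (t N)\<^sup>2\<close> is non-increasing.\<close>
  have dec: "real (Suc (Suc N)) * (t (Suc N))\<^sup>2 \<le> real (Suc N) * (t N)\<^sup>2" if N: "1 \<le> N" for N
  proof -
    define m where "m = real (Suc N)"
    let ?p = "collision + real N" and ?m = m
    have pos: "0 < ?p" "?p \<le> ?m" "0 < ?m" using collision_nonneg collision_le_1 N by (simp_all add: m_def)
    have "t (Suc N) * (2 * ?m + 1) \<le> t N * (2 * ?m)"
    proof -
      have "t N = t (Suc N) * (2 * ?p + 1) / (2 * ?p)" using ratio[OF N] pos by (simp add: field_simps)
      also have "(2 * ?p + 1) / (2 * ?p) \<ge> (2 * ?m + 1) / (2 * ?m)"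
        using pos by (simp add: field_simps)
      then have "t (Suc N) * ((2 * ?m + 1) / (2 * ?m)) \<le> t (Suc N) * ((2 * ?p + 1) / (2 * ?p))"
        using t0 by (intro mult_left_mono)
      ultimately have "t (Suc N) * ((2 * ?m + 1) / (2 * ?m)) \<le> t N" by simp
      then show ?thesis using pos by (simp add: field_simps)
    qed
    then have "(t (Suc N) * (2 * ?m + 1))\<^sup>2 \<le> (t N * (2 * ?m))\<^sup>2"
      using t0 pos by (intro power_mono mult_nonneg_nonneg) auto
    then have "(2 * ?m + 1)\<^sup>2 * (t (Suc N))\<^sup>2 \<le> (2 * ?m)\<^sup>2 * (t N)\<^sup>2"
      by (simp add: power_mult_distrib mult.commute)
    moreover have "4 * ?m * (?m + 1) * (t (Suc N))\<^sup>2 \<le> (2 * ?m + 1)\<^sup>2 * (t (Suc N))\<^sup>2"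
      by (intro mult_right_mono) (auto simp: power2_eq_square algebra_simps)
    ultimately have "4 * ?m * (?m + 1) * (t (Suc N))\<^sup>2 \<le> (2 * ?m)\<^sup>2 * (t N)\<^sup>2"
      by linarith
    then have "(4 * ?m) * ((?m + 1) * (t (Suc N))\<^sup>2) \<le> (4 * ?m) * (?m * (t N)\<^sup>2)"
      by (simp add: power_mult_distrib power2_eq_square[of m] mult.assoc)
    then have "(?m + 1) * (t (Suc N))\<^sup>2 \<le> ?m * (t N)\<^sup>2"
      by (rule mult_left_le_imp_le) (use pos in simp)
    then show ?thesis by (simp add: m_def algebra_simps)
  qed
  have bnd: "real (Suc N) * (t N)\<^sup>2 \<le> 2 * (t 1)\<^sup>2" if "1 \<le> N" for N
    using that
  proof (induction N rule: dec_induct)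
    case (step N)
    then show ?case using dec[of N] by linarith
  qed simp
  have "(\<lambda>N. (t N)\<^sup>2) \<longlonglongrightarrow> 0"
  proof (rule tendsto_sandwich[where f="\<lambda>_. 0"])
    show "eventually (\<lambda>N. (t N)\<^sup>2 \<le> 2 * (t 1)\<^sup>2 / real (Suc N)) sequentially"
      using bnd by (intro eventually_sequentiallyI[of 1]) (auto simp: field_simps)
    show "(\<lambda>N. 2 * (t 1)\<^sup>2 / real (Suc N)) \<longlonglongrightarrow> 0"
      using tendsto_mult[OF tendsto_const[of "2 * (t 1)\<^sup>2"] LIMSEQ_inverse_real_of_nat] by (simp add: divide_inverse)
  qed auto
  then have "(\<lambda>N. sqrt ((t N)\<^sup>2)) \<longlonglongrightarrow> sqrt 0" by (intro tendsto_real_sqrt)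
  then show ?thesis using t0 by (simp add: t_def)
qed

lemma no_tie_above:
  assumes \<epsilon>: "0 < \<epsilon>"
  shows "AE x in P. \<not> (snd x 0 \<noteq> snd x 1 \<and> \<epsilon> \<le> pair_weight x \<and> weight_of 0 x = weight_of 1 x)"
proof -
  let ?T = "\<lambda>x. of_bool (snd x 0 \<noteq> snd x 1 \<and> \<epsilon> \<le> pair_weight x \<and> weight_of 0 x = weight_of 1 x) :: real"
  have [measurable]: "Measurable.pred \<Omega> (\<lambda>x. weight_of 0 x = weight_of 1 x)"
    by (simp add: pred_def) 
  have T [measurable]: "?T \<in> borel_measurable P" by measurable
  have intT: "integrable P ?T" by (rule P.integrable_const_bound[where B=1, OF _ T]) auto
  have le: "(\<integral>x. ?T x \<partial>P) \<le> 4 ^ N * share_moment \<epsilon> N N" for N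
  proof -
    have "(\<integral>x. ?T x \<partial>P) \<le> (\<integral>x. 4 ^ N * (share_integrand \<epsilon> N N x) \<partial>P)"
    proof (rule integral_mono[OF intT])
      show "integrable P (\<lambda>x. 4 ^ N * (share_integrand \<epsilon> N N x))"
        by (intro integrable_mult_right integrable_share)
      fix x assume x: "x \<in> space P"
      show "?T x \<le> 4 ^ N * (share_integrand \<epsilon> N N x)"
      proof (cases "snd x 0 \<noteq> snd x 1 \<and> \<epsilon> \<le> pair_weight x \<and> weight_of 0 x = weight_of 1 x")
        case True
        then have shares: "weight_of 0 x / pair_weight x = 1 / 2" "weight_of 1 x / pair_weight x = 1 / 2"
          using weight_of_pos[OF x, of 1] by simp_all
        have one: "4 ^ N * (1 * ((1 / 2) ^ N * (1 / 2) ^ N)) = (1 :: real)"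
          by (simp add: power_mult_distrib[symmetric])
        have "of_bool (snd x 0 \<noteq> snd x 1 \<and> \<epsilon> \<le> pair_weight x) = (1 :: real)" "?T x = 1" using True by simp_all
        then show ?thesis by (simp only: shares one order_refl)
      next
        case False
        then have "?T x = 0" by simp
        also have "0 \<le> 4 ^ N * (share_integrand \<epsilon> N N x)"
          using share_in_01[OF x] by (intro mult_nonneg_nonneg zero_le_power) auto
        finally show ?thesis .
      qed
    qed
    then show ?thesis by (simp add: share_moment_def)
  qed
  have "(\<integral>x. ?T x \<partial>P) \<le> 0"
    using share_moment_tendsto_0[OF \<epsilon>] le by (intro LIMSEQ_le_const) auto
  then have "(\<integral>x. ?T x \<partial>P) = 0" by (intro antisym Bochner_Integration.integral_nonneg) auto
  then have "AE x in P. ?T x = 0" using integral_nonneg_eq_0_iff_AE[OF intT] by auto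
  then show ?thesis by eventually_elim auto
qed

lemma no_tie: "AE x in P. snd x 0 \<noteq> snd x 1 \<longrightarrow> weight_of 0 x \<noteq> weight_of 1 x"
proof -
  have "AE x in P. \<forall>m::nat. \<not> (snd x 0 \<noteq> snd x 1 \<and> 1 / real (Suc m) \<le> pair_weight x \<and> weight_of 0 x = weight_of 1 x)"
    unfolding AE_all_countable by (intro allI no_tie_above) simp
  then show ?thesis
  proof (rule AE_mp, intro AE_I2 impI notI)
    fix x assume x: "x \<in> space P" and all: "\<forall>m::nat. \<not> (snd x 0 \<noteq> snd x 1 \<and> 1 / real (Suc m) \<le> pair_weight x \<and> weight_of 0 x = weight_of 1 x)"
      and "snd x 0 \<noteq> snd x 1" "weight_of 0 x = weight_of 1 x"
    have "0 < pair_weight x" using weight_of_pos[OF x] by (simp add: add_pos_pos)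
    then obtain m where "1 / real (Suc m) < pair_weight x" using nat_approx_posE by blast
    then have "1 / real (Suc m) \<le> pair_weight x" by (rule less_imp_le)
    then show False using all \<open>snd x 0 \<noteq> snd x 1\<close> \<open>weight_of 0 x = weight_of 1 x\<close> by blast
  qed
qed

lemma AE_inj_weights: "AE \<omega> in M. inj (\<lambda>l. v l \<omega>)"
proof -
  have "AE \<omega> in M. v l \<omega> \<noteq> v l' \<omega>" if ll': "l \<noteq> l'" for l l'
  proof -
    have "AE x in P. (\<forall>i<(2::nat). snd x i = (if i = 0 then l else l')) \<longrightarrow> v l (fst x) \<noteq> v l' (fst x)"
      using no_tie
    proof (eventually_elim, intro impI)
      fix x :: "'w \<times> (nat \<Rightarrow> nat)" assume "\<forall>i<(2::nat). snd x i = (if i = 0 then l else l')"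
      then have "snd x 0 = l" "snd x 1 = l'" by auto
      moreover assume "snd x 0 \<noteq> snd x 1 \<longrightarrow> weight_of 0 x \<noteq> weight_of 1 x"
      ultimately show "v l (fst x) \<noteq> v l' (fst x)" using ll' by simp
    qed
    then show ?thesis by (rule AE_P_indicesD[rotated]) (simp add: pred_def)
  qed
  then have "AE \<omega> in M. \<forall>l l'. l \<noteq> l' \<longrightarrow> v l \<omega> \<noteq> v l' \<omega>"
    unfolding AE_all_countable by (metis (mono_tags, lifting) AE_I2 eventually_mono)
  then show ?thesis by eventually_elim (auto simp: inj_def)
qed

end

section \<open>Exchangeability and independence for a separating array\<close>

context gg_array
begin

text \<open>The array of the atoms taken in the order \<open>\<rho>\<close>.\<close>

definition reindexed :: "(nat \<Rightarrow> nat) \<Rightarrow> 'w \<Rightarrow> nat \<times> nat \<Rightarrow> real" where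
  "reindexed \<rho> \<omega> = (\<lambda>(i, j). Q \<omega> (\<rho> i, \<rho> j))"

lemma measurable_reindexed_component: "(\<lambda>\<omega>. reindexed \<rho> \<omega> p) \<in> borel_measurable M"
  using Q_measurable by (simp add: reindexed_def case_prod_beta')

lemma measurable_corner_reindexed [measurable]: "(\<lambda>\<omega>. corner k (reindexed \<rho> \<omega>)) \<in> M \<rightarrow>\<^sub>M finite_array k"
  by (rule measurable_restrict, rule measurable_reindexed_component)

lemma measurable_weights [measurable]: "(\<lambda>\<omega> l. v l \<omega>) \<in> M \<rightarrow>\<^sub>M seq_borel"
  by (rule measurable_PiM_single') (auto simp: space_PiM)

lemma reindexed_weighted:
  assumes k: "2 \<le> k" and A: "A \<in> sets (finite_array k)" and C: "C \<in> sets seq_borel" and \<rho>: "inj \<rho>"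
  shows "(\<integral>\<omega>. (indicator A (corner k (reindexed \<rho> \<omega>)) - ratio k A) * (\<Prod>i<k. v (\<rho> i) \<omega>) * indicator C (\<lambda>l. v l \<omega>) \<partial>M) = 0"
proof -
  note [measurable] = A C
  let ?g = "\<lambda>\<omega>. (indicator A (corner k (reindexed \<rho> \<omega>)) - ratio k A) * indicator C (\<lambda>l. v l \<omega>)"
  let ?f = "\<lambda>x. deviation k A x * (indicator C (\<lambda>l. v l (fst x)) * of_bool (\<forall>i<k. weight_of i x = v (\<rho> i) (fst x)))"
  have g [measurable]: "?g \<in> borel_measurable M" by measurable
  have "{x \<in> space P. weight_of i x = v (\<rho> i) (fst x)} \<in> sets P" for i
    by (rule borel_measurable_eq) measurable
  then have [measurable]: "Measurable.pred P (\<lambda>x. weight_of i x = v (\<rho> i) (fst x))" for i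
    by (simp add: pred_def)
  have "(\<integral>x. ?g (fst x) * of_bool (\<forall>i<k. snd x i = \<rho> i) \<partial>P) = (\<integral>x. ?f x \<partial>P)"
  proof (rule integral_cong_AE)
    show "AE x in P. ?g (fst x) * of_bool (\<forall>i<k. snd x i = \<rho> i) = ?f x"
      using AE_P_fst[OF AE_inj_weights]
    proof eventually_elim
      case (elim x)
      have eq: "weight_of i x = v (\<rho> i) (fst x) \<longleftrightarrow> snd x i = \<rho> i" for i
        using injD[OF elim, of "snd x i" "\<rho> i"] by auto
      show ?case
      proof (cases "\<forall>i<k. snd x i = \<rho> i")
        case True
        have "corner k (S x) = corner k (reindexed \<rho> (fst x))"
        proof
          fix p
          show "corner k (S x) p = corner k (reindexed \<rho> (fst x)) p"
            using True by (cases "p \<in> {..<k} \<times> {..<k}") (auto simp: sampled_array_def reindexed_def)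
        qed
        moreover have "distinct_replicas k x"
          using True \<rho> by (auto simp: distinct_replicas_def inj_eq)
        ultimately show ?thesis using True by (simp add: eq deviation_def)
      next
        case False
        then show ?thesis by (simp add: eq)
      qed
    qed
  qed measurable
  also have "\<dots> = 0" by (rule integral_deviation_weights[OF k A C])
  finally have "(\<integral>x. ?g (fst x) * of_bool (\<forall>i<k. snd x i = \<rho> i) \<partial>P) = 0" .
  moreover have "\<bar>?g \<omega>\<bar> \<le> 1 + \<bar>ratio k A\<bar>" for \<omega>
    by (auto simp: indicator_def)
  ultimately have "(\<integral>\<omega>. ?g \<omega> * (\<Prod>i<k. v (\<rho> i) \<omega>) \<partial>M) = 0"
    by (subst (asm) integral_P_indices[OF g]) auto
  then show ?thesis by (simp add: mult_ac)
qed

lemma reindexed_independent_integral: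
  assumes k: "2 \<le> k" and A: "A \<in> sets (finite_array k)" and C: "C \<in> sets seq_borel" and \<rho>: "inj \<rho>"
  shows "(\<integral>\<omega>. (indicator A (corner k (reindexed \<rho> \<omega>)) - ratio k A) * indicator C (\<lambda>l. v l \<omega>) \<partial>M) = 0"
proof -
  note [measurable] = A C
  define p where "p \<omega> = (\<Prod>i<k. v (\<rho> i) \<omega>)" for \<omega>
  define Z where "Z \<omega> = (indicator A (corner k (reindexed \<rho> \<omega>)) - ratio k A) * p \<omega>" for \<omega>
  \<comment> \<open>The product \<open>p\<close> of the weights is a positive function of the weights; it is divided out by means
    of bounded truncations of its inverse.\<close>
  define g where "g m y = indicator C y * max 0 (min (real m) (inverse (\<Prod>i<k. y (\<rho> i))))" for m and y :: "nat \<Rightarrow> real"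
  have [measurable]: "p \<in> borel_measurable M" unfolding p_def by measurable
  have p: "0 < p \<omega>" "p \<omega> \<le> 1" if "\<omega> \<in> space M" for \<omega>
    using v_pos[OF that] v_in_01[OF that] by (auto simp: p_def intro!: prod_pos prod_le_1)
  have ind: "\<bar>indicator A (corner k (reindexed \<rho> \<omega>)) - ratio k A\<bar> \<le> 1 + \<bar>ratio k A\<bar>" for \<omega>
    by (auto simp: indicator_def)
  have Zm [measurable]: "Z \<in> borel_measurable M" unfolding Z_def by measurable
  have Z: "integrable M Z"
  proof (rule integrable_const_bound[where B="(1 + \<bar>ratio k A\<bar>) * 1", OF _ Zm], rule AE_I2)
    fix \<omega> assume "\<omega> \<in> space M"
    then have "\<bar>p \<omega>\<bar> \<le> 1" using p[of \<omega>] by simp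
    then show "norm (Z \<omega>) \<le> (1 + \<bar>ratio k A\<bar>) * 1"
      unfolding Z_def real_norm_def by (intro abs_mult_le_mult ind)
  qed
  have gm [measurable]: "g m \<in> borel_measurable seq_borel" for m unfolding g_def by measurable
  have zero: "(\<integral>\<omega>. Z \<omega> * g m (\<lambda>l. v l \<omega>) \<partial>M) = 0" for m
  proof (rule signed_image_zero_bounded[OF Z measurable_weights _ gm])
    show "(\<integral>\<omega>. Z \<omega> * indicator C' (\<lambda>l. v l \<omega>) \<partial>M) = 0" if "C' \<in> sets seq_borel" for C'
      using reindexed_weighted[OF k A that \<rho>] by (simp add: Z_def p_def)
    show "\<bar>g m y\<bar> \<le> real m" for y by (auto simp: g_def indicator_def)
  qed
  have gp: "g m (\<lambda>l. v l \<omega>) = indicator C (\<lambda>l. v l \<omega>) * min (real m) (inverse (p \<omega>))" if "\<omega> \<in> space M" for m \<omega>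
    using p[OF that] by (simp add: g_def p_def max_def)
  have "(\<lambda>m. \<integral>\<omega>. Z \<omega> * g m (\<lambda>l. v l \<omega>) \<partial>M)
      \<longlonglongrightarrow> (\<integral>\<omega>. (indicator A (corner k (reindexed \<rho> \<omega>)) - ratio k A) * indicator C (\<lambda>l. v l \<omega>) \<partial>M)"
  proof (rule integral_dominated_convergence[where w="\<lambda>_. 1 + \<bar>ratio k A\<bar>"])
    show "AE \<omega> in M. (\<lambda>m. Z \<omega> * g m (\<lambda>l. v l \<omega>)) \<longlonglongrightarrow>
        (indicator A (corner k (reindexed \<rho> \<omega>)) - ratio k A) * indicator C (\<lambda>l. v l \<omega>)"
    proof (rule AE_I2)
      fix \<omega> assume \<omega>: "\<omega> \<in> space M"
      obtain m0 :: nat where m0: "inverse (p \<omega>) < real m0" using reals_Archimedean2 by blast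
      have "Z \<omega> * g m (\<lambda>l. v l \<omega>) = (indicator A (corner k (reindexed \<rho> \<omega>)) - ratio k A) * indicator C (\<lambda>l. v l \<omega>)"
        if "m0 \<le> m" for m
      proof -
        have "min (real m) (inverse (p \<omega>)) = inverse (p \<omega>)" using m0 that by simp
        then show ?thesis using p[OF \<omega>] by (simp add: gp[OF \<omega>] Z_def)
      qed
      then show "(\<lambda>m. Z \<omega> * g m (\<lambda>l. v l \<omega>)) \<longlonglongrightarrow>
        (indicator A (corner k (reindexed \<rho> \<omega>)) - ratio k A) * indicator C (\<lambda>l. v l \<omega>)"
        by (intro tendsto_eventually eventually_sequentiallyI[of m0])
    qed
    show "AE \<omega> in M. norm (Z \<omega> * g m (\<lambda>l. v l \<omega>)) \<le> 1 + \<bar>ratio k A\<bar>" for m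
    proof (rule AE_I2)
      fix \<omega> assume \<omega>: "\<omega> \<in> space M"
      have "0 \<le> p \<omega> * min (real m) (inverse (p \<omega>))" using p[OF \<omega>] by simp
      moreover have "p \<omega> * min (real m) (inverse (p \<omega>)) \<le> p \<omega> * inverse (p \<omega>)"
        using p[OF \<omega>] by (intro mult_left_mono) auto
      ultimately have "\<bar>p \<omega> * min (real m) (inverse (p \<omega>))\<bar> \<le> 1" using p[OF \<omega>] by simp
      then have "\<bar>indicator C (\<lambda>l. v l \<omega>) * (p \<omega> * min (real m) (inverse (p \<omega>)))\<bar> \<le> 1"
        by (auto simp: indicator_def)
      from abs_mult_le_mult[OF ind[of \<omega>] this] show "norm (Z \<omega> * g m (\<lambda>l. v l \<omega>)) \<le> 1 + \<bar>ratio k A\<bar>"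
        by (simp add: gp[OF \<omega>] Z_def mult_ac)
    qed
  qed auto
  then show ?thesis by (simp add: zero LIMSEQ_const_iff)
qed

text \<open>The array of the atoms \<open>\<rho> 0, \<dots>, \<rho> (k - 1)\<close> is independent of the weights, with the law of the
  array of \<open>k\<close> distinct replicas.\<close>

lemma reindexed_independent:
  assumes k: "2 \<le> k" and A: "A \<in> sets (finite_array k)" and C: "C \<in> sets seq_borel" and \<rho>: "inj \<rho>"
  shows "prob {\<omega> \<in> space M. corner k (reindexed \<rho> \<omega>) \<in> A \<and> (\<lambda>l. v l \<omega>) \<in> C}
    = ratio k A * prob {\<omega> \<in> space M. (\<lambda>l. v l \<omega>) \<in> C}"
proof -
  note [measurable] = A C
  let ?E = "{\<omega> \<in> space M. corner k (reindexed \<rho> \<omega>) \<in> A \<and> (\<lambda>l. v l \<omega>) \<in> C}"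
  let ?F = "{\<omega> \<in> space M. (\<lambda>l. v l \<omega>) \<in> C}"
  have E [measurable]: "?E \<in> events" and F [measurable]: "?F \<in> events" by measurable
  have "(\<integral>\<omega>. (indicator A (corner k (reindexed \<rho> \<omega>)) - ratio k A) * indicator C (\<lambda>l. v l \<omega>) \<partial>M)
    = (\<integral>\<omega>. indicator ?E \<omega> - ratio k A * indicator ?F \<omega> \<partial>M)"
    by (intro Bochner_Integration.integral_cong) (auto simp: indicator_def)
  also have "\<dots> = prob ?E - ratio k A * prob ?F"
    using E F by (subst Bochner_Integration.integral_diff) (auto simp: integrable_real_indicator emeasure_eq_measure)
  finally show ?thesis using reindexed_independent_integral[OF assms] by simp
qed

lemma measurable_reindexed: "reindexed \<rho> \<in> M \<rightarrow>\<^sub>M array_borel"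
  by (rule measurable_PiM_single'[where f="\<lambda>p \<omega>. reindexed \<rho> \<omega> p"])
     (auto simp: space_PiM intro: measurable_reindexed_component)

lemma UNIV_seq_borel: "UNIV \<in> sets seq_borel"
  using sets.top[of seq_borel] by (simp add: space_PiM)

text \<open>Every cylinder is an event of a finite corner, which may be taken of size at least \<open>2\<close>.\<close>

lemma cylinder_eq_corner:
  fixes J :: "(nat \<times> nat) set" and A :: "nat \<times> nat \<Rightarrow> real set"
  assumes J: "finite J" and A: "\<And>p. p \<in> J \<Longrightarrow> A p \<in> sets borel"
  obtains k B where "2 \<le> k" "B \<in> sets (finite_array k)"
    "\<And>R. R \<in> prod_emb UNIV (\<lambda>_. borel) J (Pi\<^sub>E J A) \<longleftrightarrow> corner k R \<in> B"
proof -
  define k where "k = Max (insert 1 (fst ` J \<union> snd ` J)) + 1"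
  have fin: "finite (insert 1 (fst ` J \<union> snd ` J))" using J by simp
  have "1 \<le> Max (insert 1 (fst ` J \<union> snd ` J))" using fin by (rule Max_ge) simp
  then have k: "2 \<le> k" by (simp add: k_def)
  have JK: "J \<subseteq> {..<k} \<times> {..<k}"
  proof
    fix p assume "p \<in> J"
    then have "fst p \<in> insert 1 (fst ` J \<union> snd ` J)" "snd p \<in> insert 1 (fst ` J \<union> snd ` J)" by simp_all
    then have "fst p \<le> Max (insert 1 (fst ` J \<union> snd ` J))" "snd p \<le> Max (insert 1 (fst ` J \<union> snd ` J))"
      by (simp_all only: Max_ge[OF fin])
    then show "p \<in> {..<k} \<times> {..<k}" by (simp add: mem_Times_iff k_def)
  qed
  have "prod_emb ({..<k} \<times> {..<k}) (\<lambda>_. borel) J (Pi\<^sub>E J A) \<in> sets (finite_array k)"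
    using J A JK by (intro sets_PiM_I) auto
  moreover have "R \<in> prod_emb UNIV (\<lambda>_. borel) J (Pi\<^sub>E J A) \<longleftrightarrow>
      corner k R \<in> prod_emb ({..<k} \<times> {..<k}) (\<lambda>_. borel) J (Pi\<^sub>E J A)" for R
  proof -
    have "p \<in> J \<Longrightarrow> corner k R p = R p" for p using JK by auto
    then have "restrict (corner k R) J = restrict R J" by (intro restrict_ext) simp
    then show ?thesis by (simp add: prod_emb_def space_PiM)
  qed
  ultimately show ?thesis using k that by blast
qed

lemma reindexed_id: "reindexed id = Q"
  by (simp add: reindexed_def fun_eq_iff)

lemma measurable_array: "Q \<in> M \<rightarrow>\<^sub>M array_borel"
  using measurable_reindexed[of id] by (simp only: reindexed_id)

lemma reindexed_same_law:
  assumes \<rho>: "inj \<rho>"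
  shows "distr M array_borel (reindexed \<rho>) = distr M array_borel Q"
proof -
  have "distr M array_borel (reindexed \<rho>) = distr M array_borel (reindexed id)"
  proof (rule measure_eqI_PiM_infinite)
    fix A :: "nat \<times> nat \<Rightarrow> real set" and J :: "(nat \<times> nat) set"
    assume J: "finite J" "\<And>p. p \<in> J \<Longrightarrow> A p \<in> sets borel"
    obtain k B where kB: "2 \<le> k" "B \<in> sets (finite_array k)"
      "\<And>R. R \<in> prod_emb UNIV (\<lambda>_. borel) J (Pi\<^sub>E J A) \<longleftrightarrow> corner k R \<in> B"
      by (rule cylinder_eq_corner[where J=J and A=A, OF J]) (assumption, rule that)
    have X: "prod_emb UNIV (\<lambda>_. borel) J (Pi\<^sub>E J A) \<in> sets array_borel"
      using J by (intro sets_PiM_I) auto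
    have "emeasure (distr M array_borel (reindexed \<rho>')) (prod_emb UNIV (\<lambda>_. borel) J (Pi\<^sub>E J A)) = ennreal (ratio k B)"
      if "inj \<rho>'" for \<rho>'
    proof -
      have pre: "reindexed \<rho>' -` prod_emb UNIV (\<lambda>_. borel) J (Pi\<^sub>E J A) \<inter> space M
        = {\<omega> \<in> space M. corner k (reindexed \<rho>' \<omega>) \<in> B \<and> (\<lambda>l. v l \<omega>) \<in> UNIV}"
        unfolding vimage_def kB(3) by blast
      have U: "UNIV \<in> sets seq_borel" by (rule UNIV_seq_borel)
      have "emeasure (distr M array_borel (reindexed \<rho>')) (prod_emb UNIV (\<lambda>_. borel) J (Pi\<^sub>E J A))
        = ennreal (prob {\<omega> \<in> space M. corner k (reindexed \<rho>' \<omega>) \<in> B \<and> (\<lambda>l. v l \<omega>) \<in> UNIV})"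
        unfolding emeasure_distr[OF measurable_reindexed X] pre by (rule emeasure_eq_measure)
      also have "\<dots> = ennreal (ratio k B)"
        unfolding reindexed_independent[OF kB(1,2) U that] by (simp add: prob_space)
      finally show ?thesis .
    qed
    from this[OF \<rho>] this[OF inj_on_id]
    show "emeasure (distr M array_borel (reindexed \<rho>)) (prod_emb UNIV (\<lambda>_. borel) J (Pi\<^sub>E J A))
      = emeasure (distr M array_borel (reindexed id)) (prod_emb UNIV (\<lambda>_. borel) J (Pi\<^sub>E J A))"
      by (rule trans[OF _ sym])
  next
    show "finite_measure (distr M array_borel (reindexed \<rho>))"
      by (rule finite_measure_distr[OF measurable_reindexed])
  qed simp_all
  then show ?thesis by (simp only: reindexed_id)
qed

lemma array_independent:
  assumes A: "A \<in> sets array_borel" and C: "C \<in> sets seq_borel"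
  shows "prob {\<omega> \<in> space M. Q \<omega> \<in> A \<and> (\<lambda>l. v l \<omega>) \<in> C}
    = prob {\<omega> \<in> space M. Q \<omega> \<in> A} * prob {\<omega> \<in> space M. (\<lambda>l. v l \<omega>) \<in> C}"
proof -
  note [measurable] = C
  note Q [measurable] = measurable_array
  let ?F = "{\<omega> \<in> space M. (\<lambda>l. v l \<omega>) \<in> C}"
  let ?N = "distr (density M (indicator ?F)) array_borel Q"
  let ?N' = "scale_measure (ennreal (prob ?F)) (distr M array_borel Q)"
  have F [measurable]: "?F \<in> events" by measurable
  have emN: "emeasure ?N X = ennreal (prob {\<omega> \<in> space M. Q \<omega> \<in> X \<and> (\<lambda>l. v l \<omega>) \<in> C})"
    if X [measurable]: "X \<in> sets array_borel" for X
  proof -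
    have "emeasure ?N X = emeasure M (?F \<inter> (Q -` X \<inter> space M))"
      by (simp add: emeasure_distr emeasure_restricted)
    also have "?F \<inter> (Q -` X \<inter> space M) = {\<omega> \<in> space M. Q \<omega> \<in> X \<and> (\<lambda>l. v l \<omega>) \<in> C}" by auto
    finally show ?thesis by (simp add: emeasure_eq_measure)
  qed
  have emN': "emeasure ?N' X = ennreal (prob {\<omega> \<in> space M. Q \<omega> \<in> X} * prob ?F)"
    if X [measurable]: "X \<in> sets array_borel" for X
  proof -
    have "Q -` X \<inter> space M = {\<omega> \<in> space M. Q \<omega> \<in> X}" by auto
    then show ?thesis
      by (simp add: emeasure_distr emeasure_eq_measure ennreal_mult[symmetric] mult.commute)
  qed
  have "?N = ?N'"
  proof (rule measure_eqI_PiM_infinite)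
    fix A :: "nat \<times> nat \<Rightarrow> real set" and J :: "(nat \<times> nat) set"
    assume J: "finite J" "\<And>p. p \<in> J \<Longrightarrow> A p \<in> sets borel"
    obtain k B where kB: "2 \<le> k" "B \<in> sets (finite_array k)"
      "\<And>R. R \<in> prod_emb UNIV (\<lambda>_. borel) J (Pi\<^sub>E J A) \<longleftrightarrow> corner k R \<in> B"
      by (rule cylinder_eq_corner[where J=J and A=A, OF J]) (assumption, rule that)
    let ?X = "prod_emb UNIV (\<lambda>_. borel) J (Pi\<^sub>E J A)"
    have X: "?X \<in> sets array_borel" using J by (intro sets_PiM_I) auto
    note U = UNIV_seq_borel
    have "prob {\<omega> \<in> space M. Q \<omega> \<in> ?X \<and> (\<lambda>l. v l \<omega>) \<in> C} = ratio k B * prob ?F"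
      using reindexed_independent[OF kB(1,2) C inj_on_id] by (simp add: kB(3) reindexed_id)
    moreover have "prob {\<omega> \<in> space M. Q \<omega> \<in> ?X} = ratio k B"
      using reindexed_independent[OF kB(1,2) U inj_on_id] by (simp add: kB(3) reindexed_id prob_space)
    ultimately show "emeasure ?N ?X = emeasure ?N' ?X" by (simp only: emN[OF X] emN'[OF X])
  next
    show "finite_measure ?N"
      by (rule finite_measureI) (simp only: space_distr emN[OF sets.top] ennreal_neq_top infinity_ennreal_def not_False_eq_True)
  qed simp_all
  then have "ennreal (prob {\<omega> \<in> space M. Q \<omega> \<in> A \<and> (\<lambda>l. v l \<omega>) \<in> C}) = ennreal (prob {\<omega> \<in> space M. Q \<omega> \<in> A} * prob ?F)"
    by (simp only: emN[OF A, symmetric] emN'[OF A, symmetric])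
  then show ?thesis by simp
qed

end

section \<open>The Gram matrix of the atoms\<close>

abbreviation sampled_gram :: "(nat \<Rightarrow> 'w \<Rightarrow> 'h::real_inner) \<Rightarrow> 'w \<times> (nat \<Rightarrow> nat) \<Rightarrow> nat \<times> nat \<Rightarrow> real" where
  "sampled_gram \<xi> \<equiv> sampled_array (\<lambda>\<omega>. gram (\<lambda>l. \<xi> l \<omega>))"

text \<open>The hypotheses of the theorem in terms of the joint law of the weights, the atoms and the indices
  of the replicas.\<close>

locale gg_atoms = positive_weights M v for M :: "'w measure" and v +
  fixes \<xi> :: "nat \<Rightarrow> 'w \<Rightarrow> 'h::{real_inner, polish_space}"
  assumes \<xi>_measurable: "\<And>l. \<xi> l \<in> borel_measurable M"
    and AE_ball: "AE \<omega> in M. \<forall>l. \<xi> l \<omega> \<in> cball 0 1"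
    and AE_inj_atoms: "AE \<omega> in M. inj (\<lambda>l. \<xi> l \<omega>)"
    and GG_atoms: "\<And>n f \<psi>. 2 \<le> n \<Longrightarrow> f \<in> borel_measurable (finite_array n) \<Longrightarrow>
      bounded (f ` space (finite_array n)) \<Longrightarrow> \<psi> \<in> borel_measurable borel \<Longrightarrow> bounded (range \<psi>) \<Longrightarrow>
      (\<integral>x. f (corner n (sampled_gram \<xi> x)) * \<psi> (sampled_gram \<xi> x (0, n)) \<partial>P) =
        1 / real n * (\<integral>x. f (corner n (sampled_gram \<xi> x)) \<partial>P)
          * (\<integral>x. \<psi> (sampled_gram \<xi> x (0, 1)) \<partial>P)
        + 1 / real n * (\<Sum>l = 1..<n. \<integral>x. f (corner n (sampled_gram \<xi> x))
            * \<psi> (sampled_gram \<xi> x (0, l)) \<partial>P)"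
begin

abbreviation A :: "'w \<Rightarrow> nat \<times> nat \<Rightarrow> real" where
  "A \<equiv> \<lambda>\<omega>. gram (\<lambda>l. \<xi> l \<omega>)"

abbreviation overlap :: "nat \<Rightarrow> nat \<Rightarrow> 'w \<times> (nat \<Rightarrow> nat) \<Rightarrow> real" where
  "overlap i j x \<equiv> sampled_array A x (i, j)"

lemma overlap_eq: "overlap i j x = \<xi> (snd x i) (fst x) \<bullet> \<xi> (snd x j) (fst x)"
  by (simp add: sampled_array_def gram_def)

lemma measurable_A: "(\<lambda>\<omega>. A \<omega> p) \<in> borel_measurable M"
  using borel_measurable_inner[OF \<xi>_measurable \<xi>_measurable] by (simp add: gram_def case_prod_beta')

lemma measurable_overlap [measurable]: "overlap i j \<in> borel_measurable \<Omega>"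
  by (rule measurable_sampled_array_component[OF measurable_A])

lemma measurable_corner_overlap: "(\<lambda>x. corner n (sampled_array A x)) \<in> \<Omega> \<rightarrow>\<^sub>M finite_array n"
  by (rule measurable_restrict, rule measurable_sampled_array_component[OF measurable_A])

lemma AE_overlap_bounds: "AE x in P. \<forall>i j. \<bar>overlap i j x\<bar> \<le> 1"
  using AE_P_fst[OF AE_ball]
proof (eventually_elim, intro allI)
  fix x :: "'w \<times> (nat \<Rightarrow> nat)" and i j
  assume *: "\<forall>l. \<xi> l (fst x) \<in> cball 0 1"
  have "\<bar>overlap i j x\<bar> \<le> norm (\<xi> (snd x i) (fst x)) * norm (\<xi> (snd x j) (fst x))"
    unfolding overlap_eq by (rule Cauchy_Schwarz_ineq2)
  also have "\<dots> \<le> 1 * 1" using * by (intro mult_mono) auto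
  finally show "\<bar>overlap i j x\<bar> \<le> 1" by simp
qed

text \<open>The self-overlap of a replica is independent of its overlap with another one.\<close>

lemma self_overlap_independent:
  assumes B [measurable]: "B \<in> sets borel" and C [measurable]: "C \<in> sets borel"
  shows "(\<integral>x. indicator B (overlap 0 0 x) * indicator C (overlap 0 1 x) \<partial>P)
    = (\<integral>x. indicator B (overlap 0 0 x) \<partial>P) * (\<integral>x. indicator C (overlap 0 1 x) \<partial>P :: real)"
proof -
  let ?f = "\<lambda>R. indicator B (R (0, 0)) :: real"
  have "(\<lambda>R. R (0, 0)) \<in> borel_measurable (finite_array 2)"
    by (rule measurable_component_singleton) simp
  then have f: "?f \<in> borel_measurable (finite_array 2)" by measurable
  have bdd: "bounded (?f ` space (finite_array 2))" "bounded (range (indicator C :: real \<Rightarrow> real))"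
    by (auto simp: bounded_iff indicator_def intro!: exI[of _ 1])
  have gg: "(\<integral>x. indicator B (overlap 0 0 x) * indicator C (overlap 0 2 x) \<partial>P) =
      1 / 2 * (\<integral>x. indicator B (overlap 0 0 x) \<partial>P) * (\<integral>x. indicator C (overlap 0 1 x) \<partial>P)
      + 1 / 2 * (\<integral>x. indicator B (overlap 0 0 x) * indicator C (overlap 0 1 x) \<partial>P :: real)"
  proof -
    have "{Suc 0..<2} = {Suc 0}" by auto
    then show ?thesis using GG_atoms[OF order_refl f bdd(1) _ bdd(2)] by simp
  qed
  \<comment> \<open>By exchangeability the replica \<open>2\<close> may be replaced by the replica \<open>1\<close>.\<close>
  define \<pi> where "\<pi> = Transposition.transpose (1::nat) 2"
  have \<pi>: "inj \<pi>" "\<pi> 0 = 0" "\<pi> 1 = 2" by (auto simp: \<pi>_def Transposition.transpose_def inj_def)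
  have "(\<integral>x. indicator B (overlap 0 0 (fst x, \<lambda>i. snd x (\<pi> i))) * indicator C (overlap 0 1 (fst x, \<lambda>i. snd x (\<pi> i))) \<partial>P)
      = (\<integral>x. indicator B (overlap 0 0 x) * indicator C (overlap 0 1 x) \<partial>P :: real)"
    by (rule integral_P_permute[where C=1, OF _ _ \<pi>(1)]) (auto simp: indicator_def, measurable)
  moreover have "overlap 0 0 (fst x, \<lambda>i. snd x (\<pi> i)) = overlap 0 0 x"
    "overlap 0 1 (fst x, \<lambda>i. snd x (\<pi> i)) = overlap 0 2 x" for x
    using \<pi>(2,3) by (simp_all add: overlap_eq)
  ultimately show ?thesis using gg by simp
qed

text \<open>The largest point of the support of the law of an overlap.\<close>

definition q :: real where
  "q = Sup {t. 0 < P.prob {x \<in> space P. t < overlap 0 1 x}}"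

lemma q_properties:
  shows prob_overlap_gt: "t < q \<Longrightarrow> 0 < P.prob {x \<in> space P. t < overlap 0 1 x}"
    and AE_overlap_le: "AE x in P. overlap 0 1 x \<le> q"
proof -
  let ?T = "{t. 0 < P.prob {x \<in> space P. t < overlap 0 1 x}}"
  have [measurable]: "{x \<in> space P. t < overlap 0 1 x} \<in> sets P" for t by measurable
  have "AE x in P. -2 < overlap 0 1 x"
    using AE_overlap_bounds
  proof eventually_elim
    case (elim x)
    then have "\<bar>overlap 0 1 x\<bar> \<le> 1" by blast
    then show ?case by linarith
  qed
  then have "P.prob {x \<in> space P. -2 < overlap 0 1 x} = 1"
    by (subst P.prob_Collect_eq_1) auto
  then have "-2 \<in> ?T" by simp
  then have ne: "?T \<noteq> {}" by blast
  have up: "t \<le> 1" if "t \<in> ?T" for t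
  proof (rule ccontr)
    assume "\<not> t \<le> 1"
    have "AE x in P. \<not> t < overlap 0 1 x"
      using AE_overlap_bounds
    proof eventually_elim
      case (elim x)
      then have "\<bar>overlap 0 1 x\<bar> \<le> 1" by blast
      then show ?case using \<open>\<not> t \<le> 1\<close> by linarith
    qed
    then have "P.prob {x \<in> space P. t < overlap 0 1 x} = 0"
      by (subst P.prob_Collect_eq_0) auto
    then show False using that by simp
  qed
  then have bdd: "bdd_above ?T" by (intro bdd_aboveI)
  show "0 < P.prob {x \<in> space P. t < overlap 0 1 x}" if "t < q"
  proof -
    obtain s where s: "s \<in> ?T" "t < s" using less_cSupE[OF _ ne] \<open>t < q\<close> unfolding q_def by blast
    have "P.prob {x \<in> space P. s < overlap 0 1 x} \<le> P.prob {x \<in> space P. t < overlap 0 1 x}"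
      using s(2) by (intro P.finite_measure_mono) auto
    then show ?thesis using s(1) by simp
  qed
  have "AE x in P. \<forall>m::nat. \<not> q + 1 / real (Suc m) < overlap 0 1 x"
    unfolding AE_all_countable
  proof
    fix m :: nat
    have "q + 1 / real (Suc m) \<notin> ?T"
    proof
      assume "q + 1 / real (Suc m) \<in> ?T"
      then have "q + 1 / real (Suc m) \<le> q" unfolding q_def by (rule cSup_upper[OF _ bdd])
      then show False by simp
    qed
    then have "P.prob {x \<in> space P. q + 1 / real (Suc m) < overlap 0 1 x} = 0"
      using measure_nonneg[of P "{x \<in> space P. q + 1 / real (Suc m) < overlap 0 1 x}"] by (simp add: less_le)
    then show "AE x in P. \<not> q + 1 / real (Suc m) < overlap 0 1 x"
      by (subst (asm) P.prob_Collect_eq_0) auto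
  qed
  then show "AE x in P. overlap 0 1 x \<le> q"
  proof eventually_elim
    case (elim x)
    show ?case
    proof (rule ccontr)
      assume "\<not> overlap 0 1 x \<le> q"
      then have "0 < overlap 0 1 x - q" by simp
      then obtain m where "1 / real (Suc m) < overlap 0 1 x - q" using nat_approx_posE by blast
      then have "q + 1 / real (Suc m) < overlap 0 1 x" by linarith
      then show False using elim by blast
    qed
  qed
qed

lemma pred_A: "Measurable.pred M (\<lambda>\<omega>. A \<omega> p \<le> c)" "Measurable.pred M (\<lambda>\<omega>. c < A \<omega> p)"
  using measurable_A[of p] unfolding pred_def by measurable

text \<open>An atom drawn by both replicas makes their overlap equal to its self-overlap.\<close>

lemma AE_self_overlap_le: "AE \<omega> in M. \<forall>l. A \<omega> (l, l) \<le> q"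
  unfolding AE_all_countable
proof
  fix l
  have "AE x in P. (\<forall>i<(2::nat). snd x i = (\<lambda>_. l) i) \<longrightarrow> A (fst x) (l, l) \<le> q"
    using AE_overlap_le
  proof (eventually_elim, intro impI)
    fix x :: "'w \<times> (nat \<Rightarrow> nat)"
    assume "overlap 0 1 x \<le> q" and *: "\<forall>i<(2::nat). snd x i = l"
    then have "snd x 0 = l" "snd x 1 = l" by simp_all
    with \<open>overlap 0 1 x \<le> q\<close> show "A (fst x) (l, l) \<le> q" by (simp add: sampled_array_def)
  qed
  then show "AE \<omega> in M. A \<omega> (l, l) \<le> q" by (rule AE_P_indicesD[OF pred_A(1)])
qed

lemma AE_self_overlap_gt:
  assumes \<epsilon>: "0 < \<epsilon>"
  shows "AE x in P. q - \<epsilon> < overlap 0 0 x"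
proof -
  let ?f = "\<lambda>x. indicator {..q - \<epsilon>} (overlap 0 0 x) :: real"
  let ?g = "\<lambda>x. indicator {q - \<epsilon> / 2<..} (overlap 0 1 x) :: real"
  have "AE x in P. ?f x * ?g x = 0"
    using AE_P_fst[OF AE_self_overlap_le]
  proof eventually_elim
    case (elim x)
    define a where "a = \<xi> (snd x 0) (fst x)"
    define b where "b = \<xi> (snd x 1) (fst x)"
    have "b \<bullet> b \<le> q" using elim by (simp add: b_def gram_def)
    moreover have "0 \<le> (a - b) \<bullet> (a - b)" by simp
    then have "2 * (a \<bullet> b) \<le> a \<bullet> a + b \<bullet> b" by (simp add: inner_diff inner_commute)
    ultimately have "\<not> (a \<bullet> a \<le> q - \<epsilon> \<and> q - \<epsilon> / 2 < a \<bullet> b)" by linarith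
    then show ?case by (auto simp: overlap_eq a_def b_def indicator_def)
  qed
  then have "(\<integral>x. ?f x * ?g x \<partial>P) = 0" by (rule integral_eq_zero_AE)
  moreover have "(\<integral>x. ?g x \<partial>P) = P.prob {x \<in> space P. q - \<epsilon> / 2 < overlap 0 1 x}"
  proof -
    have "(\<integral>x. ?g x \<partial>P) = (\<integral>x. indicator {x \<in> space P. q - \<epsilon> / 2 < overlap 0 1 x} x \<partial>P)"
      by (intro Bochner_Integration.integral_cong) (auto simp: indicator_def)
    then show ?thesis by simp
  qed
  then have "(\<integral>x. ?g x \<partial>P) \<noteq> 0" using prob_overlap_gt[of "q - \<epsilon> / 2"] \<epsilon> by simp
  ultimately have "(\<integral>x. ?f x \<partial>P) = 0" using self_overlap_independent[of "{..q - \<epsilon>}" "{q - \<epsilon> / 2<..}"] by simp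
  moreover have "integrable P ?f" by (rule P.integrable_const_bound[where B=1]) auto
  ultimately have "AE x in P. ?f x = 0" by (subst (asm) integral_nonneg_eq_0_iff_AE) auto
  then show ?thesis by eventually_elim (auto simp: indicator_def split: if_splits)
qed

text \<open>All atoms lie on one sphere.\<close>

lemma AE_self_overlap: "AE \<omega> in M. \<forall>l. A \<omega> (l, l) = q"
proof -
  have "AE \<omega> in M. \<forall>l. \<forall>m::nat. q - 1 / real (Suc m) < A \<omega> (l, l)"
    unfolding AE_all_countable
  proof (intro allI)
    fix l and m :: nat
    have "AE x in P. q - 1 / real (Suc m) < overlap 0 0 x" by (rule AE_self_overlap_gt) simp
    then have "AE x in P. (\<forall>i<(1::nat). snd x i = (\<lambda>_. l) i) \<longrightarrow> q - 1 / real (Suc m) < A (fst x) (l, l)"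
    proof (eventually_elim, intro impI)
      fix x :: "'w \<times> (nat \<Rightarrow> nat)"
      assume "q - 1 / real (Suc m) < overlap 0 0 x" and "\<forall>i<(1::nat). snd x i = l"
      then show "q - 1 / real (Suc m) < A (fst x) (l, l)" by (simp add: sampled_array_def)
    qed
    then show "AE \<omega> in M. q - 1 / real (Suc m) < A \<omega> (l, l)" by (rule AE_P_indicesD[OF pred_A(2)])
  qed
  then show ?thesis
    using AE_self_overlap_le
  proof eventually_elim
    case (elim \<omega>)
    show ?case
    proof
      fix l
      have "q \<le> A \<omega> (l, l)"
      proof (rule ccontr)
        assume "\<not> q \<le> A \<omega> (l, l)"
        then have "0 < q - A \<omega> (l, l)" by simp
        then obtain m where "1 / real (Suc m) < q - A \<omega> (l, l)" using nat_approx_posE by blast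
        moreover have "q - 1 / real (Suc m) < A \<omega> (l, l)" using elim(1) by blast
        ultimately show False by linarith
      qed
      then show "A \<omega> (l, l) = q" using elim(2) by (simp add: antisym)
    qed
  qed
qed

lemma AE_A_eq_q_iff: "AE \<omega> in M. \<forall>l l'. A \<omega> (l, l') = q \<longleftrightarrow> l = l'"
  using AE_self_overlap AE_inj_atoms
proof (eventually_elim, intro allI)
  fix \<omega> l l'
  assume diag: "\<forall>l. A \<omega> (l, l) = q" and inj: "inj (\<lambda>l. \<xi> l \<omega>)"
  show "A \<omega> (l, l') = q \<longleftrightarrow> l = l'"
  proof
    assume "A \<omega> (l, l') = q"
    then have "\<xi> l \<omega> \<bullet> \<xi> l' \<omega> = q" by (simp add: gram_def)
    moreover have "\<xi> l \<omega> \<bullet> \<xi> l \<omega> = q" "\<xi> l' \<omega> \<bullet> \<xi> l' \<omega> = q"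
      using diag[rule_format, of l] diag[rule_format, of l'] by (simp_all add: gram_def)
    ultimately have "(\<xi> l \<omega> - \<xi> l' \<omega>) \<bullet> (\<xi> l \<omega> - \<xi> l' \<omega>) = 0"
      by (simp add: inner_diff_left inner_diff_right inner_commute[of "\<xi> l' \<omega>" "\<xi> l \<omega>"])
    then show "l = l'" using injD[OF inj, of l l'] by simp
  qed (use diag in simp)
qed

text \<open>The value \<open>q\<close> marks the diagonal of the Gram matrix, which almost surely is the case. Elsewhere
  \<open>A'\<close> replaces the Gram matrix by a constant array with this property.\<close>

definition separates :: "'w \<Rightarrow> bool" where
  "separates \<omega> \<longleftrightarrow> (\<forall>l l'. A \<omega> (l, l') = q \<longleftrightarrow> l = l')"

definition A' :: "'w \<Rightarrow> nat \<times> nat \<Rightarrow> real" where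
  "A' \<omega> = (if separates \<omega> then A \<omega> else (\<lambda>(l, l'). if l = l' then q else q - 1))"

lemma AE_A'_eq: "AE \<omega> in M. A' \<omega> = A \<omega>"
  using AE_A_eq_q_iff by eventually_elim (simp add: A'_def separates_def)

lemma measurable_A': "(\<lambda>\<omega>. A' \<omega> p) \<in> borel_measurable M"
proof -
  have "Measurable.pred M (\<lambda>\<omega>. A \<omega> (l, l') = q)" "Measurable.pred M (\<lambda>\<omega>. A \<omega> (l, l') \<noteq> q)" for l l'
    unfolding pred_def
    by (rule borel_measurable_eq[OF measurable_A borel_measurable_const],
        rule borel_measurable_neq[OF measurable_A borel_measurable_const])
  then have "Measurable.pred M (\<lambda>\<omega>. A \<omega> (l, l') = q \<longleftrightarrow> l = l')" for l l'
    by (cases "l = l'") simp_all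
  then have "Measurable.pred M separates"
    unfolding separates_def by (intro pred_intros_countable)
  then have "(\<lambda>\<omega>. if separates \<omega> then A \<omega> p else (case p of (l, l') \<Rightarrow> if l = l' then q else q - 1)) \<in> borel_measurable M"
    by (intro measurable_If measurable_A) (auto simp: pred_def)
  moreover have "A' \<omega> p = (if separates \<omega> then A \<omega> p else (case p of (l, l') \<Rightarrow> if l = l' then q else q - 1))" for \<omega>
    by (simp add: A'_def)
  ultimately show ?thesis by simp
qed

lemma A'_eq_q_iff: "A' \<omega> (l, l') = q \<longleftrightarrow> l = l'"
  by (simp add: A'_def separates_def)

sublocale A': gg_array M v A' q
proof
  fix n and f :: "(nat \<times> nat \<Rightarrow> real) \<Rightarrow> real"
  assume n: "2 \<le> n" and f [measurable]: "f \<in> borel_measurable (finite_array n)"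
    and bdd: "bounded (f ` space (finite_array n))"
  have ae: "AE x in P. sampled_array A' x = sampled_array A x \<and> (\<forall>l. indicator {q} (overlap 0 l x) = (of_bool (snd x 0 = snd x l) :: real))"
    using AE_P_fst[OF AE_A'_eq]
  proof eventually_elim
    case (elim x)
    then have "sampled_array A' x = sampled_array A x" by (simp add: sampled_array_def)
    moreover have "overlap 0 l x = q \<longleftrightarrow> snd x 0 = snd x l" for l
      using A'_eq_q_iff[of "fst x" "snd x 0" "snd x l"] elim by (simp add: sampled_array_def)
    ultimately show ?case by (auto simp: indicator_def)
  qed
  have [measurable]: "(\<lambda>x. f (corner n (sampled_array A x))) \<in> borel_measurable \<Omega>"
    by (rule measurable_compose[OF measurable_corner_overlap f])
  have [measurable]: "(\<lambda>x. f (corner n (sampled_array A' x))) \<in> borel_measurable \<Omega>"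
    by (rule measurable_compose[OF _ f], rule measurable_restrict, rule measurable_sampled_array_component[OF measurable_A'])
  have 1: "(\<integral>x. f (corner n (sampled_array A' x)) * of_bool (snd x 0 = snd x l) \<partial>P)
      = (\<integral>x. f (corner n (sampled_array A x)) * indicator {q} (overlap 0 l x) \<partial>P)" for l
  proof (rule integral_cong_AE)
    show "AE x in P. f (corner n (sampled_array A' x)) * of_bool (snd x 0 = snd x l)
        = f (corner n (sampled_array A x)) * indicator {q} (overlap 0 l x)"
      using ae by eventually_elim simp
  qed measurable
  have 2: "(\<integral>x. f (corner n (sampled_array A' x)) \<partial>P) = (\<integral>x. f (corner n (sampled_array A x)) \<partial>P)"
  proof (rule integral_cong_AE)
    show "AE x in P. f (corner n (sampled_array A' x)) = f (corner n (sampled_array A x))"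
      using ae by eventually_elim simp
  qed measurable
  have 3: "(\<integral>x. of_bool (snd x 0 = snd x 1) \<partial>P) = (\<integral>x. indicator {q} (overlap 0 1 x) \<partial>P :: real)"
  proof (rule integral_cong_AE)
    show "AE x in P. of_bool (snd x 0 = snd x 1) = (indicator {q} (overlap 0 1 x) :: real)"
      using ae by eventually_elim simp
  qed measurable
  have "bounded (range (indicator {q} :: real \<Rightarrow> real))"
    by (auto simp: bounded_iff indicator_def intro!: exI[of _ 1])
  then have "(\<integral>x. f (corner n (sampled_array A x)) * indicator {q} (overlap 0 n x) \<partial>P) =
      1 / real n * (\<integral>x. f (corner n (sampled_array A x)) \<partial>P) * (\<integral>x. indicator {q} (overlap 0 1 x) \<partial>P)
      + 1 / real n * (\<Sum>l = 1..<n. \<integral>x. f (corner n (sampled_array A x)) * indicator {q} (overlap 0 l x) \<partial>P)"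
    by (intro GG_atoms[OF n f bdd]) auto
  then show "(\<integral>x. f (corner n (sampled_array A' x)) * of_bool (snd x 0 = snd x n) \<partial>P) =
      1 / real n * (\<integral>x. f (corner n (sampled_array A' x)) \<partial>P) * (\<integral>x. of_bool (snd x 0 = snd x 1) \<partial>P)
      + 1 / real n * (\<Sum>l = 1..<n. \<integral>x. f (corner n (sampled_array A' x)) * of_bool (snd x 0 = snd x l) \<partial>P)"
    by (simp only: 1 2 3)
qed (rule measurable_A' A'_eq_q_iff)+

lemma measurable_array_A: "A \<in> M \<rightarrow>\<^sub>M array_borel"
  by (rule measurable_PiM_single'[where f="\<lambda>p \<omega>. A \<omega> p"]) (auto simp: space_PiM intro: measurable_A)

lemma weakly_exchangeable_gram: "weakly_exchangeable M A"
  unfolding weakly_exchangeable_def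
proof (intro conjI allI impI measurable_array_A)
  fix \<rho> :: "nat \<Rightarrow> nat" assume "permutation \<rho>"
  then have \<rho>: "inj \<rho>" using permutation_bijective bij_is_inj by blast
  have meas: "(\<lambda>\<omega> (l, l'). A \<omega> (\<rho> l, \<rho> l')) \<in> M \<rightarrow>\<^sub>M array_borel"
    by (rule measurable_PiM_single'[where f="\<lambda>p \<omega>. case p of (l, l') \<Rightarrow> A \<omega> (\<rho> l, \<rho> l')"])
       (auto simp: space_PiM intro: measurable_A)
  have "distr M array_borel (\<lambda>\<omega> (l, l'). A \<omega> (\<rho> l, \<rho> l')) = distr M array_borel (A'.reindexed \<rho>)"
  proof (rule distr_cong_AE[OF refl refl _ meas A'.measurable_reindexed])
    show "AE \<omega> in M. (\<lambda>(l, l'). A \<omega> (\<rho> l, \<rho> l')) = A'.reindexed \<rho> \<omega>"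
      using AE_A'_eq by eventually_elim (simp add: A'.reindexed_def)
  qed
  also have "\<dots> = distr M array_borel A'" by (rule A'.reindexed_same_law[OF \<rho>])
  also have "\<dots> = distr M array_borel A"
    by (rule distr_cong_AE[OF refl refl AE_A'_eq A'.measurable_array measurable_array_A])
  finally show "distr M array_borel (\<lambda>\<omega> (l, l'). A \<omega> (\<rho> l, \<rho> l')) = distr M array_borel A" .
qed

lemma gram_independent:
  assumes X [measurable]: "X \<in> sets array_borel" and C [measurable]: "C \<in> sets seq_borel"
  shows "prob {\<omega> \<in> space M. A \<omega> \<in> X \<and> (\<lambda>l. v l \<omega>) \<in> C}
    = prob {\<omega> \<in> space M. A \<omega> \<in> X} * prob {\<omega> \<in> space M. (\<lambda>l. v l \<omega>) \<in> C}"
proof -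
  note [measurable] = measurable_array_A A'.measurable_array A'.measurable_weights
  have "prob {\<omega> \<in> space M. A \<omega> \<in> X \<and> (\<lambda>l. v l \<omega>) \<in> C} = prob {\<omega> \<in> space M. A' \<omega> \<in> X \<and> (\<lambda>l. v l \<omega>) \<in> C}"
    by (rule prob_eq_AE) (use AE_A'_eq in eventually_elim, simp, measurable)
  also have "\<dots> = prob {\<omega> \<in> space M. A' \<omega> \<in> X} * prob {\<omega> \<in> space M. (\<lambda>l. v l \<omega>) \<in> C}"
    by (rule A'.array_independent[OF X C])
  also have "prob {\<omega> \<in> space M. A' \<omega> \<in> X} = prob {\<omega> \<in> space M. A \<omega> \<in> X}"
    by (rule prob_eq_AE) (use AE_A'_eq in eventually_elim, simp, measurable)
  finally show ?thesis .
qed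

end

text \<open>The averages over replicas drawn from the random measure are integrals over the joint law of
  the weights, the atoms and the indices of the replicas.\<close>

lemma mean_average_sample_law:
  fixes \<xi> :: "nat \<Rightarrow> 'w \<Rightarrow> 'h::{real_inner, polish_space}"
  assumes "random_weights M v" "random_weights M v'"
    and eq: "AE \<omega> in M. \<forall>l. v l \<omega> = v' l \<omega>"
    and \<xi>: "\<And>l. \<xi> l \<in> borel_measurable M"
    and F [measurable]: "F \<in> borel_measurable (\<Pi>\<^sub>M l\<in>(UNIV :: nat set). borel)" and bound: "\<And>\<sigma>. \<bar>F \<sigma>\<bar> \<le> C"
  shows "mean_average M (\<lambda>\<omega>. atomic_measure (\<lambda>l. v l \<omega>) (\<lambda>l. \<xi> l \<omega>)) F
    = (\<integral>x. F (\<lambda>i. \<xi> (snd x i) (fst x)) \<partial>sample_law M v')"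
proof -
  interpret v: random_weights M v by fact
  interpret v': random_weights M v' by fact
  have repl: "(\<lambda>x i. \<xi> (snd x i) (fst x)) \<in> M \<Otimes>\<^sub>M index_seq \<rightarrow>\<^sub>M (\<Pi>\<^sub>M l\<in>(UNIV :: nat set). borel)"
  proof (rule measurable_PiM_single')
    fix i :: nat
    have "(\<lambda>x. \<xi> l (fst x)) \<in> M \<Otimes>\<^sub>M index_seq \<rightarrow>\<^sub>M borel" for l
      by (rule measurable_compose[OF measurable_fst \<xi>])
    then show "(\<lambda>x. \<xi> (snd x i) (fst x)) \<in> M \<Otimes>\<^sub>M index_seq \<rightarrow>\<^sub>M borel"
      by (rule measurable_compose_countable[where f="\<lambda>l x. \<xi> l (fst x)"]) measurable
  qed (simp add: space_PiM)
  have H: "(\<lambda>x. F (\<lambda>i. \<xi> (snd x i) (fst x))) \<in> borel_measurable (M \<Otimes>\<^sub>M index_seq)"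
    by (rule measurable_compose[OF repl F])
  have avg: "replica_average (atomic_measure (\<lambda>l. v l \<omega>) (\<lambda>l. \<xi> l \<omega>)) F = (\<integral>\<iota>. F (\<lambda>i. \<xi> (\<iota> i) \<omega>) \<partial>sample_kernel v \<omega>)"
    if \<omega>: "\<omega> \<in> space M" for \<omega>
  proof -
    have m: "(\<lambda>\<iota> i. \<xi> (\<iota> i) \<omega>) \<in> sample_kernel v \<omega> \<rightarrow>\<^sub>M (\<Pi>\<^sub>M l\<in>(UNIV :: nat set). borel)"
    proof (rule measurable_PiM_single')
      fix i :: nat
      have "(\<lambda>\<iota>. \<iota> i) \<in> sample_kernel v \<omega> \<rightarrow>\<^sub>M count_space UNIV"
        by (subst measurable_cong_sets[OF sets_sample_kernel refl]) simp
      then show "(\<lambda>\<iota>. \<xi> (\<iota> i) \<omega>) \<in> sample_kernel v \<omega> \<rightarrow>\<^sub>M borel"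
        by (rule measurable_compose) simp
    qed (simp add: space_PiM)
    have "replica_average (atomic_measure (\<lambda>l. v l \<omega>) (\<lambda>l. \<xi> l \<omega>)) F
        = (\<integral>\<sigma>. F \<sigma> \<partial>distr (sample_kernel v \<omega>) (\<Pi>\<^sub>M l\<in>UNIV. borel) (\<lambda>\<iota> i. \<xi> (\<iota> i) \<omega>))"
      unfolding replica_average_def by (simp only: PiM_atomic_measure[OF v.prob_space_index_law[OF \<omega>]])
    also have "\<dots> = (\<integral>\<iota>. F (\<lambda>i. \<xi> (\<iota> i) \<omega>) \<partial>sample_kernel v \<omega>)"
      by (rule integral_distr[OF m F])
    finally show ?thesis .
  qed
  have "mean_average M (\<lambda>\<omega>. atomic_measure (\<lambda>l. v l \<omega>) (\<lambda>l. \<xi> l \<omega>)) F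
      = (\<integral>\<omega>. \<integral>\<iota>. F (\<lambda>i. \<xi> (\<iota> i) \<omega>) \<partial>sample_kernel v \<omega> \<partial>M)"
    unfolding mean_average_def by (intro Bochner_Integration.integral_cong avg refl)
  also have "\<dots> = (\<integral>\<omega>. \<integral>\<iota>. F (\<lambda>i. \<xi> (\<iota> i) \<omega>) \<partial>sample_kernel v' \<omega> \<partial>M)"
  proof (rule integral_cong_AE)
    show "AE \<omega> in M. (\<integral>\<iota>. F (\<lambda>i. \<xi> (\<iota> i) \<omega>) \<partial>sample_kernel v \<omega>) = (\<integral>\<iota>. F (\<lambda>i. \<xi> (\<iota> i) \<omega>) \<partial>sample_kernel v' \<omega>)"
      using eq by eventually_elim (simp add: index_law_def)
  qed (use v.measurable_sample_integral[OF H] v'.measurable_sample_integral[OF H] in simp_all)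
  also have "\<dots> = (\<integral>x. F (\<lambda>i. \<xi> (snd x i) (fst x)) \<partial>sample_law M v')"
    using v'.integral_P[OF H bound] by simp
  finally show ?thesis .
qed

lemma gg_atoms_of_ghirlanda_guerra:
  fixes \<xi> :: "nat \<Rightarrow> 'w \<Rightarrow> 'h::{real_inner, polish_space}"
  assumes "random_weights M v" "positive_weights M v'"
    and eq: "AE \<omega> in M. \<forall>l. v l \<omega> = v' l \<omega>"
    and \<xi>: "\<And>l. \<xi> l \<in> borel_measurable M"
    and ball: "AE \<omega> in M. \<forall>l. \<xi> l \<omega> \<in> cball 0 1" and inj: "AE \<omega> in M. inj (\<lambda>l. \<xi> l \<omega>)"
    and gg: "ghirlanda_guerra M (\<lambda>\<omega>. atomic_measure (\<lambda>l. v l \<omega>) (\<lambda>l. \<xi> l \<omega>))"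
  shows "gg_atoms M v' \<xi>"
proof -
  interpret v': positive_weights M v' by fact
  have rw: "random_weights M v'" by unfold_locales
  show ?thesis
  proof
    fix n and f :: "(nat \<times> nat \<Rightarrow> real) \<Rightarrow> real" and \<psi> :: "real \<Rightarrow> real"
    assume n: "2 \<le> n" and f: "f \<in> borel_measurable (finite_array n)" "bounded (f ` space (finite_array n))"
      and \<psi>: "\<psi> \<in> borel_measurable borel" "bounded (range \<psi>)"
    note [measurable] = \<psi>(1)
    obtain Cf where Cf: "\<And>R. R \<in> space (finite_array n) \<Longrightarrow> \<bar>f R\<bar> \<le> Cf" using f(2) by (auto simp: bounded_iff)
    obtain C\<psi> where C\<psi>: "\<And>t. \<bar>\<psi> t\<bar> \<le> C\<psi>" using \<psi>(2) by (auto simp: bounded_iff)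
    let ?B = "\<Pi>\<^sub>M l\<in>(UNIV :: nat set). (borel :: 'h measure)"
    have gram_m: "(\<lambda>\<sigma>. gram \<sigma> p) \<in> borel_measurable ?B" for p :: "nat \<times> nat"
      unfolding gram_def case_prod_beta' by measurable
    have "(\<lambda>\<sigma>. corner n (gram \<sigma>)) \<in> ?B \<rightarrow>\<^sub>M finite_array n"
      by (rule measurable_restrict, rule gram_m)
    from measurable_compose[OF this f(1)]
    have Fm [measurable]: "(\<lambda>\<sigma>. f (corner n (gram \<sigma>))) \<in> borel_measurable ?B" .
    have \<psi>m [measurable]: "(\<lambda>\<sigma>. \<psi> (\<sigma> 0 \<bullet> \<sigma> l)) \<in> borel_measurable ?B" for l :: nat by measurable
    have Fb: "\<bar>f (corner n (gram \<sigma>))\<bar> \<le> Cf" for \<sigma> :: "nat \<Rightarrow> 'h" by (rule Cf) (simp add: space_PiM)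
    have S: "gram (\<lambda>i. \<xi> (snd x i) (fst x)) = sampled_gram \<xi> x" for x
      by (simp add: gram_def sampled_array_def fun_eq_iff)
    have S': "\<xi> (snd x i) (fst x) \<bullet> \<xi> (snd x j) (fst x) = sampled_gram \<xi> x (i, j)" for x i j
      by (simp add: gram_def sampled_array_def)
    let ?G = "\<lambda>\<omega>. atomic_measure (\<lambda>l. v l \<omega>) (\<lambda>l. \<xi> l \<omega>)"
    note avg = mean_average_sample_law[OF assms(1) rw eq \<xi>]
    have a1: "mean_average M ?G (\<lambda>\<sigma>. f (corner n (gram \<sigma>)) * \<psi> (\<sigma> 0 \<bullet> \<sigma> l))
        = (\<integral>x. f (corner n (sampled_gram \<xi> x)) * \<psi> (sampled_gram \<xi> x (0, l)) \<partial>sample_law M v')" for l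
      by (subst avg[where C="Cf * C\<psi>"]) (use Fb C\<psi> in \<open>auto intro: abs_mult_le_mult simp: S S'\<close>)
    have a2: "mean_average M ?G (\<lambda>\<sigma>. f (corner n (gram \<sigma>)))
        = (\<integral>x. f (corner n (sampled_gram \<xi> x)) \<partial>sample_law M v')"
      by (subst avg[where C="Cf"]) (use Fb in \<open>auto simp: S\<close>)
    have a3: "mean_average M ?G (\<lambda>\<sigma>. \<psi> (\<sigma> 0 \<bullet> \<sigma> 1))
        = (\<integral>x. \<psi> (sampled_gram \<xi> x (0, 1)) \<partial>sample_law M v')"
      by (subst avg[where C="C\<psi>"]) (use C\<psi> in \<open>auto simp: S'\<close>)
    have "mean_average M ?G (\<lambda>\<sigma>. f (corner n (gram \<sigma>)) * \<psi> (\<sigma> 0 \<bullet> \<sigma> n)) =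
        1 / real n * mean_average M ?G (\<lambda>\<sigma>. f (corner n (gram \<sigma>))) * mean_average M ?G (\<lambda>\<sigma>. \<psi> (\<sigma> 0 \<bullet> \<sigma> 1))
        + 1 / real n * (\<Sum>l = 1..<n. mean_average M ?G (\<lambda>\<sigma>. f (corner n (gram \<sigma>)) * \<psi> (\<sigma> 0 \<bullet> \<sigma> l)))"
      using gg n f \<psi> unfolding ghirlanda_guerra_def Let_def by blast
    then show "(\<integral>x. f (corner n (sampled_gram \<xi> x)) * \<psi> (sampled_gram \<xi> x (0, n)) \<partial>sample_law M v') =
        1 / real n * (\<integral>x. f (corner n (sampled_gram \<xi> x)) \<partial>sample_law M v')
          * (\<integral>x. \<psi> (sampled_gram \<xi> x (0, 1)) \<partial>sample_law M v')
        + 1 / real n * (\<Sum>l = 1..<n. \<integral>x. f (corner n (sampled_gram \<xi> x))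
            * \<psi> (sampled_gram \<xi> x (0, l)) \<partial>sample_law M v')"
      unfolding a1 a2 a3 .
  qed (fact \<xi> ball inj)+
qed

lemma positive_weights_modification:
  assumes "random_weights M v"
    and pos: "AE \<omega> in M. \<forall>l. v l \<omega> > 0" and dec: "AE \<omega> in M. decseq (\<lambda>l. v l \<omega>)"
  obtains v' where "positive_weights M v'" "AE \<omega> in M. \<forall>l. v l \<omega> = v' l \<omega>"
proof -
  interpret v: random_weights M v by fact
  define good where "good \<omega> \<longleftrightarrow> (\<forall>l. 0 < v l \<omega>) \<and> (\<forall>l. v (Suc l) \<omega> \<le> v l \<omega>)" for \<omega>
  define v' where "v' l \<omega> = (if good \<omega> then v l \<omega> else (1 / 2) ^ Suc l)" for l \<omega>
  have [measurable]: "Measurable.pred M good" unfolding good_def by measurable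
  have "AE \<omega> in M. good \<omega>" using pos dec by eventually_elim (auto simp: good_def decseq_Suc_iff)
  then have eq: "AE \<omega> in M. \<forall>l. v l \<omega> = v' l \<omega>" by eventually_elim (simp add: v'_def)
  have half: "emeasure (density (count_space UNIV) (\<lambda>l. ennreal ((1 / 2) ^ Suc l))) UNIV = 1"
  proof -
    have "(\<Sum>l. ennreal ((1 / 2) ^ Suc l)) = ennreal (\<Sum>l. (1 / 2) ^ Suc l)"
      by (rule suminf_ennreal2) (use power_half_series in \<open>auto simp: sums_iff\<close>)
    also have "(\<Sum>l. (1 / 2 :: real) ^ Suc l) = 1" using power_half_series by (simp add: sums_iff)
    finally show ?thesis by (simp add: emeasure_density nn_integral_count_space_nat)
  qed
  have "positive_weights M v'"
  proof (intro positive_weights.intro random_weights.intro random_weights_axioms.intro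
      positive_weights_axioms.intro v.prob_space_axioms)
    show "v' l \<in> borel_measurable M" for l unfolding v'_def [abs_def] by measurable
    show "prob_space (index_law v' \<omega>)" if "\<omega> \<in> space M" for \<omega>
    proof (cases "good \<omega>")
      case True
      then have "index_law v' \<omega> = index_law v \<omega>" by (simp add: index_law_def v'_def)
      then show ?thesis using v.prob_space_index_law[OF that] by simp
    next
      case False
      then show ?thesis using half by (intro prob_spaceI) (simp add: index_law_def v'_def)
    qed
    show "0 < v' l \<omega>" for l \<omega> by (simp add: v'_def good_def)
    show "decseq (\<lambda>l. v' l \<omega>)" for \<omega>
      by (cases "good \<omega>") (auto simp: v'_def good_def decseq_Suc_iff)
  qed
  then show ?thesis using eq by (rule that)
qed

lemma Int_stable_preimages: "Int_stable {Y -` X \<inter> S | X. X \<in> sets N}"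
proof (rule Int_stableI)
  fix a b assume "a \<in> {Y -` X \<inter> S | X. X \<in> sets N}" "b \<in> {Y -` X \<inter> S | X. X \<in> sets N}"
  then obtain X X' where X: "X \<in> sets N" "X' \<in> sets N" "a = Y -` X \<inter> S" "b = Y -` X' \<inter> S" by blast
  then have "a \<inter> b = Y -` (X \<inter> X') \<inter> S" by auto
  then show "a \<inter> b \<in> {Y -` X \<inter> S | X. X \<in> sets N}" using X(1,2) by blast
qed

theorem theorem4:
  fixes M :: "'w measure"
    and v :: "nat \<Rightarrow> 'w \<Rightarrow> real"
    and \<xi> :: "nat \<Rightarrow> 'w \<Rightarrow> 'h::{real_inner, polish_space}"
    and G :: "'w \<Rightarrow> 'h measure"
    and Q :: "'w \<Rightarrow> nat \<times> nat \<Rightarrow> real"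
  defines "G \<equiv> \<lambda>\<omega>. atomic_measure (\<lambda>l. v l \<omega>) (\<lambda>l. \<xi> l \<omega>)"
    and "Q \<equiv> \<lambda>\<omega>. gram (\<lambda>l. \<xi> l \<omega>)"
  assumes "prob_space M"
    and "\<And>l. v l \<in> borel_measurable M"
    and "\<And>l. \<xi> l \<in> borel_measurable M"
    and "\<And>\<omega>. \<omega> \<in> space M \<Longrightarrow> prob_space (G \<omega>)"
    and "AE \<omega> in M. \<forall>l. v l \<omega> > 0"
    and "AE \<omega> in M. decseq (\<lambda>l. v l \<omega>)"
    and "AE \<omega> in M. \<forall>l. \<xi> l \<omega> \<in> cball 0 1"
    and "AE \<omega> in M. inj (\<lambda>l. \<xi> l \<omega>)"
    and "ghirlanda_guerra M G"
  shows "weakly_exchangeable M Q \<and> indep_rv M array_borel Q seq_borel (\<lambda>\<omega> l. v l \<omega>)"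
proof -
  interpret prob_space M by fact
  have rw: "random_weights M v"
    using assms(3,4,6)
    by (intro random_weights.intro random_weights_axioms.intro) (simp_all add: G_def prob_space_index_law_iff)
  obtain v' where v': "positive_weights M v'" and eq: "AE \<omega> in M. \<forall>l. v l \<omega> = v' l \<omega>"
    using positive_weights_modification[OF rw assms(7,8)] by blast
  interpret gg_atoms M v' \<xi>
    using gg_atoms_of_ghirlanda_guerra[OF rw v' eq assms(5,9,10)] assms(11) by (simp add: G_def)
  have Q: "Q \<in> M \<rightarrow>\<^sub>M array_borel" using measurable_array_A by (simp add: Q_def)
  have v: "(\<lambda>\<omega> l. v l \<omega>) \<in> M \<rightarrow>\<^sub>M seq_borel"
    by (rule measurable_PiM_single') (auto simp: space_PiM assms(4))
  note [measurable] = Q v A'.measurable_weights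
  have prod: "prob {\<omega> \<in> space M. Q \<omega> \<in> X \<and> (\<lambda>l. v l \<omega>) \<in> C}
      = prob {\<omega> \<in> space M. Q \<omega> \<in> X} * prob {\<omega> \<in> space M. (\<lambda>l. v l \<omega>) \<in> C}"
    if [measurable]: "X \<in> sets array_borel" "C \<in> sets seq_borel" for X C
  proof -
    have "prob {\<omega> \<in> space M. Q \<omega> \<in> X \<and> (\<lambda>l. v l \<omega>) \<in> C} = prob {\<omega> \<in> space M. Q \<omega> \<in> X \<and> (\<lambda>l. v' l \<omega>) \<in> C}"
      by (rule prob_eq_AE) (use eq in eventually_elim, simp, measurable)
    also have "\<dots> = prob {\<omega> \<in> space M. Q \<omega> \<in> X} * prob {\<omega> \<in> space M. (\<lambda>l. v' l \<omega>) \<in> C}"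
      using gram_independent[OF that] by (simp add: Q_def)
    also have "prob {\<omega> \<in> space M. (\<lambda>l. v' l \<omega>) \<in> C} = prob {\<omega> \<in> space M. (\<lambda>l. v l \<omega>) \<in> C}"
      by (rule prob_eq_AE) (use eq in eventually_elim, simp, measurable)
    finally show ?thesis .
  qed
  let ?V = "\<lambda>\<omega> l. v l \<omega>"
  have "indep_set {Q -` X \<inter> space M | X. X \<in> sets array_borel} {?V -` C \<inter> space M | C. C \<in> sets seq_borel}"
  proof (rule indep_setI)
    show "{Q -` X \<inter> space M | X. X \<in> sets array_borel} \<subseteq> events" using measurable_sets[OF Q] by auto
    show "{?V -` C \<inter> space M | C. C \<in> sets seq_borel} \<subseteq> events" using measurable_sets[OF v] by auto
    fix a b
    assume "a \<in> {Q -` X \<inter> space M | X. X \<in> sets array_borel}" "b \<in> {?V -` C \<inter> space M | C. C \<in> sets seq_borel}"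
    then obtain X C where X: "X \<in> sets array_borel" "a = Q -` X \<inter> space M"
      and C: "C \<in> sets seq_borel" "b = ?V -` C \<inter> space M" by blast
    have "a \<inter> b = {\<omega> \<in> space M. Q \<omega> \<in> X \<and> ?V \<omega> \<in> C}" "a = {\<omega> \<in> space M. Q \<omega> \<in> X}" "b = {\<omega> \<in> space M. ?V \<omega> \<in> C}"
      using X(2) C(2) by auto
    then show "prob (a \<inter> b) = prob a * prob b" using prod[OF X(1) C(1)] by (simp only:)
  qed
  then have "indep_set (sigma_sets (space M) {Q -` X \<inter> space M | X. X \<in> sets array_borel})
      (sigma_sets (space M) {?V -` C \<inter> space M | C. C \<in> sets seq_borel})"
    by (rule indep_set_sigma_sets[OF _ Int_stable_preimages Int_stable_preimages])
  then have "indep_rv M array_borel Q seq_borel ?V" using Q v by (simp add: indep_rv_def)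
  then show ?thesis using weakly_exchangeable_gram by (simp add: Q_def)
qed

end
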